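(* Let $(J,W)$ be a pure graphon, and let $a_1,\dots,a_k,b_1,\dots,b_k\in J$. Then there exists an automorphism $\varphi$ of $(J,W)$ with $a_i^\varphi=b_i$ for $i=1,\dots,k$ if and only if $t_{a_1\dots a_k}(F,W)=t_{b_1\dots b_k}(F,W)$ for every $k$-labeled simple graph $F$ in which the labeled nodes are pairwise nonadjacent.
   Context: A graphon is a pair $(J,W)$ where $J$ is a standard probability space with probability measure $\pi$ and $W:J\times J\to[0,1]$ is a symmetric measurable function with every section $W(x,\cdot)$ measurable. $r_W(x,y)=\int_J|W(x,z)-W(y,z)|\,d\pi(z)$. The graphon is pure if $r_W$ is a metric on $J$, $(J,r_W)$ is complete, and $\pi$ has full support. An automorphism of a pure graphon $(J,W)$ is a measure preserving bijection $\sigma:J\to J$ such that for every $x\in J$, $W(x^\sigma,y^\sigma)=W(x,y)$ for almost all $y\in J$. A $k$-labeled graph $F=(V,E)$ is a graph with $k$ distinct nodes labeled $1,\dots,k$ (identify them with $[k]\subseteq V$). For $x_1,\dots,x_k\in J$ the restricted homomorphism density is $t_{x_1\dots x_k}(F,W)=\int_{J^{V\setminus[k]}}\prod_{ij\in E}W(x_i,x_j)\prod_{i\in V\setminus[k]}d\pi(x_i)$. *)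

theory Defs
  imports "HOL-Probability.Probability"
begin

definition polish_topology :: "'a topology \<Rightarrow> bool" where
  "polish_topology T \<longleftrightarrow> completely_metrizable_space T \<and> second_countable T"

definition standard_borel :: "'a measure \<Rightarrow> bool" where
  "standard_borel N \<longleftrightarrow> (\<exists>T. polish_topology T \<and> space N = topspace T \<and>
      sets N = sigma_sets (topspace T) {U. openin T U})"

text \<open>
  Standard probability spaces in the sense of Lebesgue and Rokhlin: complete, and up to a null
  set the completion of a Borel probability measure on a Polish space. The restriction to a set
  \<open>X\<close> of probability 1 is the usual ``modulo null sets''.
\<close>

definition standard_prob_space :: "'a measure \<Rightarrow> bool" where
  "standard_prob_space M \<longleftrightarrow> prob_space M \<and> complete_measure M \<and>
     (\<exists>X\<in>sets M. emeasure M X = 1 \<and>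
        (\<exists>N. standard_borel N \<and> restrict_space M X = completion N))"

text \<open>
  Joint measurability of \<open>W\<close> is with respect to the completed product; therefore
  measurability of the individual sections is a separate requirement.
\<close>

definition graphon :: "'a measure \<Rightarrow> ('a \<Rightarrow> 'a \<Rightarrow> real) \<Rightarrow> bool" where
  "graphon M W \<longleftrightarrow> standard_prob_space M \<and>
     (\<forall>x\<in>space M. \<forall>y\<in>space M. 0 \<le> W x y \<and> W x y \<le> 1) \<and>
     (\<forall>x\<in>space M. \<forall>y\<in>space M. W x y = W y x) \<and>
     (\<lambda>(x, y). W x y) \<in> borel_measurable (completion (M \<Otimes>\<^sub>M M)) \<and>
     (\<forall>x\<in>space M. W x \<in> borel_measurable M)"

definition neighborhood_dist :: "'a measure \<Rightarrow> ('a \<Rightarrow> 'a \<Rightarrow> real) \<Rightarrow> 'a \<Rightarrow> 'a \<Rightarrow> real" where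
  "neighborhood_dist M W x y = (\<integral>z. \<bar>W x z - W y z\<bar> \<partial>M)"

text \<open>
  Full support means that every nonempty open set has positive measure. The sets that are open
  for the neighborhood distance of a graphon need not be measurable a priori, but \<open>emeasure\<close> is 0
  outside \<open>sets M\<close>, so positivity entails measurability.
\<close>

definition pure_graphon :: "'a measure \<Rightarrow> ('a \<Rightarrow> 'a \<Rightarrow> real) \<Rightarrow> bool" where
  "pure_graphon M W \<longleftrightarrow> graphon M W \<and>
     Metric_space (space M) (neighborhood_dist M W) \<and>
     Metric_space.mcomplete (space M) (neighborhood_dist M W) \<and>
     (\<forall>U. openin (Metric_space.mtopology (space M) (neighborhood_dist M W)) U \<and> U \<noteq> {}
        \<longrightarrow> emeasure M U > 0)"

definition measure_preserving_bij :: "'a measure \<Rightarrow> ('a \<Rightarrow> 'a) \<Rightarrow> bool" where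
  "measure_preserving_bij M \<sigma> \<longleftrightarrow>
     bij_betw \<sigma> (space M) (space M) \<and> \<sigma> \<in> measurable M M \<and> distr M M \<sigma> = M"

definition graphon_automorphism :: "'a measure \<Rightarrow> ('a \<Rightarrow> 'a \<Rightarrow> real) \<Rightarrow> ('a \<Rightarrow> 'a) \<Rightarrow> bool" where
  "graphon_automorphism M W \<sigma> \<longleftrightarrow> measure_preserving_bij M \<sigma> \<and>
     (\<forall>x\<in>space M. AE y in M. W (\<sigma> x) (\<sigma> y) = W x y)"

text \<open>
  Nodes are natural numbers, which represents every finite graph up to isomorphism; the labeled
  nodes are the numbers 1 to \<open>k\<close> themselves.
\<close>

definition labeled_simple_graph :: "nat \<Rightarrow> nat set \<Rightarrow> nat set set \<Rightarrow> bool" where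
  "labeled_simple_graph k V E \<longleftrightarrow> finite V \<and> {1..k} \<subseteq> V \<and>
     (\<forall>e\<in>E. \<exists>i\<in>V. \<exists>j\<in>V. i \<noteq> j \<and> e = {i, j})"

definition labels_nonadjacent :: "nat \<Rightarrow> nat set set \<Rightarrow> bool" where
  "labels_nonadjacent k E \<longleftrightarrow> (\<forall>i\<in>{1..k}. \<forall>j\<in>{1..k}. {i, j} \<notin> E)"

text \<open>
  The condition \<open>i < j\<close> takes each edge once; by symmetry of \<open>W\<close> the orientation is irrelevant.
  The integral is over the completed product because \<open>W\<close>, and hence the integrand, is
  measurable only with respect to the completion, and a Bochner integral of a nonmeasurable
  function is 0.
\<close>

definition restricted_hom_density ::
  "'a measure \<Rightarrow> ('a \<Rightarrow> 'a \<Rightarrow> real) \<Rightarrow> nat \<Rightarrow> nat set \<Rightarrow> nat set set \<Rightarrow> (nat \<Rightarrow> 'a) \<Rightarrow> real" where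
  "restricted_hom_density M W k V E a =
     (\<integral>y. (let x = override_on y a {1..k} in
             \<Prod>(i, j) | i < j \<and> {i, j} \<in> E. W (x i) (x j))
        \<partial>completion (PiM (V - {1..k}) (\<lambda>_. M)))"

end

theory Submission
  imports Defs
begin

text \<open>
  Let \<open>K x y\<close> be the integral of \<open>W x z * W y z\<close> over \<open>z\<close>. The sup distance of the functions \<open>K x\<close>
  and \<open>K y\<close> defines the same uniformity as the neighborhood distance, so for a dense sequence \<open>u\<close>
  the map \<open>x \<mapsto> (K x (u n))\<^sub>n\<close> is injective and determines the Borel structure.

  Adjoin a random independent sequence \<open>z\<close> to the labels \<open>a\<close> as further roots. All densities of
  graphs with pairwise nonadjacent roots form a family closed under products, whose expectations
  over \<open>z\<close> are the restricted homomorphism densities at \<open>a\<close>. By the moment problem on a cube the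
  family has the same joint law for \<open>a\<close> as for \<open>b\<close>, and inner regularity of the standard space
  gives dense sequences \<open>z\<close>, \<open>z'\<close> with equal densities at \<open>(a, z)\<close> and \<open>(b, z')\<close>.

  Moments again show that \<open>x \<mapsto> (K x (z n))\<^sub>n\<close> and \<open>x \<mapsto> (K x (z' n))\<^sub>n\<close> have the same law, hence, by
  full support and completeness, the same image. Composing one map with the inverse of the other
  gives a measure preserving bijection taking \<open>a\<close> to \<open>b\<close>. It preserves \<open>W\<close> because the moments
  weighted by one edge \<open>W x y\<close> agree as well.
\<close>



text \<open>Moments of a law must again be densities of simple graphs, so gluing two graphs at their
  roots must not create multiple edges; pairwise nonadjacent roots guarantee this. Nonadjacency also
  suits \<open>W\<close>, whose value at a single pair of points an automorphism need not preserve.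
  The price is that \<open>W x (z n)\<close> cannot serve as a coordinate of \<open>x\<close>. The
  path of length two is the simplest graph in which two nonadjacent roots interact, and its density
  is \<open>K\<close>.

  An edge \<open>W x y\<close> becomes admissible only once \<open>x\<close> and \<open>y\<close>
  are averaged, which shows invariance of \<open>W\<close> merely for almost every pair. An
  automorphism has to respect the sections of every \<open>x\<close>; full support closes the gap.

  The other obstacle is measurability. \<open>M\<close> is complete and \<open>W\<close> is
  measurable only for a completed product, while laws, Fubini and coordinates live on Borel sets.
  Hence the Borel restriction \<open>B\<close> of \<open>M\<close> and the Borel version
  \<open>W2\<close> of \<open>W\<close>.\<close>

section \<open>Laws on Polish spaces\<close>

lemma borel_measurable_coordinate: "(\<lambda>x::'i \<Rightarrow> real. x i) \<in> borel_measurable borel"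
  by (rule borel_measurable_continuous_onI, rule continuous_on_product_then_coordinatewise, rule continuous_on_id)

text \<open>Inner regularity is applied to the graph of \<open>g\<close>, since compact subsets of the graph
  project to compact subsets of \<open>g ` D\<close>, which itself need not be Borel.\<close>

lemma compact_subset_image_measurable:
  fixes P :: "'q::polish_space measure" and g :: "'q \<Rightarrow> 'r::polish_space"
  assumes "finite_measure P" and sets_P: "sets P = sets borel"
    and g: "g \<in> borel_measurable borel" and D: "D \<in> sets borel" and "0 < \<epsilon>"
  shows "\<exists>C. compact C \<and> C \<subseteq> g ` D \<and> measure P D - \<epsilon> \<le> measure P (D \<inter> g -` C)"
proof -
  interpret finite_measure P by fact
  define \<Gamma> where "\<Gamma> = {p :: 'q \<times> 'r. fst p \<in> D \<and> snd p = g (fst p)}"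
  define R where "R = distr P borel (\<lambda>x. (x, g x))"
  have [measurable_cong]: "sets P = sets borel" by fact
  note g[measurable] D[measurable]
  have graph[measurable]: "(\<lambda>x. (x, g x)) \<in> borel_measurable P"
    by (simp add: borel_prod[symmetric])
  interpret R: finite_measure R unfolding R_def by (rule finite_measure_distr) fact
  have \<Gamma>[measurable]: "\<Gamma> \<in> sets borel"
  proof -
    have "{p \<in> space (borel \<Otimes>\<^sub>M borel). fst p \<in> D \<and> snd p = g (fst p)} \<in> sets (borel \<Otimes>\<^sub>M borel :: ('q \<times> 'r) measure)"
      by measurable
    then show ?thesis by (simp only: \<Gamma>_def borel_prod space_borel UNIV_I simp_thms)
  qed
  have "emeasure R \<Gamma> = (SUP K\<in>{K. K \<subseteq> \<Gamma> \<and> compact K}. emeasure R K)"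
    by (rule inner_regular) (auto simp: R_def R.emeasure_eq_measure[unfolded R_def])
  then have SUP: "ennreal (measure R \<Gamma>) = (SUP K\<in>{K. K \<subseteq> \<Gamma> \<and> compact K}. emeasure R K)"
    by (simp add: R.emeasure_eq_measure)
  \<comment> \<open>The case distinction keeps the bound nonnegative, so that \<open>ennreal\<close>
    does not truncate it.\<close>
  obtain K where K: "K \<subseteq> \<Gamma>" "compact K" "measure R \<Gamma> - \<epsilon> \<le> measure R K"
  proof (cases "measure R \<Gamma> \<le> \<epsilon>")
    case True
    then show ?thesis using that[of "{}"] by simp
  next
    case False
    then have "ennreal (measure R \<Gamma> - \<epsilon>) < ennreal (measure R \<Gamma>)"
      using \<open>0 < \<epsilon>\<close> by (intro ennreal_lessI) auto
    then obtain K where "K \<subseteq> \<Gamma>" "compact K" "ennreal (measure R \<Gamma> - \<epsilon>) < emeasure R K"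
      unfolding SUP less_SUP_iff by auto
    then show ?thesis
      using False by (intro that[of K]) (auto simp: R.emeasure_eq_measure ennreal_less_iff)
  qed
  have Kb: "K \<in> sets borel" by (rule borel_compact) fact
  have "measure R \<Gamma> = measure P D"
  proof -
    have "(\<lambda>x. (x, g x)) -` \<Gamma> \<inter> space P = D"
      by (auto simp: \<Gamma>_def sets_eq_imp_space_eq[OF sets_P])
    then show ?thesis unfolding R_def by (simp add: measure_distr)
  qed
  moreover have "measure R K = measure P ((\<lambda>x. (x, g x)) -` K)"
    unfolding R_def using Kb by (subst measure_distr) (auto simp: sets_eq_imp_space_eq[OF sets_P])
  moreover have "measure P ((\<lambda>x. (x, g x)) -` K) \<le> measure P (D \<inter> g -` (snd ` K))"
  proof (rule finite_measure_mono)
    show "(\<lambda>x. (x, g x)) -` K \<subseteq> D \<inter> g -` (snd ` K)"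
      using K(1) by (force simp: \<Gamma>_def)
    have "snd ` K \<in> sets borel"
      by (intro borel_compact compact_continuous_image continuous_on_snd continuous_on_id K)
    then show "D \<inter> g -` (snd ` K) \<in> sets P"
      unfolding sets_P using measurable_sets[OF g, of "snd ` K"] D by auto
  qed
  moreover have "measure R \<Gamma> - \<epsilon> \<le> measure R K"
    by (rule K(3))
  ultimately have "measure P D - \<epsilon> \<le> measure P (D \<inter> g -` (snd ` K))" by linarith
  moreover have "compact (snd ` K)" by (intro compact_continuous_image continuous_on_snd continuous_on_id K)
  moreover have "snd ` K \<subseteq> g ` D" using K(1) by (auto simp: \<Gamma>_def)
  ultimately show ?thesis by blast
qed

text \<open>Under the common law the images of \<open>D\<close> under \<open>A\<close> and
  \<open>B\<close> both carry full mass, but they need not be Borel, so they cannot simply be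
  intersected. Compact subsets of them can: two sets of mass at least 2/3 meet, and a common point
  is a value of both maps. Any loss below 1/2 would do in place of 1/3.\<close>

lemma equal_laws_common_value:
  fixes P :: "'q::polish_space measure" and A B :: "'q \<Rightarrow> 'r::polish_space"
  assumes "prob_space P" and sets_P: "sets P = sets borel"
    and A: "A \<in> borel_measurable borel" and B: "B \<in> borel_measurable borel"
    and D: "D \<in> sets borel" and D1: "measure P D = 1"
    and eq: "distr P borel A = distr P borel B"
  shows "\<exists>x\<in>D. \<exists>y\<in>D. A x = B y"
proof (rule ccontr)
  assume none: "\<not> ?thesis"
  interpret prob_space P by fact
  have fin: "finite_measure P" by unfold_locales
  have [measurable_cong]: "sets P = sets borel" by fact
  note A[measurable] B[measurable]
  obtain C where C: "compact C" "C \<subseteq> A ` D" "measure P D - 1/3 \<le> measure P (D \<inter> A -` C)"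
    using compact_subset_image_measurable[OF fin sets_P A D, of "1/3"] by auto
  obtain C' where C': "compact C'" "C' \<subseteq> B ` D" "measure P D - 1/3 \<le> measure P (D \<inter> B -` C')"
    using compact_subset_image_measurable[OF fin sets_P B D, of "1/3"] by auto
  have Cb[measurable]: "C \<in> sets borel" "C' \<in> sets borel" using C C' borel_compact by auto
  have sp: "space P = UNIV" using sets_eq_imp_space_eq[OF sets_P] by simp
  have vA: "A -` C \<in> sets P" using measurable_sets[OF A, of C] by (simp add: sets_P)
  have vB: "B -` C \<in> sets P" "B -` C' \<in> sets P"
    using measurable_sets[OF B, of C] measurable_sets[OF B, of C'] by (simp_all add: sets_P)
  have "measure P (A -` C) = measure P (B -` C)"
    using arg_cong[OF eq, of "\<lambda>m. measure m C"] by (simp add: measure_distr sp)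
  moreover have "measure P (A -` C) \<ge> 2/3"
    using C(3) D1 finite_measure_mono[of "D \<inter> A -` C" "A -` C"] vA by auto
  moreover have "measure P (B -` C') \<ge> 2/3"
    using C'(3) D1 finite_measure_mono[of "D \<inter> B -` C'" "B -` C'"] vB by auto
  moreover have "B -` C \<inter> B -` C' = {}" using none C(2) C'(2) by (auto 0 3)
  moreover have "measure P (B -` C \<union> B -` C') \<le> 1" by simp
  ultimately show False using finite_measure_Union[OF vB] by simp
qed

text \<open>Closed sets generate the Borel sets and are stable under intersection. Their indicators
  are limits of the continuous functions \<open>f n\<close>, which for positive \<open>n\<close>
  fall from 1 to 0 within distance \<open>1 / n\<close> of the set.\<close>

lemma measure_eqI_continuous_integral:
  fixes \<mu> \<nu> :: "'q::metric_space measure"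
  assumes "finite_measure \<mu>" "finite_measure \<nu>" and sets: "sets \<mu> = sets borel" "sets \<nu> = sets borel"
    and eq: "\<And>f. continuous_on UNIV f \<Longrightarrow> (\<And>x. 0 \<le> f x \<and> f x \<le> 1) \<Longrightarrow> (\<integral>x. f x \<partial>\<mu>) = (\<integral>x. f x \<partial>\<nu> :: real)"
  shows "\<mu> = \<nu>"
proof (rule measure_eqI_generator_eq[where \<Omega>=UNIV and E="{C. closed C}" and A="\<lambda>_. UNIV"])
  interpret \<mu>: finite_measure \<mu> by fact
  interpret \<nu>: finite_measure \<nu> by fact
  have sp: "space \<mu> = UNIV" "space \<nu> = UNIV" using sets[THEN sets_eq_imp_space_eq] by auto
  show "Int_stable {C::'q set. closed C}" by (auto simp: Int_stable_def)
  show "sets \<mu> = sigma_sets UNIV {C. closed C}" "sets \<nu> = sigma_sets UNIV {C. closed C}"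
    unfolding sets by (auto simp: borel_eq_closed)
  show "emeasure \<mu> ((\<lambda>_. UNIV) i) \<noteq> \<infinity>" for i :: nat by simp
  fix C :: "'q set" assume "C \<in> {C. closed C}"
  then have C: "closed C" by simp
  \<comment> \<open>The empty set is treated apart because \<open>infdist\<close> to it is 0 by
    convention, which would make every \<open>f n\<close> constantly 1.\<close>
  show "emeasure \<mu> C = emeasure \<nu> C"
  proof (cases "C = {}")
    case False
    define f where "f n x = max 0 (1 - real n * infdist x C)" for n x
    have cont: "continuous_on UNIV (f n)" for n
      unfolding f_def by (intro continuous_intros)
    have bd: "0 \<le> f n x \<and> f n x \<le> 1" for n x
      unfolding f_def by (auto simp: infdist_nonneg)
    have lim: "(\<lambda>n. f n x) \<longlonglongrightarrow> indicator C x" for x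
    proof (cases "x \<in> C")
      case True
      then show ?thesis by (simp add: f_def)
    next
      case xC: False
      have pos: "infdist x C > 0"
        using in_closed_iff_infdist_zero[OF C False, of x] xC infdist_nonneg[of x C] by linarith
      obtain N where N: "real N * infdist x C > 1" using reals_Archimedean3[OF pos] by blast
      have "f n x = 0" if "n \<ge> N" for n
      proof -
        have "real n * infdist x C \<ge> real N * infdist x C" using that pos by (intro mult_right_mono) auto
        then show ?thesis using N by (simp add: f_def)
      qed
      then have "eventually (\<lambda>n. f n x = 0) sequentially" by (auto simp: eventually_sequentially)
      then show ?thesis using xC by (simp add: tendsto_eventually)
    qed
    have meas: "f n \<in> borel_measurable \<mu>" "f n \<in> borel_measurable \<nu>" for n
      using borel_measurable_continuous_onI[OF cont] sets measurable_cong_sets by blast+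
    have Cm: "C \<in> sets \<mu>" "C \<in> sets \<nu>" using C by (auto simp: sets)
    have "(\<lambda>n. \<integral>x. f n x \<partial>\<mu>) \<longlonglongrightarrow> (\<integral>x. indicator C x \<partial>\<mu>)"
      by (rule integral_dominated_convergence[where w="\<lambda>_. 1"]) (use lim bd meas Cm in auto)
    moreover have "(\<lambda>n. \<integral>x. f n x \<partial>\<nu>) \<longlonglongrightarrow> (\<integral>x. indicator C x \<partial>\<nu>)"
      by (rule integral_dominated_convergence[where w="\<lambda>_. 1"]) (use lim bd meas Cm in auto)
    ultimately have "(\<integral>x. indicator C x \<partial>\<mu>) = (\<integral>x. indicator C x \<partial>\<nu> :: real)"
      using eq[OF cont bd] LIMSEQ_unique by auto
    then show ?thesis using Cm by (simp add: \<mu>.emeasure_eq_measure \<nu>.emeasure_eq_measure sp)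
  qed simp
qed auto

text \<open>Stone-Weierstrass on the cube \<open>S\<close>, which is compact by Tychonoff's theorem.
  Polynomials approximate a continuous function on \<open>S\<close> only; the support assumption
  makes the rest of the space negligible and the moments finite.\<close>

lemma measure_eqI_moments:
  fixes \<mu> \<nu> :: "('i::countable \<Rightarrow> real) measure"
  assumes "finite_measure \<mu>" "finite_measure \<nu>" and sets: "sets \<mu> = sets borel" "sets \<nu> = sets borel"
    and supp: "AE x in \<mu>. \<forall>i. 0 \<le> x i \<and> x i \<le> 1" "AE x in \<nu>. \<forall>i. 0 \<le> x i \<and> x i \<le> 1"
    and eq: "\<And>is. (\<integral>x. (\<Prod>i\<leftarrow>is. x i) \<partial>\<mu>) = (\<integral>x. (\<Prod>i\<leftarrow>is. x i) \<partial>\<nu>)"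
  shows "\<mu> = \<nu>"
proof (rule measure_eqI_continuous_integral)
  interpret \<mu>: finite_measure \<mu> by fact
  interpret \<nu>: finite_measure \<nu> by fact
  have [measurable_cong]: "sets \<mu> = sets borel" "sets \<nu> = sets borel" by fact+
  define S :: "('i \<Rightarrow> real) set" where "S = {x. \<forall>i. 0 \<le> x i \<and> x i \<le> 1}"
  have "compactin (product_topology (\<lambda>_. euclidean) UNIV) (PiE UNIV (\<lambda>_::'i. {0..1::real}))"
    by (simp add: compactin_PiE)
  moreover have "PiE UNIV (\<lambda>_::'i. {0..1::real}) = S" by (auto simp: S_def PiE_def Pi_def)
  ultimately have S: "compact S" by (simp add: euclidean_product_topology)
  \<comment> \<open>A polynomial is a list of coefficients with index lists, so sums and products
    become concatenations of lists.\<close>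
  define Pol where "Pol = {f. \<exists>cs :: (real \<times> 'i list) list. f = (\<lambda>x. \<Sum>(c,is)\<leftarrow>cs. c * (\<Prod>i\<leftarrow>is. x i))}"
  have cont_coord: "continuous_on U (\<lambda>x::'i\<Rightarrow>real. x i)" for U i
    by (rule continuous_on_product_then_coordinatewise) (rule continuous_on_id)
  have cont_mono: "continuous_on U (\<lambda>x::'i\<Rightarrow>real. \<Prod>i\<leftarrow>is. x i)" for U "is"
    by (induction "is") (auto intro!: continuous_intros cont_coord)
  have cont_Pol: "continuous_on U f" if "f \<in> Pol" for f U
  proof -
    have "continuous_on U (\<lambda>x. \<Sum>(c,is)\<leftarrow>cs. c * (\<Prod>i\<leftarrow>is. x i))" for cs :: "(real \<times> 'i list) list"
      by (induction cs) (auto intro!: continuous_intros cont_mono)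
    then show ?thesis using that by (auto simp: Pol_def)
  qed
  have mono_bd: "\<bar>\<Prod>i\<leftarrow>is. x i\<bar> \<le> 1" if "x \<in> S" for x :: "'i \<Rightarrow> real" and "is"
    using that by (induction "is") (auto simp: S_def abs_mult intro!: mult_le_one)
  have meas: "f \<in> borel_measurable \<mu>" "f \<in> borel_measurable \<nu>" if "continuous_on UNIV f"
    for f :: "('i \<Rightarrow> real) \<Rightarrow> real"
    using borel_measurable_continuous_onI[OF that] sets measurable_cong_sets by blast+
  have supp': "AE x in \<mu>. x \<in> S" "AE x in \<nu>. x \<in> S" using supp by (auto simp: S_def)
  have int_mono: "integrable \<mu> (\<lambda>x. \<Prod>i\<leftarrow>is. x i)" "integrable \<nu> (\<lambda>x. \<Prod>i\<leftarrow>is. x i)" for "is"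
    using supp' mono_bd meas[OF cont_mono]
    by (auto intro!: \<mu>.integrable_const_bound[where B=1] \<nu>.integrable_const_bound[where B=1] elim!: eventually_mono)
  have Pol_eq: "integrable \<mu> f \<and> integrable \<nu> f \<and> (\<integral>x. f x \<partial>\<mu>) = (\<integral>x. f x \<partial>\<nu>)" if "f \<in> Pol" for f
  proof -
    let ?f = "\<lambda>cs x. \<Sum>(c,is)\<leftarrow>cs. c * (\<Prod>i\<leftarrow>is. x i)"
    have "integrable \<mu> (?f cs) \<and> integrable \<nu> (?f cs) \<and> (\<integral>x. ?f cs x \<partial>\<mu>) = (\<integral>x. ?f cs x \<partial>\<nu>)"
      for cs :: "(real \<times> 'i list) list"
      by (induction cs) (auto simp: int_mono eq split: prod.splits)
    then show ?thesis using that by (auto simp: Pol_def)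
  qed
  fix f :: "('i \<Rightarrow> real) \<Rightarrow> real" assume f: "continuous_on UNIV f" and bd: "\<And>x. 0 \<le> f x \<and> f x \<le> 1"
  have f_int: "integrable \<mu> f" "integrable \<nu> f"
    using meas[OF f] bd by (auto intro!: \<mu>.integrable_const_bound[where B=1] \<nu>.integrable_const_bound[where B=1])
  have approx: "\<bar>(\<integral>x. f x \<partial>\<mu>) - (\<integral>x. f x \<partial>\<nu>)\<bar> \<le> e * (measure \<mu> (space \<mu>) + measure \<nu> (space \<nu>))" if "e > 0" for e
  proof -
    have "\<exists>g. g \<in> Pol \<and> (\<forall>x\<in>S. \<bar>f x - g x\<bar> < e)"
    proof (rule Stone_Weierstrass_HOL[OF S])
      show "(\<lambda>x. c) \<in> Pol" for c unfolding Pol_def by (auto intro!: exI[of _ "[(c, [])]"])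
      show "(\<lambda>x. f x + g x) \<in> Pol" if "f \<in> Pol \<and> g \<in> Pol" for f g
      proof -
        from that obtain cs ds where "f = (\<lambda>x. \<Sum>(c,is)\<leftarrow>cs. c * (\<Prod>i\<leftarrow>is. x i))" "g = (\<lambda>x. \<Sum>(c,is)\<leftarrow>ds. c * (\<Prod>i\<leftarrow>is. x i))"
          unfolding Pol_def by blast
        then show ?thesis unfolding Pol_def by (auto intro!: exI[of _ "cs @ ds"])
      qed
      show "(\<lambda>x. f x * g x) \<in> Pol" if "f \<in> Pol \<and> g \<in> Pol" for f g
      proof -
        from that obtain cs ds where f: "f = (\<lambda>x. \<Sum>(c,is)\<leftarrow>cs. c * (\<Prod>i\<leftarrow>is. x i))" and g: "g = (\<lambda>x. \<Sum>(c,is)\<leftarrow>ds. c * (\<Prod>i\<leftarrow>is. x i))"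
          unfolding Pol_def by blast
        have 1: "(c * (\<Prod>i\<leftarrow>is. x i)) * (\<Sum>(c,is)\<leftarrow>ds. c * (\<Prod>i\<leftarrow>is. x i)) =
           (\<Sum>(d,js)\<leftarrow>map (\<lambda>(d,js). (c*d, is@js)) ds. d * (\<Prod>i\<leftarrow>js. x i))" for c "is" and x :: "'i\<Rightarrow>real"
          by (induction ds) (auto simp: algebra_simps split: prod.splits)
        have "f x * g x = (\<Sum>(d,js)\<leftarrow>concat (map (\<lambda>(c,is). map (\<lambda>(d,js). (c*d, is@js)) ds) cs). d * (\<Prod>i\<leftarrow>js. x i))" for x
          unfolding f g by (induction cs) (auto simp: distrib_right 1 split: prod.splits)
        then show ?thesis unfolding Pol_def by auto
      qed
      show "\<exists>f. f \<in> Pol \<and> f x \<noteq> f y" if xy: "x \<in> S \<and> y \<in> S \<and> x \<noteq> y" for x y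
      proof -
        from xy obtain i where "x i \<noteq> y i" by auto
        moreover have "(\<lambda>x. x i) \<in> Pol" unfolding Pol_def by (auto intro!: exI[of _ "[(1, [i])]"])
        ultimately show ?thesis by blast
      qed
      show "continuous_on S f" using f continuous_on_subset by blast
    qed (use cont_Pol \<open>e > 0\<close> in auto)
    then obtain g where g: "g \<in> Pol" "\<And>x. x \<in> S \<Longrightarrow> \<bar>f x - g x\<bar> < e" by blast
    have gi: "integrable \<mu> g" "integrable \<nu> g" "(\<integral>x. g x \<partial>\<mu>) = (\<integral>x. g x \<partial>\<nu>)" using Pol_eq[OF g(1)] by auto
    have "\<bar>\<integral>x. f x - g x \<partial>\<mu>\<bar> \<le> (\<integral>x. \<bar>f x - g x\<bar> \<partial>\<mu>)" by (rule integral_abs_bound)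
    also have "\<dots> \<le> (\<integral>x. e \<partial>\<mu>)"
      by (rule integral_mono_AE) (use f_int gi supp' g(2) in \<open>auto elim!: eventually_mono intro: less_imp_le\<close>)
    finally have 1: "\<bar>\<integral>x. f x - g x \<partial>\<mu>\<bar> \<le> e * measure \<mu> (space \<mu>)" by (simp add: mult.commute)
    have "\<bar>\<integral>x. f x - g x \<partial>\<nu>\<bar> \<le> (\<integral>x. \<bar>f x - g x\<bar> \<partial>\<nu>)" by (rule integral_abs_bound)
    also have "\<dots> \<le> (\<integral>x. e \<partial>\<nu>)"
      by (rule integral_mono_AE) (use f_int gi supp' g(2) in \<open>auto elim!: eventually_mono intro: less_imp_le\<close>)
    finally have 2: "\<bar>\<integral>x. f x - g x \<partial>\<nu>\<bar> \<le> e * measure \<nu> (space \<nu>)" by (simp add: mult.commute)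
    from 1 2 show ?thesis using f_int gi by (simp add: algebra_simps abs_le_iff)
  qed
  define m where "m = measure \<mu> (space \<mu>) + measure \<nu> (space \<nu>)"
  have "m \<ge> 0" by (simp add: m_def)
  have "\<bar>(\<integral>x. f x \<partial>\<mu>) - (\<integral>x. f x \<partial>\<nu>)\<bar> \<le> 0"
  proof (rule field_le_epsilon)
    fix e :: real assume "e > 0"
    \<comment> \<open>The denominator \<open>m + 1\<close> instead of \<open>m\<close> covers total
      mass 0.\<close>
    have "0 < m + 1" using \<open>m \<ge> 0\<close> by linarith
    then have "e / (m + 1) * m \<le> e"
      using \<open>e > 0\<close> by (simp add: field_simps)
    then show "\<bar>(\<integral>x. f x \<partial>\<mu>) - (\<integral>x. f x \<partial>\<nu>)\<bar> \<le> 0 + e"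
      using approx[folded m_def, of "e / (m + 1)"] \<open>e > 0\<close> \<open>m \<ge> 0\<close> by (smt (verit) divide_pos_pos)
  qed
  then show "(\<integral>x. f x \<partial>\<mu>) = (\<integral>x. f x \<partial>\<nu>)" by simp
qed (use assms in auto)

text \<open>The index sets differ so that one statement yields both a coordinatewise change of
  variables and the projection to fewer coordinates. Cylinders over finitely many coordinates
  determine the image measure.\<close>

lemma distr_PiM_map:
  assumes A: "prob_space A" and h: "h \<in> measurable A B" and B: "distr A B h = B" and "I \<subseteq> J"
  shows "(\<lambda>\<omega>. \<lambda>i\<in>I. h (\<omega> i)) \<in> measurable (PiM J (\<lambda>_. A)) (PiM I (\<lambda>_. B))"
    and "distr (PiM J (\<lambda>_. A)) (PiM I (\<lambda>_. B)) (\<lambda>\<omega>. \<lambda>i\<in>I. h (\<omega> i)) = PiM I (\<lambda>_. B)"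
proof -
  interpret A: prob_space A by fact
  have pB: "prob_space B" using A.prob_space_distr[OF h] B by simp
  interpret B: prob_space B by fact
  interpret PA: product_prob_space "\<lambda>_. A" J ..
  interpret PB: product_prob_space "\<lambda>_. B" I ..
  note h[measurable]
  show m: "(\<lambda>\<omega>. \<lambda>i\<in>I. h (\<omega> i)) \<in> measurable (PiM J (\<lambda>_. A)) (PiM I (\<lambda>_. B))"
    using \<open>I \<subseteq> J\<close> by (intro measurable_restrict measurable_compose[OF _ h] measurable_component_singleton) auto
  show "distr (PiM J (\<lambda>_. A)) (PiM I (\<lambda>_. B)) (\<lambda>\<omega>. \<lambda>i\<in>I. h (\<omega> i)) = PiM I (\<lambda>_. B)"
  proof (rule PB.PiM_eq)
    fix K F assume K: "finite K" "K \<subseteq> I" and F: "\<And>j. j \<in> K \<Longrightarrow> F j \<in> sets B"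
    have pre: "(\<lambda>\<omega>. \<lambda>i\<in>I. h (\<omega> i)) -` prod_emb I (\<lambda>_. B) K (Pi\<^sub>E K F) \<inter> space (PiM J (\<lambda>_. A))
      = {\<omega>\<in>space (PiM J (\<lambda>_. A)). \<forall>i\<in>K. \<omega> i \<in> h -` F i \<inter> space A}"
      using \<open>K \<subseteq> I\<close> \<open>I \<subseteq> J\<close> measurable_space[OF h]
      by (auto simp: prod_emb_def space_PiM PiE_iff Pi_iff extensional_def restrict_def subset_iff fun_eq_iff split: if_splits)
    have "emeasure (distr (PiM J (\<lambda>_. A)) (PiM I (\<lambda>_. B)) (\<lambda>\<omega>. \<lambda>i\<in>I. h (\<omega> i))) (prod_emb I (\<lambda>_. B) K (Pi\<^sub>E K F))
      = emeasure (PiM J (\<lambda>_. A)) {\<omega>\<in>space (PiM J (\<lambda>_. A)). \<forall>i\<in>K. \<omega> i \<in> h -` F i \<inter> space A}"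
      using m K F by (subst emeasure_distr) (auto simp: pre intro!: sets_PiM_I)
    also have "\<dots> = (\<Prod>i\<in>K. emeasure A (h -` F i \<inter> space A))"
      using K \<open>I \<subseteq> J\<close> F h by (intro PA.emeasure_PiM_Collect) (auto intro: measurable_sets)
    also have "\<dots> = (\<Prod>i\<in>K. emeasure B (F i))"
      using F h by (intro prod.cong refl) (metis B emeasure_distr)
    finally show "emeasure (distr (PiM J (\<lambda>_. A)) (PiM I (\<lambda>_. B)) (\<lambda>\<omega>. \<lambda>i\<in>I. h (\<omega> i))) (prod_emb I (\<lambda>_. B) K (Pi\<^sub>E K F)) = (\<Prod>j\<in>K. emeasure B (F j))" .
  qed simp
qed


section \<open>Standard probability spaces\<close>

text \<open>The embedding is by the distances to a dense sequence. By completeness a point \<open>v\<close> of the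
  closure of the image lies in the image iff the infimum of its coordinates \<open>v n\<close> is 0, so the
  image is Borel.\<close>

lemma standard_borel_embedding:
  assumes "standard_borel N"
  obtains e :: "'a \<Rightarrow> nat \<Rightarrow> real" where "inj_on e (space N)" "e \<in> borel_measurable N"
    "\<And>A. A \<in> sets N \<Longrightarrow> e ` A \<in> sets borel"
proof -
  from assms obtain T where T: "completely_metrizable_space T" "second_countable T"
    and spN: "space N = topspace T" and setsN: "sets N = sigma_sets (topspace T) {U. openin T U}"
    unfolding standard_borel_def polish_topology_def by auto
  show thesis
  proof (cases "topspace T = {}")
    case True
    have sN: "space N = {}" using spN True by simp
    have "A = {}" if "A \<in> sets N" for A
      using sets.sets_into_space[OF that] sN by auto
    then have "(\<lambda>_ _. 0) ` A \<in> sets borel" if "A \<in> sets N" for A using that by fastforce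
    then show thesis using sN by (intro that[of "\<lambda>_ _. 0"] measurable_const) simp_all
  next
    case ne: False
    from T(1) obtain M d where M: "Metric_space M d" "Metric_space.mcomplete M d" and Td: "T = Metric_space.mtopology M d"
      unfolding completely_metrizable_space_def by auto
    interpret Metric_space M d by fact
    have top: "topspace T = M" using Td by simp
    from second_countable_imp_separable_space[OF T(2)] obtain S where S: "countable S" "S \<subseteq> M" "T closure_of S = M"
      unfolding separable_space_def top by auto
    have "S \<noteq> {}" using S ne top by auto
    define s where "s = from_nat_into S"
    have s: "range s = S" using S \<open>S \<noteq> {}\<close> by (simp add: s_def range_from_nat_into)
    have sM: "s n \<in> M" for n using s S by auto
    have dense: "\<exists>n. d x (s n) < r" if "x \<in> M" "r > 0" for x r
    proof -
      have "x \<in> T closure_of S" using S that by auto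
      then show ?thesis using that s unfolding Td metric_closure_of by (force simp: in_mball)
    qed
    define e where "e x = (\<lambda>n. d x (s n))" for x
    have diff: "\<bar>d x z - d y z\<bar> \<le> d x y" if "x \<in> M" "y \<in> M" "z \<in> M" for x y z
      using triangle[OF that(1,2,3)] triangle[OF that(2,1,3)] commute[of x y] by auto
    have inj: "inj_on e M"
    proof (rule inj_onI, rule ccontr)
      fix x y assume xy: "x \<in> M" "y \<in> M" "e x = e y" "x \<noteq> y"
      then have "d x y > 0" by auto
      then obtain n where n: "d x (s n) < d x y / 2" using dense[of x "d x y / 2"] xy by auto
      moreover have "d y (s n) = d x (s n)" using xy(3) by (metis e_def)
      ultimately show False using triangle[of x "s n" y] xy sM commute[of "s n" y] by auto
    qed
    define G where "G = e ` M"
    have G_char: "u \<in> G \<longleftrightarrow> u \<in> closure G \<and> (\<forall>j. \<exists>n. u n < 1 / real (Suc j))" for u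
    proof
      assume "u \<in> G"
      then obtain x where x: "x \<in> M" "u = e x" by (auto simp: G_def)
      then show "u \<in> closure G \<and> (\<forall>j. \<exists>n. u n < 1 / real (Suc j))"
        using dense[OF x(1)] \<open>u \<in> G\<close> closure_subset[of G] by (auto simp: e_def)
    next
      assume "u \<in> closure G \<and> (\<forall>j. \<exists>n. u n < 1 / real (Suc j))"
      then have u: "u \<in> closure G" "\<And>j. \<exists>n. u n < 1 / real (Suc j)" by auto
      from u(1) obtain v where v: "\<And>m. v m \<in> G" "v \<longlonglongrightarrow> u" by (auto simp: closure_sequential)
      define x where "x m = inv_into M e (v m)" for m
      have x: "x m \<in> M" "v m = e (x m)" for m
        unfolding x_def using v(1)[of m] by (auto simp: G_def inv_into_into f_inv_into_f)
      have lim: "(\<lambda>m. d (x m) (s n)) \<longlonglongrightarrow> u n" for n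
      proof -
        have "continuous_on UNIV (\<lambda>u::nat\<Rightarrow>real. u n)"
          by (rule continuous_on_product_then_coordinatewise, rule continuous_on_id)
        from continuous_on_tendsto_compose[OF this v(2)] show ?thesis by (simp add: x(2) e_def)
      qed
      have "MCauchy x"
        unfolding MCauchy_def
      proof (intro conjI allI impI)
        show "range x \<subseteq> M" using x by auto
        \<comment> \<open>A small coordinate \<open>u n\<close> means that all late
          \<open>x m\<close> lie near the one point \<open>s n\<close>, hence near each
          other.\<close>
        fix \<epsilon> :: real assume "\<epsilon> > 0"
        then obtain j where j: "1 / real (Suc j) < \<epsilon> / 2" by (meson half_gt_zero nat_approx_posE)
        from u(2) obtain n where "u n < 1 / real (Suc j)" by blast
        then have "u n < \<epsilon> / 2" using j by simp
        then have "eventually (\<lambda>m. d (x m) (s n) < \<epsilon> / 2) sequentially"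
          using order_tendstoD(2)[OF lim] by blast
        then obtain K where K: "\<And>m. m \<ge> K \<Longrightarrow> d (x m) (s n) < \<epsilon> / 2" by (auto simp: eventually_sequentially)
        have "d (x m) (x m') < \<epsilon>" if "K \<le> m" "K \<le> m'" for m m'
          using triangle[OF x(1)[of m] sM[of n] x(1)[of m']] K[OF that(1)] K[OF that(2)] commute[of "s n"] by auto
        then show "\<exists>N. \<forall>n n'. N \<le> n \<longrightarrow> N \<le> n' \<longrightarrow> d (x n) (x n') < \<epsilon>" by blast
      qed
      then obtain y where y: "limitin mtopology x y sequentially" using M(2) mcomplete_def by blast
      then have yM: "y \<in> M" and dy: "(\<lambda>m. d (x m) y) \<longlonglongrightarrow> 0"
        by (auto simp: limit_metric_sequentially limitin_metric_dist_null)
      have "(\<lambda>m. d (x m) (s n) - d y (s n)) \<longlonglongrightarrow> 0" for n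
        by (rule Lim_null_comparison[OF _ dy]) (use diff x yM sM in auto)
      then have "(\<lambda>m. d (x m) (s n)) \<longlonglongrightarrow> d y (s n)" for n
        by (rule LIM_zero_cancel)
      then have "u n = d y (s n)" for n by (rule LIMSEQ_unique[OF lim])
      then have "u = e y" by (auto simp: e_def)
      then show "u \<in> G" using yM by (auto simp: G_def)
    qed
    have coord[measurable]: "(\<lambda>u::nat\<Rightarrow>real. u n) \<in> borel_measurable borel" for n
      by (rule borel_measurable_coordinate)
    have [measurable]: "closure G \<in> sets borel" by auto
    have "{u. u \<in> closure G \<and> (\<forall>j. \<exists>n. u n < 1 / real (Suc j))} \<in> sets borel" by measurable
    moreover have "G = {u. u \<in> closure G \<and> (\<forall>j. \<exists>n. u n < 1 / real (Suc j))}"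
      by (rule set_eqI, unfold mem_Collect_eq, rule G_char)
    ultimately have G[measurable]: "G \<in> sets borel" by (rule back_subst[of "\<lambda>A. A \<in> sets borel", OF _ sym])
    \<comment> \<open>Lying in a ball around \<open>s n\<close> is a condition on the single
      coordinate \<open>n\<close>, and the balls of radius \<open>1 / real (Suc j)\<close> around
      the dense points form a base.\<close>
    have opn: "e ` U \<in> sets borel" if U: "openin T U" for U
    proof -
      have "U \<subseteq> M" using openin_subset[OF U] top by simp
      have "e ` U = {u \<in> G. \<exists>n j. mball (s n) (1 / real (Suc j)) \<subseteq> U \<and> u n < 1 / real (Suc j)}"
      proof (intro equalityI subsetI)
        fix u assume "u \<in> e ` U"
        then obtain x where x: "x \<in> U" "u = e x" by auto
        then obtain r where r: "r > 0" "mball x r \<subseteq> U" using U unfolding Td openin_mtopology by blast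
        obtain j where j: "1 / real (Suc j) < r / 2" using r by (meson half_gt_zero nat_approx_posE)
        have xM: "x \<in> M" using x \<open>U \<subseteq> M\<close> by auto
        obtain n where n: "d x (s n) < 1 / real (Suc j)" using dense[OF xM, of "1 / real (Suc j)"] by auto
        have "mball (s n) (1 / real (Suc j)) \<subseteq> mball x r"
          by (rule mball_subset) (use n j xM commute[of x "s n"] in auto)
        then show "u \<in> {u \<in> G. \<exists>n j. mball (s n) (1 / real (Suc j)) \<subseteq> U \<and> u n < 1 / real (Suc j)}"
          using n x xM r by (auto simp: G_def e_def)
      next
        fix u assume "u \<in> {u \<in> G. \<exists>n j. mball (s n) (1 / real (Suc j)) \<subseteq> U \<and> u n < 1 / real (Suc j)}"
        then obtain x n j where x: "x \<in> M" "u = e x" and "mball (s n) (1 / real (Suc j)) \<subseteq> U" "u n < 1 / real (Suc j)"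
          by (auto simp: G_def)
        then have "x \<in> mball (s n) (1 / real (Suc j))" using sM[of n] commute[of x "s n"] by (auto simp: e_def)
        then show "u \<in> e ` U" using x \<open>mball _ _ \<subseteq> U\<close> by auto
      qed
      also have "\<dots> \<in> sets borel" by measurable
      finally show ?thesis .
    qed
    \<comment> \<open>Injectivity of \<open>e\<close> on \<open>M\<close> lets images commute with
      complements, for which the induction also carries \<open>A \<subseteq> M\<close>.\<close>
    have img: "e ` A \<in> sets borel \<and> A \<subseteq> M" if "A \<in> sigma_sets M {U. openin T U}" for A
      using that
    proof induction
      case (Basic A)
      then show ?case using opn openin_subset top by blast
    next
      case (Compl A)
      then have "e ` (M - A) = G - e ` A"
        using inj by (auto simp: G_def inj_on_def)
      then show ?case using Compl G by auto
    qed (auto simp: image_UN)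
    have meas: "e \<in> borel_measurable N"
    proof (rule measurable_coordinatewise_then_product)
      fix n
      have "{x \<in> space N. e x n < a} \<in> sets N" for a
      proof -
        have "{x \<in> space N. e x n < a} = mball (s n) a"
          using sM[of n] commute[of "s n"] by (auto simp: e_def spN top)
        also have "\<dots> \<in> sets N" unfolding setsN using Td by (auto intro: sigma_sets.Basic)
        finally show ?thesis .
      qed
      then show "(\<lambda>x. e x n) \<in> borel_measurable N" by (auto intro: borel_measurableI_less)
    qed
    show thesis
      by (rule that[of e]) (use inj img meas in \<open>auto simp: spN top setsN\<close>)
  qed
qed

text \<open>Up to a null set \<open>M\<close> is a completion, so \<open>h\<close> cannot be
  expected to pull back all of \<open>sets M\<close> to Borel sets. It does so for countably many
  prescribed sets, after the Borel null sets covering their null parts are discarded. For a general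
  measurable set there remains a Borel set of parameters of the same measure that \<open>h\<close>
  maps into it.\<close>

lemma standard_prob_space_parametrization:
  assumes "standard_prob_space M" and \<U>: "countable \<U>" "\<U> \<subseteq> sets M"
  obtains \<mu> :: "(nat \<Rightarrow> real) measure" and h :: "(nat \<Rightarrow> real) \<Rightarrow> 'a"
  where "prob_space \<mu>" "sets \<mu> = sets borel" "\<And>q. h q \<in> space M"
    "\<And>U. U \<in> \<U> \<Longrightarrow> h -` U \<in> sets borel"
    "\<And>A. A \<in> sets M \<Longrightarrow> \<exists>D\<in>sets borel. h ` D \<subseteq> A \<and> measure \<mu> D = measure M A"
proof -
  from assms(1) obtain X N where "prob_space M" and X: "X \<in> sets M" "emeasure M X = 1"
    and N: "standard_borel N" and RN: "restrict_space M X = completion N"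
    unfolding standard_prob_space_def by auto
  interpret M: prob_space M by fact
  have XM: "X \<inter> space M = X" using X(1) sets.sets_into_space by blast
  have spN: "space N = X"
    using arg_cong[OF RN, of space] XM by (simp add: space_restrict_space)
  have setsC: "A \<in> sets (completion N) \<longleftrightarrow> A \<in> sets M \<and> A \<subseteq> X" for A
    unfolding RN[symmetric] using X(1) by (subst sets_restrict_space_iff) (auto simp: XM)
  have emC: "emeasure (completion N) A = emeasure M A" if "A \<in> sets (completion N)" for A
    unfolding RN[symmetric] using that X(1) by (intro emeasure_restrict_space) (auto simp: XM setsC)
  have emN: "emeasure N A = emeasure M A" if "A \<in> sets N" for A
    using emC[of A] that by simp
  interpret N: prob_space N
    by (rule prob_spaceI) (use emN[of X] X spN sets.top[of N] in auto)
  obtain e :: "'a \<Rightarrow> nat \<Rightarrow> real" where e: "inj_on e X" "e \<in> borel_measurable N" "\<And>A. A \<in> sets N \<Longrightarrow> e ` A \<in> sets borel"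
    using standard_borel_embedding[OF N] unfolding spN by metis
  have inC: "A \<inter> X \<in> sets (completion N)" if "A \<in> sets M" for A
    using that X(1) by (auto simp: setsC)
  have "\<exists>Z. Z \<in> null_sets N \<and> null_part N (U \<inter> X) \<subseteq> Z" if "U \<in> \<U>" for U
    using null_part[OF inC] that \<U> by auto
  then obtain Z where Z: "\<And>U. U \<in> \<U> \<Longrightarrow> Z U \<in> null_sets N" "\<And>U. U \<in> \<U> \<Longrightarrow> null_part N (U \<inter> X) \<subseteq> Z U"
    by metis
  define X1 where "X1 = X - (\<Union>U\<in>\<U>. Z U)"
  have ZN: "(\<Union>U\<in>\<U>. Z U) \<in> null_sets N" using \<U>(1) Z(1) by (intro null_sets_UN') auto
  have X1N: "X1 \<in> sets N" unfolding X1_def using ZN spN sets.top[of N] by auto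
  have X1_AE: "AE x in N. x \<in> X1"
    using AE_not_in[OF ZN] AE_space[of N] by eventually_elim (auto simp: X1_def spN)
  have "X1 \<noteq> {}"
  proof
    assume "X1 = {}"
    then have "AE x in N. False" using X1_AE by simp
    then show False using N.AE_False by simp
  qed
  then obtain x0 where x0: "x0 \<in> X1" by auto
  have X1M: "X1 \<subseteq> space M" using XM by (auto simp: X1_def)
  \<comment> \<open>Parameters outside the image are sent to the fixed point \<open>x0\<close>, so
    \<open>h\<close> is total with values in \<open>X1\<close>.\<close>
  define h where "h q = (if q \<in> e ` X1 then inv_into X e q else x0)" for q
  have he: "h (e x) = x" if "x \<in> X1" for x
    using that e(1) by (auto simp: h_def X1_def inv_into_f_f)
  define \<mu> where "\<mu> = distr N borel e"
  show thesis
  proof (rule that[of \<mu> h])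
    show "prob_space \<mu>" unfolding \<mu>_def by (rule N.prob_space_distr) (rule e)
    show "sets \<mu> = sets borel" by (simp add: \<mu>_def)
    have hX: "h q \<in> X1" for q using x0 he by (cases "q \<in> e ` X1") (auto simp: h_def)
    then show "h q \<in> space M" for q using X1M by auto
    have inj1: "inj_on e X1" using e(1) by (rule inj_on_subset) (auto simp: X1_def)
    have vim: "h -` U = e ` (U \<inter> X1) \<union> (if x0 \<in> U then - e ` X1 else {})" for U
    proof (intro set_eqI iffI)
      fix q assume "q \<in> h -` U"
      then show "q \<in> e ` (U \<inter> X1) \<union> (if x0 \<in> U then - e ` X1 else {})"
        using he by (cases "q \<in> e ` X1") (auto simp: h_def)
    next
      fix q assume "q \<in> e ` (U \<inter> X1) \<union> (if x0 \<in> U then - e ` X1 else {})"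
      then show "q \<in> h -` U" using he by (cases "q \<in> e ` X1") (auto simp: h_def he[unfolded h_def] dest!: inj_onD[OF inj1] split: if_splits)
    qed
    show "h -` U \<in> sets borel" if U: "U \<in> \<U>" for U
    proof -
      have "U \<inter> X1 = main_part N (U \<inter> X) \<inter> X1"
        using main_part_null_part_Un[OF inC[of U]] Z(2)[OF U] U \<U>(2) by (auto simp: X1_def)
      then have "U \<inter> X1 \<in> sets N" using main_part_sets[OF inC[of U]] U \<U>(2) X1N by auto
      then show ?thesis unfolding vim using e(3) X1N by auto
    qed
    fix A assume A: "A \<in> sets M"
    let ?B = "main_part N (A \<inter> X) \<inter> X1"
    have B: "?B \<in> sets N" using main_part_sets[OF inC[OF A]] X1N by auto
    have BA: "?B \<subseteq> A" using main_part_null_part_Un[OF inC[OF A]] by blast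
    have "measure \<mu> (e ` ?B) = measure N (e -` e ` ?B \<inter> space N)"
      unfolding \<mu>_def using e B by (intro measure_distr) auto
    also have "e -` e ` ?B \<inter> space N = ?B"
      using e(1) by (auto simp: spN X1_def inj_on_def)
    also have "measure N ?B = measure N (main_part N (A \<inter> X))"
      using X1_AE B main_part_sets[OF inC[OF A]] by (intro N.finite_measure_eq_AE) (auto elim!: eventually_mono)
    also have "\<dots> = measure M (A \<inter> X)"
      using emeasure_completion[OF inC[OF A]] emC[OF inC[OF A]] by (simp add: measure_def)
    also have "\<dots> = measure M A"
    proof -
      have "AE x in M. x \<in> X" using X M.AE_in_set_eq_1[OF X(1)] by (simp add: M.emeasure_eq_measure)
      then show ?thesis using A X by (intro M.finite_measure_eq_AE) (auto elim!: eventually_mono)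
    qed
    finally show "\<exists>D\<in>sets borel. h ` D \<subseteq> A \<and> measure \<mu> D = measure M A"
      using e(3)[OF B] BA he by (intro bexI[of _ "e ` ?B"]) auto
  qed
qed

text \<open>A maximal \<open>r\<close>-separated set is the index set of a disjoint family of balls of positive
  measure, hence countable.\<close>

lemma (in Metric_space) separable_if_balls_charged:
  assumes "finite_measure N" and pos: "\<And>x r. x \<in> M \<Longrightarrow> 0 < r \<Longrightarrow> 0 < emeasure N (mball x r)" and "M \<noteq> {}"
  obtains s :: "nat \<Rightarrow> 'a" where "\<And>n. s n \<in> M" "\<And>x r. x \<in> M \<Longrightarrow> 0 < r \<Longrightarrow> \<exists>n. d x (s n) < r"
proof -
  interpret N: finite_measure N by fact
  have ballN: "mball x r \<in> sets N" if "x \<in> M" "0 < r" for x r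
    using pos[OF that] emeasure_notin_sets by fastforce
  have "\<exists>S. countable S \<and> S \<subseteq> M \<and> (\<forall>x\<in>M. \<exists>y\<in>S. d x y < r)" if r: "r > 0" for r
  proof -
    let ?A = "{S. S \<subseteq> M \<and> (\<forall>x\<in>S. \<forall>y\<in>S. x \<noteq> y \<longrightarrow> r \<le> d x y)}"
    have "\<exists>S\<in>?A. \<forall>X\<in>?A. S \<subseteq> X \<longrightarrow> X = S"
    proof (rule subset_Zorn')
      fix C assume C: "subset.chain ?A C"
      have "r \<le> d x y" if "X \<in> C" "Y \<in> C" "x \<in> X" "y \<in> Y" "x \<noteq> y" for X Y x y
      proof -
        have "X \<subseteq> Y \<or> Y \<subseteq> X" "X \<in> ?A" "Y \<in> ?A" using C that by (auto simp: subset_chain_def)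
        then show ?thesis using that by blast
      qed
      moreover have "\<Union>C \<subseteq> M" using C by (auto simp: subset_chain_def)
      ultimately show "\<Union>C \<in> ?A" by blast
    qed
    then obtain S where S: "S \<in> ?A" and max: "\<forall>X\<in>?A. S \<subseteq> X \<longrightarrow> X = S" by (rule bexE)
    have "\<exists>y\<in>S. d x y < r" if x: "x \<in> M" for x
    proof (rule ccontr)
      assume "\<not> ?thesis"
      then have far: "\<And>y. y \<in> S \<Longrightarrow> r \<le> d x y" by force
      then have "\<And>y. y \<in> S \<Longrightarrow> r \<le> d y x" by (simp add: commute)
      with far have "insert x S \<in> ?A" using S x by simp
      from bspec[OF max this] have "insert x S = S" by (simp add: subset_insertI)
      then have "x \<in> S" by blast
      then show False using far[of x] r x by simp
    qed
    moreover have "countable S"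
    proof -
      let ?m = "\<lambda>x. measure N (mball x (r/2))"
      have disj: "disjoint_family_on (\<lambda>x. mball x (r/2)) S"
        unfolding disjoint_family_on_def using S disjoint_mball[of "r/2" "r/2"] by (auto simp: disjnt_def)
      have "sum ?m F \<le> measure N (space N)" if F: "finite F" "F \<subseteq> S" for F
      proof -
        have "sum ?m F = measure N (\<Union>x\<in>F. mball x (r/2))"
          using F S r by (intro N.finite_measure_finite_Union[symmetric] disjoint_family_on_mono[OF F(2) disj])
             (auto intro!: ballN)
        also have "\<dots> \<le> measure N (space N)" by (rule N.bounded_measure)
        finally show ?thesis .
      qed
      then have "?m summable_on S"
        by (intro nonneg_bounded_partial_sums_imp_summable_on[where C="measure N (space N)"] eventually_finite_subsets_at_top_weakI) simp_all
      then have "countable {x \<in> S. ?m x \<noteq> 0}" by (rule summable_countable_real)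
      moreover have "{x \<in> S. ?m x \<noteq> 0} = S"
        using S pos[of _ "r/2"] r by (fastforce simp: N.emeasure_eq_measure)
      ultimately show ?thesis by simp
    qed
    ultimately show ?thesis using S by auto
  qed
  then have "\<forall>n. \<exists>S. countable S \<and> S \<subseteq> M \<and> (\<forall>x\<in>M. \<exists>y\<in>S. d x y < 1 / real (Suc n))" by simp
  then obtain S where S: "\<And>n. countable (S n)" "\<And>n. S n \<subseteq> M" "\<And>n x. x \<in> M \<Longrightarrow> \<exists>y\<in>S n. d x y < 1 / real (Suc n)"
    by metis
  define U where "U = (\<Union>n. S n)"
  have "U \<noteq> {}" using S(3) \<open>M \<noteq> {}\<close> by (force simp: U_def)
  moreover have "countable U" using S(1) by (auto simp: U_def)
  ultimately have rng: "range (from_nat_into U) = U" by (simp add: range_from_nat_into)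
  show thesis
  proof (rule that[of "from_nat_into U"])
    show "from_nat_into U n \<in> M" for n using rng S(2) by (auto simp: U_def)
    fix x r assume "x \<in> M" "0 < (r::real)"
    then obtain n where "1 / real (Suc n) < r" by (meson nat_approx_posE)
    then obtain y where "y \<in> U" "d x y < r" using S(3)[OF \<open>x \<in> M\<close>, of n] by (force simp: U_def)
    then show "\<exists>n. d x (from_nat_into U n) < r" using rng by (metis imageE)
  qed
qed


section \<open>The Borel structure of a pure graphon\<close>

locale pure_graphon_space =
  fixes M :: "'a measure" and W :: "'a \<Rightarrow> 'a \<Rightarrow> real"
  assumes pure: "pure_graphon M W"
begin

abbreviation rdist :: "'a \<Rightarrow> 'a \<Rightarrow> real" where "rdist \<equiv> neighborhood_dist M W"

lemma graphon: "graphon M W"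
  and standard: "standard_prob_space M"
  using pure by (auto simp: pure_graphon_def graphon_def)

lemma W_bounds: "x \<in> space M \<Longrightarrow> y \<in> space M \<Longrightarrow> 0 \<le> W x y \<and> W x y \<le> 1"
  and W_commute: "x \<in> space M \<Longrightarrow> y \<in> space M \<Longrightarrow> W x y = W y x"
  and W_section: "x \<in> space M \<Longrightarrow> W x \<in> borel_measurable M"
  and W_joint: "(\<lambda>(x, y). W x y) \<in> borel_measurable (completion (M \<Otimes>\<^sub>M M))"
  using graphon by (auto simp: graphon_def)

sublocale J: Metric_space "space M" rdist
  using pure by (simp add: pure_graphon_def)

sublocale prob_space M
  using standard by (simp add: standard_prob_space_def)

sublocale complete_measure M
  using standard by (simp add: standard_prob_space_def)

lemma open_positive: "openin J.mtopology U \<Longrightarrow> U \<noteq> {} \<Longrightarrow> emeasure M U > 0"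
  using pure by (simp add: pure_graphon_def)

lemma open_sets_M: "openin J.mtopology U \<Longrightarrow> U \<in> sets M"
  using open_positive[of U] emeasure_notin_sets[of U M] by (cases "U = {}") auto

text \<open>The Borel sets of the neighborhood distance are countably generated and recoverable from
  countably many coordinates, which the sets of the complete measure \<open>M\<close> need not be.
  Working with \<open>B\<close> loses nothing, by \<open>completion_B\<close>.\<close>

definition B :: "'a measure" where
  "B = restr_to_subalg M (sigma (space M) {U. openin J.mtopology U})"

lemma openin_Pow: "{U. openin J.mtopology U} \<subseteq> Pow (space M)"
  using openin_subset by fastforce

lemma subalgebra_B: "subalgebra M (sigma (space M) {U. openin J.mtopology U})"
proof -
  have "sigma_sets (space M) {U. openin J.mtopology U} \<subseteq> sets M"
    by (rule sets.sigma_sets_subset) (use open_sets_M in blast)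
  then show ?thesis
    unfolding subalgebra_def by (simp add: space_measure_of_conv sets_measure_of[OF openin_Pow])
qed

lemma space_B[simp]: "space B = space M"
  by (simp add: B_def space_restr_to_subalg)

lemma sets_B: "sets B = sigma_sets (space M) {U. openin J.mtopology U}"
  using openin_Pow by (simp add: B_def sets_restr_to_subalg[OF subalgebra_B])

lemma sets_B_subset: "A \<in> sets B \<Longrightarrow> A \<in> sets M"
  using subalgebra_B openin_Pow by (auto simp: sets_B subalgebra_def)

lemma emeasure_B: "A \<in> sets B \<Longrightarrow> emeasure B A = emeasure M A"
  unfolding B_def using sets_restr_to_subalg[OF subalgebra_B]
  by (intro emeasure_restr_to_subalg[OF subalgebra_B]) auto

lemma measure_B: "A \<in> sets B \<Longrightarrow> measure B A = measure M A"
  by (simp add: measure_def emeasure_B)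

sublocale B: prob_space B
  unfolding B_def by (rule prob_space_restr_to_subalg[OF subalgebra_B prob_space_axioms])

lemma open_sets_B: "openin J.mtopology U \<Longrightarrow> U \<in> sets B"
  unfolding sets_B by (rule sigma_sets.Basic) simp

lemma ball_sets_B[measurable]: "J.mball x e \<in> sets B"
  by (rule open_sets_B) simp

lemma ball_positive: "x \<in> space M \<Longrightarrow> 0 < e \<Longrightarrow> 0 < measure B (J.mball x e)"
  using open_positive[of "J.mball x e"] by (auto simp: measure_B emeasure_eq_measure)

lemma ex_dense_sequence:
  "\<exists>s :: nat \<Rightarrow> 'a. (\<forall>n. s n \<in> space M) \<and> (\<forall>x\<in>space M. \<forall>e>0. \<exists>n. rdist x (s n) < e)"
proof -
  have "0 < emeasure M (J.mball x e)" if "x \<in> space M" "0 < e" for x e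
    by (rule open_positive) (use that in auto)
  from J.separable_if_balls_charged[OF finite_measure_axioms this not_empty]
  show ?thesis by metis
qed

definition dseq :: "nat \<Rightarrow> 'a" where
  "dseq = (SOME s. (\<forall>n. s n \<in> space M) \<and> (\<forall>x\<in>space M. \<forall>e>0. \<exists>n. rdist x (s n) < e))"

lemma dseq_space[simp]: "dseq n \<in> space M"
  and dseq_dense: "x \<in> space M \<Longrightarrow> e > 0 \<Longrightarrow> \<exists>n. rdist x (dseq n) < e"
  using someI_ex[OF ex_dense_sequence, folded dseq_def] by auto

lemma rdist_measurable[measurable]: "y \<in> space M \<Longrightarrow> (\<lambda>x. rdist x y) \<in> borel_measurable B"
proof (rule borel_measurableI_less)
  fix e assume y: "y \<in> space M"
  have "{x \<in> space B. rdist x y < e} = J.mball y e" using y J.commute by auto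
  then show "{x \<in> space B. rdist x y < e} \<in> sets B" by simp
qed

lemma open_eq_Union_balls:
  assumes "openin J.mtopology U"
  shows "U = (\<Union>(n, j)\<in>{(n, j). J.mball (dseq n) (1 / real (Suc j)) \<subseteq> U}. J.mball (dseq n) (1 / real (Suc j)))"
proof (intro equalityI subsetI)
  fix x assume x: "x \<in> U"
  then have xM: "x \<in> space M" using openin_subset[OF assms] by auto
  obtain e where e: "e > 0" "J.mball x e \<subseteq> U" using x assms unfolding J.openin_mtopology by blast
  obtain j where j: "1 / real (Suc j) < e / 2" using e by (meson half_gt_zero nat_approx_posE)
  obtain n where n: "rdist x (dseq n) < 1 / real (Suc j)" using dseq_dense[OF xM, of "1 / real (Suc j)"] by auto
  have "J.mball (dseq n) (1 / real (Suc j)) \<subseteq> J.mball x e"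
    by (rule J.mball_subset) (use n j xM J.commute[of x "dseq n"] in auto)
  then show "x \<in> (\<Union>(n, j)\<in>{(n, j). J.mball (dseq n) (1 / real (Suc j)) \<subseteq> U}. J.mball (dseq n) (1 / real (Suc j)))"
    using n xM e J.commute[of x "dseq n"] by (auto intro!: bexI[of _ "(n, j)"])
qed auto

text \<open>The prescribed sets are a countable base of balls, which makes \<open>h\<close> Borel
  measurable. Inner approximation gives one inequality between the measures; applied to a set and to
  its complement, it becomes an equality.\<close>

lemma parametrization:
  obtains \<mu> :: "(nat \<Rightarrow> real) measure" and h :: "(nat \<Rightarrow> real) \<Rightarrow> 'a"
  where "prob_space \<mu>" "sets \<mu> = sets borel" "h \<in> measurable \<mu> B" "distr \<mu> B h = B"
    "\<And>A. A \<in> sets M \<Longrightarrow> \<exists>D\<in>sets borel. h ` D \<subseteq> A \<and> measure \<mu> D = measure M A"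
proof -
  define \<U> where "\<U> = (\<lambda>(n, j). J.mball (dseq n) (1 / real (Suc j))) ` UNIV"
  have \<U>: "countable \<U>" "\<U> \<subseteq> sets M"
    using sets_B_subset[OF ball_sets_B] by (auto simp: \<U>_def)
  obtain \<mu> :: "(nat \<Rightarrow> real) measure" and h :: "(nat \<Rightarrow> real) \<Rightarrow> 'a"
    where \<mu>: "prob_space \<mu>" and sets\<mu>: "sets \<mu> = sets borel" and hM: "\<And>q. h q \<in> space M"
      and hU: "\<And>U. U \<in> \<U> \<Longrightarrow> h -` U \<in> sets borel"
      and hD: "\<And>A. A \<in> sets M \<Longrightarrow> \<exists>D\<in>sets borel. h ` D \<subseteq> A \<and> measure \<mu> D = measure M A"
    using standard_prob_space_parametrization[OF standard \<U>] by metis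
  interpret \<mu>: prob_space \<mu> by (rule \<mu>)
  have sp: "space \<mu> = UNIV" using sets_eq_imp_space_eq[OF sets\<mu>] by simp
  have h: "h \<in> measurable \<mu> B"
  proof (rule measurable_sigma_sets[OF sets_B openin_Pow])
    show "h \<in> space \<mu> \<rightarrow> space M" using hM by auto
    fix U assume "U \<in> {U. openin J.mtopology U}"
    then have eq: "h -` U = (\<Union>(n, j)\<in>{(n, j). J.mball (dseq n) (1 / real (Suc j)) \<subseteq> U}. h -` J.mball (dseq n) (1 / real (Suc j)))"
      by (subst open_eq_Union_balls[of U]) auto
    have "h -` U \<in> sets borel"
      unfolding eq
    proof (rule sets.countable_UN', goal_cases)
      case 2
      show ?case
      proof clarify
        fix n j :: nat
        have "(\<lambda>(n, j). J.mball (dseq n) (1 / real (Suc j))) (n, j) \<in> \<U>" unfolding \<U>_def by (rule imageI) simp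
        from hU[OF this] show "h -` J.mball (dseq n) (1 / real (Suc j)) \<in> sets borel" by simp
      qed
    qed simp
    then show "h -` U \<inter> space \<mu> \<in> sets \<mu>" unfolding sets\<mu> sp Int_UNIV_right .
  qed
  have ge: "measure M A \<le> measure \<mu> (h -` A)" if A: "A \<in> sets B" for A
  proof -
    from hD[OF sets_B_subset[OF A]] obtain D where D: "D \<in> sets borel" "h ` D \<subseteq> A \<and> measure \<mu> D = measure M A" by (rule bexE)
    then have "D \<subseteq> h -` A" by blast
    moreover have "h -` A \<in> sets \<mu>" using measurable_sets[OF h A] by (simp only: sp Int_UNIV_right)
    ultimately have "measure \<mu> D \<le> measure \<mu> (h -` A)" by (rule \<mu>.finite_measure_mono)
    with D show ?thesis by simp
  qed
  have "distr \<mu> B h = B"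
  proof (rule measure_eqI)
    fix A assume "A \<in> sets (distr \<mu> B h)"
    then have A: "A \<in> sets B" by simp
    then have cA: "space M - A \<in> sets B" using sets.compl_sets[OF A] by simp
    have hA: "h -` A \<in> sets \<mu>" using measurable_sets[OF h A] by (simp add: sp)
    have "h -` (space M - A) = space \<mu> - h -` A" using hM by (auto simp: sp)
    then have "measure \<mu> (h -` (space M - A)) = 1 - measure \<mu> (h -` A)" using \<mu>.prob_compl[OF hA] by simp
    moreover have "measure M (space M - A) = 1 - measure M A" using prob_compl[OF sets_B_subset[OF A]] .
    ultimately have "measure \<mu> (h -` A) = measure M A" using ge[OF A] ge[OF cA] by linarith
    then show "emeasure (distr \<mu> B h) A = emeasure B A"
      using A h by (simp add: emeasure_distr sp emeasure_B \<mu>.emeasure_eq_measure emeasure_eq_measure)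
  qed simp
  then show thesis by (rule that[OF \<mu> sets\<mu> h _ hD])
qed

text \<open>The map \<open>g\<close> of distances to the dense sequence is injective, so the preimage of a compact
  subset of \<open>g ` A\<close> is a Borel subset of \<open>A\<close>.\<close>

lemma Borel_inner_approx:
  assumes A: "A \<in> sets M"
  shows "\<exists>A'\<in>sets B. A' \<subseteq> A \<and> measure M A' = measure M A"
proof -
  obtain \<mu> :: "(nat \<Rightarrow> real) measure" and h :: "(nat \<Rightarrow> real) \<Rightarrow> 'a"
  where \<mu>: "prob_space \<mu>" and sets\<mu>: "sets \<mu> = sets borel" and h: "h \<in> measurable \<mu> B" and dist: "distr \<mu> B h = B"
    and hD: "\<And>A. A \<in> sets M \<Longrightarrow> \<exists>D\<in>sets borel. h ` D \<subseteq> A \<and> measure \<mu> D = measure M A"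
    using parametrization by metis
  interpret \<mu>: prob_space \<mu> by (rule \<mu>)
  have sp: "space \<mu> = UNIV" using sets_eq_imp_space_eq[OF sets\<mu>] by simp
  define g where "g x = (\<lambda>n. rdist x (dseq n))" for x
  have g[measurable]: "g \<in> borel_measurable B"
    by (rule measurable_coordinatewise_then_product) (simp add: g_def)
  have inj: "x = y" if xy: "x \<in> space M" "y \<in> space M" "g x = g y" for x y
  proof (rule ccontr)
    assume "x \<noteq> y"
    then have "rdist x y > 0" using J.mdist_pos_less[OF _ xy(1,2)] by simp
    then obtain n where n: "rdist x (dseq n) < rdist x y / 2" using dseq_dense[OF xy(1), of "rdist x y / 2"] by auto
    have "rdist (dseq n) y = rdist x (dseq n)"
      using fun_cong[OF xy(3), of n] by (simp add: g_def J.commute[of _ y])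
    then show False using J.triangle[OF xy(1) dseq_space xy(2), of n] n by linarith
  qed
  have gh: "(\<lambda>q. g (h q)) \<in> borel_measurable borel"
    using measurable_compose[OF h g] unfolding measurable_cong_sets[OF sets\<mu> refl] .
  from hD[OF A] obtain D where "D \<in> sets borel" "h ` D \<subseteq> A \<and> measure \<mu> D = measure M A" by (rule bexE)
  then have D: "D \<in> sets borel" "h ` D \<subseteq> A" "measure \<mu> D = measure M A" by simp_all
  have "\<exists>A'\<in>sets B. A' \<subseteq> A \<and> measure M A - 1 / real (Suc n) \<le> measure M A'" for n
  proof -
    have "\<exists>C. compact C \<and> C \<subseteq> (\<lambda>q. g (h q)) ` D \<and> measure \<mu> D - 1 / real (Suc n) \<le> measure \<mu> (D \<inter> (\<lambda>q. g (h q)) -` C)"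
      by (rule compact_subset_image_measurable[OF \<mu>.finite_measure_axioms sets\<mu> gh D(1)]) simp
    then obtain C where C: "compact C" "C \<subseteq> (\<lambda>q. g (h q)) ` D"
      "measure \<mu> D - 1 / real (Suc n) \<le> measure \<mu> (D \<inter> (\<lambda>q. g (h q)) -` C)" by auto
    let ?A = "g -` C \<inter> space B"
    have A': "?A \<in> sets B" by (rule measurable_sets[OF g borel_compact[OF C(1)]])
    have "?A \<subseteq> A"
    proof
      fix x assume x: "x \<in> ?A"
      then obtain q where q: "q \<in> D" "g x = g (h q)" using C(2) by auto
      then have "x = h q" using x measurable_space[OF h] sp by (intro inj) auto
      then show "x \<in> A" using q D(2) by auto
    qed
    moreover have "measure \<mu> (D \<inter> (\<lambda>q. g (h q)) -` C) \<le> measure \<mu> (h -` ?A \<inter> space \<mu>)"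
      using measurable_space[OF h] measurable_sets[OF h A'] sp by (intro \<mu>.finite_measure_mono) auto
    moreover have "measure \<mu> (h -` ?A \<inter> space \<mu>) = measure M ?A"
      using measure_distr[OF h A'] A' by (simp add: dist measure_B)
    ultimately show ?thesis using A' C(3) D(3) by (intro bexI[of _ ?A]) auto
  qed
  then obtain A' where A': "\<And>n. A' n \<in> sets B" "\<And>n. A' n \<subseteq> A" "\<And>n. measure M A - 1 / real (Suc n) \<le> measure M (A' n)"
    by metis
  have UB: "(\<Union>n. A' n) \<in> sets B" using A' by auto
  have le: "measure M (\<Union>n. A' n) \<le> measure M A" using A' A by (intro finite_measure_mono) auto
  have "measure M A - measure M (\<Union>n. A' n) \<le> 1 / real (Suc n)" for n
    using A'(3)[of n] finite_measure_mono[of "A' n" "\<Union>n. A' n"] sets_B_subset[OF UB] by fastforce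
  then have "measure M A - measure M (\<Union>n. A' n) \<le> 0"
    by (meson dual_order.strict_trans1 linorder_not_le nat_approx_posE less_irrefl)
  then show ?thesis using le UB A' by (intro bexI[of _ "\<Union>n. A' n"]) auto
qed

text \<open>A measurable set contains a Borel set of the same measure, and so does its complement.
  What neither of the two Borel sets covers is a Borel null set, and it contains the difference
  between the given set and its Borel part.\<close>

lemma completion_B: "completion B = M"
proof -
  have 1: "sets (completion B) = sets M"
  proof (intro equalityI subsetI)
    fix A assume "A \<in> sets (completion B)"
    then obtain S N N' where A: "A = S \<union> N" "N \<subseteq> N'" "N' \<in> null_sets B" "S \<in> sets B" by (rule sets_completionE)
    have "N' \<in> null_sets M" using A(3) sets_B_subset by (auto simp: null_sets_def emeasure_B)
    then have "N \<in> sets M" using A(2) complete by blast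
    then show "A \<in> sets M" using A sets_B_subset by auto
  next
    fix A assume A: "A \<in> sets M"
    then have cA: "space M - A \<in> sets M" by auto
    obtain S where S: "S \<in> sets B" "S \<subseteq> A" "measure M S = measure M A" using Borel_inner_approx[OF A] by auto
    obtain R where R: "R \<in> sets B" "R \<subseteq> space M - A" "measure M R = measure M (space M - A)" using Borel_inner_approx[OF cA] by auto
    let ?N = "space M - R - S"
    have N: "?N \<in> sets B" using R S sets.top[of B] by auto
    have "measure M (space M - R) = 1 - measure M R" using prob_compl[OF sets_B_subset[OF R(1)]] .
    moreover have "measure M ?N = measure M (space M - R) - measure M S"
      using R S sets_B_subset sets.sets_into_space[OF A] by (intro finite_measure_Diff) auto
    ultimately have "measure M ?N = 0" using R(3) S(3) prob_compl[OF A] by simp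
    then have "?N \<in> null_sets B" using N by (auto simp: null_sets_def emeasure_B emeasure_eq_measure)
    then show "A \<in> sets (completion B)"
      using S R sets.sets_into_space[OF A] by (intro sets_completionI[of A S "A - S" ?N B]) auto
  qed
  show ?thesis
  proof (rule measure_eqI[OF 1])
    fix A assume A: "A \<in> sets (completion B)"
    have mp: "main_part B A \<in> sets B" using A by (rule main_part_sets)
    have un: "main_part B A \<union> null_part B A = A" using A by (rule main_part_null_part_Un)
    obtain N where N: "N \<in> null_sets B" "null_part B A \<subseteq> N" using null_part[OF A] by auto
    then have NM: "N \<in> null_sets M" using sets_B_subset by (auto simp: null_sets_def emeasure_B)
    have "emeasure (completion B) A = emeasure M (main_part B A)"
      unfolding emeasure_completion[OF A] using mp by (rule emeasure_B)
    also have "\<dots> = emeasure M A"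
    proof (rule emeasure_eq_AE)
      show "AE x in M. x \<in> main_part B A \<longleftrightarrow> x \<in> A"
        using AE_not_in[OF NM] by eventually_elim (use un N in blast)
      show "main_part B A \<in> sets M" by (rule sets_B_subset[OF mp])
      show "A \<in> sets M" using A unfolding 1 .
    qed
    finally show "emeasure (completion B) A = emeasure M A" .
  qed
qed

lemma AE_B_iff: "(AE x in B. P x) \<longleftrightarrow> (AE x in M. P x)"
  using AE_completion_iff[of P B] unfolding completion_B by (rule sym)

lemma measurable_B_M: "f \<in> measurable B N \<Longrightarrow> f \<in> measurable M N"
  using measurable_completion[of f B N] unfolding completion_B .

lemma integral_B: "f \<in> borel_measurable B \<Longrightarrow> integral\<^sup>L M f = (integral\<^sup>L B f :: real)"
  using integral_completion[of f B] unfolding completion_B .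

end


section \<open>A Borel version of the kernel\<close>

lemma (in prob_space) integral_abs_squared_le:
  fixes f :: "'a \<Rightarrow> real"
  assumes "f \<in> borel_measurable M" "\<And>x. x \<in> space M \<Longrightarrow> \<bar>f x\<bar> \<le> 1"
  shows "(\<integral>x. \<bar>f x\<bar> \<partial>M)\<^sup>2 \<le> (\<integral>x. (f x)\<^sup>2 \<partial>M)"
proof -
  have 1: "integrable M (\<lambda>x. \<bar>f x\<bar>)"
    by (rule integrable_const_bound[where B=1]) (use assms in auto)
  have 2: "integrable M (\<lambda>x. \<bar>f x\<bar>\<^sup>2)"
    by (rule integrable_const_bound[where B=1]) (use assms in \<open>auto simp: abs_square_le_1\<close>)
  have "0 \<le> variance (\<lambda>x. \<bar>f x\<bar>)" by simp
  then show ?thesis using variance_eq[OF 1 2] by simp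
qed

context pure_graphon_space
begin

text \<open>Taking the least index makes the choice of a nearby dense point a countably valued Borel
  function of \<open>x\<close>.\<close>

definition idx :: "nat \<Rightarrow> 'a \<Rightarrow> nat" where
  "idx m x = (LEAST n. rdist x (dseq n) < (1/2) ^ m)"

lemma idx: "x \<in> space M \<Longrightarrow> rdist x (dseq (idx m x)) < (1/2) ^ m"
  unfolding idx_def by (rule LeastI_ex) (rule dseq_dense, auto)

lemma idx_measurable[measurable]: "idx m \<in> measurable B (count_space UNIV)"
  unfolding idx_def by (intro measurable_Least) measurable

text \<open>Only countably many sections are replaced by Borel versions, so the exceptional null
  sets have a null union.\<close>

definition wseq :: "nat \<Rightarrow> 'a \<Rightarrow> real" where
  "wseq n = (SOME g. g \<in> borel_measurable B \<and> (AE y in B. W (dseq n) y = g y))"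

lemma wseq: "wseq n \<in> borel_measurable B" "AE y in M. W (dseq n) y = wseq n y"
proof -
  have "W (dseq n) \<in> borel_measurable (completion B)"
    unfolding completion_B by (rule W_section) simp
  then have "\<exists>g. g \<in> borel_measurable B \<and> (AE y in B. W (dseq n) y = g y)"
    using completion_ex_borel_measurable_real by blast
  from someI_ex[OF this] show "wseq n \<in> borel_measurable B" "AE y in M. W (dseq n) y = wseq n y"
    unfolding wseq_def AE_B_iff by auto
qed

text \<open>Approximating \<open>x\<close> by points of the dense sequence so fast that the \<open>L\<^sup>1\<close> errors are summable
  gives a jointly Borel function that agrees almost everywhere with every section \<open>W x\<close>, not only
  with almost every one. Where the sequence diverges \<open>lim\<close> is a junk value, hence the truncation.\<close>

definition W2 :: "'a \<Rightarrow> 'a \<Rightarrow> real" where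
  "W2 x y = max 0 (min 1 (lim (\<lambda>m. wseq (idx m x) y)))"

lemma W2_bounds: "0 \<le> W2 x y" "W2 x y \<le> 1"
  by (auto simp: W2_def)

lemma W2_joint[measurable]: "(\<lambda>(x, y). W2 x y) \<in> borel_measurable (B \<Otimes>\<^sub>M B)"
proof -
  have [measurable]: "wseq n \<in> borel_measurable B" for n by (rule wseq)
  have "(\<lambda>p. wseq (idx m (fst p)) (snd p)) \<in> borel_measurable (B \<Otimes>\<^sub>M B)" for m
    by (rule measurable_compose_countable'[where I=UNIV and f="\<lambda>n p. wseq n (snd p)" and g="\<lambda>p. idx m (fst p)"])
       measurable
  then have [measurable]: "(\<lambda>p. lim (\<lambda>m. wseq (idx m (fst p)) (snd p))) \<in> borel_measurable (B \<Otimes>\<^sub>M B)"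
    by (rule borel_measurable_lim_metric)
  show ?thesis unfolding W2_def split_beta by measurable
qed

lemma W2_measurable[measurable (raw)]:
  "f \<in> measurable N B \<Longrightarrow> g \<in> measurable N B \<Longrightarrow> (\<lambda>x. W2 (f x) (g x)) \<in> borel_measurable N"
  using measurable_compose[OF measurable_Pair W2_joint, of f N g] by simp

lemma W2_section[measurable]: "x \<in> space M \<Longrightarrow> W2 x \<in> borel_measurable B"
proof -
  assume x: "x \<in> space M"
  have "(\<lambda>_. x) \<in> measurable B B" by (rule measurable_const) (simp add: x)
  from W2_measurable[OF this measurable_ident] show ?thesis by simp
qed

lemma prob_B_space[simp]: "measure B (space M) = 1"
  using B.prob_space by simp

lemma abs_diff_W_le: "x \<in> space M \<Longrightarrow> y \<in> space M \<Longrightarrow> z \<in> space M \<Longrightarrow> \<bar>W x z - W y z\<bar> \<le> 1"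
  using W_bounds[of x z] W_bounds[of y z] by auto

lemma integrable_abs_diff_W:
  "x \<in> space M \<Longrightarrow> y \<in> space M \<Longrightarrow> integrable M (\<lambda>z. \<bar>W x z - W y z\<bar>)"
  using W_section[of x] W_section[of y]
  by (intro integrable_const_bound[where B=1]) (auto simp: abs_diff_W_le)

lemma W2_AE: 
  assumes x: "x \<in> space M" shows "AE y in M. W2 x y = W x y"
proof -
  let ?f = "\<lambda>m y. \<bar>W x y - W (dseq (idx m x)) y\<bar>"
  have [measurable]: "?f m \<in> borel_measurable M" for m
    using W_section[OF x] W_section[OF dseq_space, of "idx m x"] by measurable
  have le: "(\<integral>\<^sup>+y. ennreal (?f m y) \<partial>M) \<le> ennreal ((1/2)^m)" for m
  proof -
    have "(\<integral>\<^sup>+y. ennreal (?f m y) \<partial>M) = ennreal (rdist x (dseq (idx m x)))"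
      unfolding neighborhood_dist_def
      by (rule nn_integral_eq_integral) (auto intro!: integrable_abs_diff_W x)
    then show ?thesis using idx[OF x, of m] by (simp add: ennreal_leI less_imp_le)
  qed
  \<comment> \<open>By monotone convergence, errors that are summable in mean are summable at almost
    every \<open>y\<close>, which upgrades convergence in mean to convergence almost
    everywhere.\<close>
  have "(\<integral>\<^sup>+y. (\<Sum>m. ennreal (?f m y)) \<partial>M) = (\<Sum>m. \<integral>\<^sup>+y. ennreal (?f m y) \<partial>M)"
    by (rule nn_integral_suminf) measurable
  also have "\<dots> \<le> (\<Sum>m. ennreal ((1/2)^m))"
    by (intro suminf_le le) auto
  also have "\<dots> < \<infinity>"
    by (subst suminf_ennreal2) (auto intro!: summable_geometric)
  finally have "(\<integral>\<^sup>+y. (\<Sum>m. ennreal (?f m y)) \<partial>M) \<noteq> \<infinity>" by simp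
  then have fin: "AE y in M. (\<Sum>m. ennreal (?f m y)) \<noteq> \<infinity>"
    by (intro nn_integral_PInf_AE) measurable
  have eq: "AE y in M. \<forall>n. W (dseq n) y = wseq n y"
    by (subst AE_all_countable) (auto intro: wseq)
  from fin eq AE_space show ?thesis
  proof eventually_elim
    case (elim y)
    have "summable (\<lambda>m. ?f m y)"
      by (rule summable_suminf_not_top) (use elim in auto)
    then have "(\<lambda>m. ?f m y) \<longlonglongrightarrow> 0" by (rule summable_LIMSEQ_zero)
    then have "(\<lambda>m. W x y - W (dseq (idx m x)) y) \<longlonglongrightarrow> 0" by (rule tendsto_rabs_zero_cancel)
    then have "(\<lambda>m. W x y - (W x y - W (dseq (idx m x)) y)) \<longlonglongrightarrow> W x y - 0"
      by (intro tendsto_diff tendsto_const)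
    then have "(\<lambda>m. wseq (idx m x) y) \<longlonglongrightarrow> W x y" using elim by simp
    then show ?case using W_bounds[OF x, of y] elim by (simp add: W2_def limI)
  qed
qed

section \<open>The neighborhood distance and the kernel \<open>K\<close>\<close>

lemma rdist_eq:
  assumes "x \<in> space M" "y \<in> space M"
  shows "rdist x y = (\<integral>z. \<bar>W2 x z - W2 y z\<bar> \<partial>B)"
proof -
  have m: "(\<lambda>z. \<bar>W2 x z - W2 y z\<bar>) \<in> borel_measurable B" using assms by measurable
  have "rdist x y = (\<integral>z. \<bar>W2 x z - W2 y z\<bar> \<partial>M)"
    unfolding neighborhood_dist_def
  proof (rule integral_cong_AE)
    show "AE z in M. \<bar>W x z - W y z\<bar> = \<bar>W2 x z - W2 y z\<bar>"
      using W2_AE[OF assms(1)] W2_AE[OF assms(2)] by eventually_elim simp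
  qed (use W_section[OF assms(1)] W_section[OF assms(2)] measurable_B_M[OF m] in measurable)
  also have "\<dots> = (\<integral>z. \<bar>W2 x z - W2 y z\<bar> \<partial>B)" by (rule integral_B[OF m])
  finally show ?thesis .
qed

text \<open>This is the kernel of the square of \<open>W\<close> as an integral operator, or the
  density of a path of length two rooted at its ends. It depends on the sections of \<open>W\<close>
  only up to null sets, hence is meaningful at every pair of points.\<close>

definition K :: "'a \<Rightarrow> 'a \<Rightarrow> real" where
  "K x y = (\<integral>z. W2 x z * W2 y z \<partial>B)"

lemma K_commute: "K x y = K y x"
  by (simp add: K_def mult.commute)

lemma integrable_W2_mult:
  "x \<in> space M \<Longrightarrow> y \<in> space M \<Longrightarrow> integrable B (\<lambda>z. W2 x z * W2 y z)"
proof (rule B.integrable_const_bound[where B=1])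
  show "AE z in B. norm (W2 x z * W2 y z) \<le> 1"
    by (auto intro!: AE_I2 mult_le_one simp: W2_bounds abs_mult)
qed measurable

lemma K_bounds: "x \<in> space M \<Longrightarrow> y \<in> space M \<Longrightarrow> 0 \<le> K x y \<and> K x y \<le> 1"
proof -
  assume xy: "x \<in> space M" "y \<in> space M"
  have "K x y \<le> (\<integral>z. 1 \<partial>B)" unfolding K_def
    by (rule integral_mono[OF integrable_W2_mult[OF xy]]) (auto intro!: mult_le_one simp: W2_bounds)
  moreover have "0 \<le> K x y" unfolding K_def by (intro integral_nonneg_AE AE_I2) (auto simp: W2_bounds)
  ultimately show ?thesis by simp
qed

lemma K_measurable[measurable (raw)]:
  assumes "f \<in> measurable N B" "g \<in> measurable N B"
  shows "(\<lambda>x. K (f x) (g x)) \<in> borel_measurable N"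
proof -
  have "(\<lambda>p. K (fst p) (snd p)) \<in> borel_measurable (B \<Otimes>\<^sub>M B)"
    unfolding K_def by measurable
  from measurable_compose[OF measurable_Pair[OF assms] this] show ?thesis by simp
qed

text \<open>Half of the comparison of the two uniformities: since \<open>W2 z\<close> is at most 1,
  the difference is bounded by the distance in mean. The reverse half is
  \<open>rdist_squared_le\<close>.\<close>

lemma K_diff_le:
  assumes "x \<in> space M" "y \<in> space M" "z \<in> space M"
  shows "\<bar>K x z - K y z\<bar> \<le> rdist x y"
proof -
  have eq: "K x z - K y z = (\<integral>u. (W2 x u - W2 y u) * W2 z u \<partial>B)"
    unfolding K_def using assms
    by (subst Bochner_Integration.integral_diff[symmetric]) (auto intro!: integrable_W2_mult simp: algebra_simps)
  have "\<bar>K x z - K y z\<bar> \<le> (\<integral>u. \<bar>(W2 x u - W2 y u) * W2 z u\<bar> \<partial>B)"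
    unfolding eq by (rule integral_abs_bound)
  also have "\<dots> \<le> (\<integral>u. \<bar>W2 x u - W2 y u\<bar> \<partial>B)"
  proof (rule integral_mono_AE)
    have b: "\<bar>W2 x u - W2 y u\<bar> \<le> 1" for u
      using W2_bounds[of x u] W2_bounds[of y u] by auto
    have le: "\<bar>(W2 x u - W2 y u) * W2 z u\<bar> \<le> \<bar>W2 x u - W2 y u\<bar>" for u
      by (simp add: abs_mult mult_left_le W2_bounds)
    have b': "\<bar>(W2 x u - W2 y u) * W2 z u\<bar> \<le> 1" for u
      by (rule order_trans[OF le b])
    have "(\<lambda>u. \<bar>W2 x u - W2 y u\<bar>) \<in> borel_measurable B" using assms by measurable
    then show "integrable B (\<lambda>u. \<bar>W2 x u - W2 y u\<bar>)"
      by (rule B.integrable_const_bound[where B=1, rotated]) (simp add: b)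
    have "(\<lambda>u. \<bar>(W2 x u - W2 y u) * W2 z u\<bar>) \<in> borel_measurable B" using assms by measurable
    then show "integrable B (\<lambda>u. \<bar>(W2 x u - W2 y u) * W2 z u\<bar>)"
      by (rule B.integrable_const_bound[where B=1, rotated]) (simp add: b')
    show "AE u in B. \<bar>(W2 x u - W2 y u) * W2 z u\<bar> \<le> \<bar>W2 x u - W2 y u\<bar>" by (rule AE_I2) (rule le)
  qed
  also have "\<dots> = rdist x y" using rdist_eq[OF assms(1,2)] by simp
  finally show ?thesis .
qed

text \<open>Expand \<open>\<parallel>W x - W y\<parallel>\<^sup>2\<close> in \<open>L\<^sup>2\<close>; it dominates the squared \<open>L\<^sup>1\<close> distance.\<close>

lemma rdist_squared_le:
  assumes "x \<in> space M" "y \<in> space M"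
  shows "(rdist x y)\<^sup>2 \<le> \<bar>K x x - K y x\<bar> + \<bar>K x y - K y y\<bar>"
proof -
  have "(rdist x y)\<^sup>2 \<le> (\<integral>u. (W2 x u - W2 y u)\<^sup>2 \<partial>B)"
    unfolding rdist_eq[OF assms]
  proof (rule B.integral_abs_squared_le)
    show "\<bar>W2 x u - W2 y u\<bar> \<le> 1" for u
      using W2_bounds[of x u] W2_bounds[of y u] by auto
  qed (use assms in measurable)
  also have "\<dots> = (K x x - K y x) - (K x y - K y y)"
  proof -
    have "(\<integral>u. (W2 x u - W2 y u)\<^sup>2 \<partial>B) =
      (\<integral>u. (W2 x u * W2 x u - W2 y u * W2 x u) - (W2 x u * W2 y u - W2 y u * W2 y u) \<partial>B)"
      by (simp add: power2_eq_square algebra_simps)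
    also have "\<dots> = (K x x - K y x) - (K x y - K y y)"
      unfolding K_def using assms by (simp add: integrable_W2_mult mult.commute)
    finally show ?thesis .
  qed
  finally show ?thesis by linarith
qed

end


section \<open>Densities and automorphisms\<close>

lemma borel_measurable_completion_AE:
  fixes f g :: "'a \<Rightarrow> real"
  assumes g: "g \<in> borel_measurable N" and eq: "AE x in N. f x = g x"
  shows "f \<in> borel_measurable (completion N)"
proof (rule measurableI)
  fix A :: "real set" assume "A \<in> sets borel"
  then have A: "g -` A \<inter> space N \<in> sets (completion N)" using measurable_sets[OF g] by auto
  have "AE x in completion N. x \<in> g -` A \<inter> space N \<longleftrightarrow> x \<in> f -` A \<inter> space N"
    using AE_completion[OF eq] by eventually_elim auto
  from completion.in_sets_AE[OF this A] show "f -` A \<inter> space (completion N) \<in> sets (completion N)" by simp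
qed simp

lemma distr_PiM_two_components:
  assumes N: "prob_space N" and ij: "i \<in> I" "j \<in> I" "i \<noteq> j"
  shows "distr (PiM I (\<lambda>_. N)) (N \<Otimes>\<^sub>M N) (\<lambda>\<omega>. (\<omega> i, \<omega> j)) = N \<Otimes>\<^sub>M N"
proof -
  interpret N: prob_space N by (rule N)
  interpret P: product_prob_space "\<lambda>_. N" I ..
  have m: "(\<lambda>\<omega>. (\<omega> i, \<omega> j)) \<in> measurable (PiM I (\<lambda>_. N)) (N \<Otimes>\<^sub>M N)"
    using ij by measurable
  have "N \<Otimes>\<^sub>M N = distr (PiM I (\<lambda>_. N)) (N \<Otimes>\<^sub>M N) (\<lambda>\<omega>. (\<omega> i, \<omega> j))"
  proof (rule pair_measure_eqI)
    fix A B assume AB: "A \<in> sets N" "B \<in> sets N"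
    have "(\<lambda>\<omega>. (\<omega> i, \<omega> j)) -` (A \<times> B) \<inter> space (PiM I (\<lambda>_. N)) =
      {\<omega>\<in>space (PiM I (\<lambda>_. N)). \<forall>l\<in>{i, j}. \<omega> l \<in> (if l = i then A else B)}"
      using ij by auto
    then have "emeasure (distr (PiM I (\<lambda>_. N)) (N \<Otimes>\<^sub>M N) (\<lambda>\<omega>. (\<omega> i, \<omega> j))) (A \<times> B) =
      emeasure (PiM I (\<lambda>_. N)) {\<omega>\<in>space (PiM I (\<lambda>_. N)). \<forall>l\<in>{i, j}. \<omega> l \<in> (if l = i then A else B)}"
      using AB m by (subst emeasure_distr) auto
    also have "\<dots> = (\<Prod>l\<in>{i, j}. emeasure N (if l = i then A else B))"
      using ij AB by (intro P.emeasure_PiM_Collect) auto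
    also have "\<dots> = emeasure N A * emeasure N B" using ij by simp
    finally show "emeasure N A * emeasure N B = emeasure (distr (PiM I (\<lambda>_. N)) (N \<Otimes>\<^sub>M N) (\<lambda>\<omega>. (\<omega> i, \<omega> j))) (A \<times> B)" by simp
  qed (simp_all add: N.sigma_finite_measure_axioms)
  then show ?thesis by simp
qed

lemma AE_PiM_two_components:
  assumes "prob_space N" "i \<in> I" "j \<in> I" "i \<noteq> j" and R: "AE p in N \<Otimes>\<^sub>M N. R (fst p) (snd p)"
  shows "AE \<omega> in PiM I (\<lambda>_. N). R (\<omega> i) (\<omega> j)"
proof -
  have m: "(\<lambda>\<omega>. (\<omega> i, \<omega> j)) \<in> measurable (PiM I (\<lambda>_. N)) (N \<Otimes>\<^sub>M N)"
    using assms(2,3) by measurable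
  have "AE p in distr (PiM I (\<lambda>_. N)) (N \<Otimes>\<^sub>M N) (\<lambda>\<omega>. (\<omega> i, \<omega> j)). R (fst p) (snd p)"
    unfolding distr_PiM_two_components[OF assms(1-4)] by (rule R)
  from AE_distrD[OF m this] show ?thesis by simp
qed

text \<open>Fubini is applied to the Borel version \<open>f'\<close> of \<open>f\<close>. The null
  set where the two differ has null sections over almost every \<open>x\<close>, which transfers the
  hypothesis to \<open>f'\<close>.\<close>

lemma (in prob_space) AE_pair_completion_eqI:
  fixes f g :: "'a \<times> 'a \<Rightarrow> real"
  assumes f: "f \<in> borel_measurable (completion (M \<Otimes>\<^sub>M M))" and g: "g \<in> borel_measurable (M \<Otimes>\<^sub>M M)"
    and eq: "\<And>x. x \<in> space M \<Longrightarrow> AE y in M. f (x, y) = g (x, y)"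
  shows "AE p in M \<Otimes>\<^sub>M M. f p = g p"
proof -
  interpret pair_prob_space M M ..
  obtain f' where f': "f' \<in> borel_measurable (M \<Otimes>\<^sub>M M)" "AE p in M \<Otimes>\<^sub>M M. f p = f' p"
    using completion_ex_borel_measurable_real[OF f] by auto
  have "AE x in M. AE y in M. f' (x, y) = g (x, y)"
    using AE_pair[OF f'(2)] AE_space
  proof eventually_elim
    case (elim x)
    from elim(1) eq[OF elim(2)] show ?case by eventually_elim simp
  qed
  moreover have "{p \<in> space (M \<Otimes>\<^sub>M M). f' p = g p} \<in> sets (M \<Otimes>\<^sub>M M)"
    using f'(1) g by measurable
  ultimately have "AE p in M \<Otimes>\<^sub>M M. f' p = g p" by (rule AE_pair_measure[rotated])
  with f'(2) show ?thesis by eventually_elim simp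
qed

definition edge_pairs :: "nat set set \<Rightarrow> (nat \<times> nat) set" where
  "edge_pairs E = {(i, j). i < j \<and> {i, j} \<in> E}"

lemma edge_pairsD:
  assumes "labeled_simple_graph k V E" "(i, j) \<in> edge_pairs E"
  shows "i \<in> V" "j \<in> V" "i < j"
proof -
  have "{i, j} \<in> E" "i < j" using assms(2) by (auto simp: edge_pairs_def)
  moreover obtain i' j' where "i' \<in> V" "j' \<in> V" "{i, j} = {i', j'}"
    using assms(1) \<open>{i, j} \<in> E\<close> unfolding labeled_simple_graph_def by blast
  ultimately show "i \<in> V" "j \<in> V" "i < j" by (auto simp: doubleton_eq_iff)
qed

lemma finite_edge_pairs:
  assumes "labeled_simple_graph k V E" shows "finite (edge_pairs E)"
proof (rule finite_subset)
  show "edge_pairs E \<subseteq> V \<times> V" using edge_pairsD[OF assms] by auto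
  show "finite (V \<times> V)" using assms by (simp add: labeled_simple_graph_def)
qed

context pure_graphon_space
begin

lemma measurable_M_B:
  assumes "f \<in> measurable N M" shows "f \<in> measurable N B"
proof (rule measurableI)
  show "f x \<in> space B" if "x \<in> space N" for x using measurable_space[OF assms that] by simp
  show "f -` A \<inter> space N \<in> sets N" if "A \<in> sets B" for A
    by (rule measurable_sets[OF assms sets_B_subset[OF that]])
qed

lemma W2_AE_pair: "AE p in M \<Otimes>\<^sub>M M. W2 (fst p) (snd p) = W (fst p) (snd p)"
proof -
  have "AE p in M \<Otimes>\<^sub>M M. (\<lambda>(x, y). W x y) p = (\<lambda>(x, y). W2 x y) p"
  proof (rule AE_pair_completion_eqI[OF W_joint])
    have "fst \<in> measurable (M \<Otimes>\<^sub>M M) B" "snd \<in> measurable (M \<Otimes>\<^sub>M M) B"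
      by (auto intro: measurable_M_B)
    from W2_measurable[OF this] show "(\<lambda>(x, y). W2 x y) \<in> borel_measurable (M \<Otimes>\<^sub>M M)"
      by (simp add: split_beta)
    show "AE y in M. (\<lambda>(x, y). W x y) (x, y) = (\<lambda>(x, y). W2 x y) (x, y)" if "x \<in> space M" for x
      using W2_AE[OF that] by eventually_elim simp
  qed
  then show ?thesis by eventually_elim (simp add: split_beta)
qed

text \<open>The first argument of \<open>W2\<close> is the labeled node, if there is one: the sections of \<open>W2\<close>
  represent those of \<open>W\<close> only in the first variable.\<close>

definition edge_factor :: "nat \<Rightarrow> (nat \<Rightarrow> 'a) \<Rightarrow> nat \<times> nat \<Rightarrow> real" where
  "edge_factor k x = (\<lambda>(i, j). if j \<in> {1..k} then W2 (x j) (x i) else W2 (x i) (x j))"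

text \<open>Here nonadjacency of the labels is decisive. An edge at a label needs \<open>R\<close>
  on one section, which is available for every point \<open>a i\<close>; an edge between unlabeled
  nodes needs it for almost every pair. An edge between two labels would need it at one given pair,
  which no almost-everywhere statement provides. The relation \<open>R\<close> will be agreement of
  \<open>W2\<close> with \<open>W\<close>, and invariance of \<open>W2\<close> under an
  automorphism.\<close>

lemma AE_edges:
  assumes G: "labeled_simple_graph k V E" "labels_nonadjacent k E" and a: "\<forall>i\<in>{1..k}. a i \<in> space M"
    and R: "\<And>x. x \<in> space M \<Longrightarrow> AE y in M. R x y" and R2: "AE p in M \<Otimes>\<^sub>M M. R (fst p) (snd p)"
  shows "AE y in PiM (V - {1..k}) (\<lambda>_. M). \<forall>e\<in>edge_pairs E.
    (case e of (i, j) \<Rightarrow> let x = override_on y a {1..k} in if j \<in> {1..k} then R (x j) (x i) else R (x i) (x j))"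
    (is "AE y in ?P. \<forall>e\<in>_. ?Q y e")
proof (rule AE_finite_allI[OF finite_edge_pairs[OF G(1)]])
  fix e assume e: "e \<in> edge_pairs E"
  obtain i j where ij: "e = (i, j)" by (cases e)
  note D = edge_pairsD[OF G(1) e[unfolded ij]]
  have na: "i \<notin> {1..k} \<or> j \<notin> {1..k}"
    using G(2) e by (auto simp: ij labels_nonadjacent_def edge_pairs_def)
  have comp: "AE y in ?P. R x (y l)" if "x \<in> space M" "l \<in> V - {1..k}" for x l
    using prob_space_axioms that(2) R[OF that(1)] by (intro AE_PiM_component) auto
  consider "j \<in> {1..k}" | "i \<in> {1..k}" "j \<notin> {1..k}" | "i \<notin> {1..k}" "j \<notin> {1..k}" by blast
  then show "AE y in ?P. ?Q y e"
  proof cases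
    case 1
    then show ?thesis using comp[of "a j" i] a D na by (simp add: ij override_on_def Let_def del: atLeastAtMost_iff)
  next
    case 2
    then show ?thesis using comp[of "a i" j] a D by (simp add: ij override_on_def Let_def del: atLeastAtMost_iff)
  next
    case 3
    have "AE y in ?P. R (y i) (y j)"
      using prob_space_axioms _ _ _ R2 by (rule AE_PiM_two_components) (use 3 D in auto)
    then show ?thesis using 3 by (simp add: ij override_on_def Let_def del: atLeastAtMost_iff)
  qed
qed

lemma edge_factor_measurable:
  assumes G: "labeled_simple_graph k V E" and a: "\<forall>i\<in>{1..k}. a i \<in> space M"
    and N: "\<And>i. i \<in> V - {1..k} \<Longrightarrow> (\<lambda>y. f y i) \<in> measurable N B"
  shows "(\<lambda>y. \<Prod>e\<in>edge_pairs E. edge_factor k (override_on (f y) a {1..k}) e) \<in> borel_measurable N"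
proof (rule borel_measurable_prod)
  fix e assume e: "e \<in> edge_pairs E"
  obtain i j where ij: "e = (i, j)" by (cases e)
  note D = edge_pairsD[OF G e[unfolded ij]]
  have "(\<lambda>y. override_on (f y) a {1..k} l) \<in> measurable N B" if "l \<in> V" for l
  proof (cases "l \<in> {1..k}")
    case True
    then show ?thesis using a by (simp add: override_on_def del: atLeastAtMost_iff)
  next
    case False
    then show ?thesis using N[of l] that by (simp add: override_on_def del: atLeastAtMost_iff)
  qed
  note * = this[OF D(1)] this[OF D(2)]
  show "(\<lambda>y. edge_factor k (override_on (f y) a {1..k}) e) \<in> borel_measurable N"
    unfolding edge_factor_def ij prod.case by (cases "j \<in> {1..k}") (simp_all only: if_True if_False, intro W2_measurable *, intro W2_measurable *)
qed

text \<open>The integrand built from \<open>W2\<close> is measurable before completion and agrees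
  with the original one almost everywhere, so the completed product can be traded for the plain
  one.\<close>

lemma restricted_hom_density_eq:
  assumes G: "labeled_simple_graph k V E" "labels_nonadjacent k E" and a: "\<forall>i\<in>{1..k}. a i \<in> space M"
  shows "restricted_hom_density M W k V E a =
    (\<integral>y. (\<Prod>e\<in>edge_pairs E. edge_factor k (override_on y a {1..k}) e) \<partial>PiM (V - {1..k}) (\<lambda>_. M))"
proof -
  let ?P = "PiM (V - {1..k}) (\<lambda>_. M)"
  let ?f = "\<lambda>y. \<Prod>(i, j) | i < j \<and> {i, j} \<in> E. W (override_on y a {1..k} i) (override_on y a {1..k} j)"
  let ?g = "\<lambda>y. \<Prod>e\<in>edge_pairs E. edge_factor k (override_on y a {1..k}) e"
  have g: "?g \<in> borel_measurable ?P"
    using G(1) a by (rule edge_factor_measurable) (auto intro!: measurable_M_B)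
  have AEe: "AE y in ?P. \<forall>e\<in>edge_pairs E. (case e of (i, j) \<Rightarrow> let x = override_on y a {1..k} in
      if j \<in> {1..k} then W2 (x j) (x i) = W (x j) (x i) else W2 (x i) (x j) = W (x i) (x j))"
    using W2_AE W2_AE_pair by (rule AE_edges[where R="\<lambda>x y. W2 x y = W x y", OF G a])
  have "AE y in ?P. ?f y = ?g y"
    using AEe AE_space
  proof eventually_elim
    case (elim y)
    have y: "override_on y a {1..k} l \<in> space M" if "l \<in> V" for l
      using a elim(2) that by (auto simp: override_on_def space_PiM PiE_iff)
    show ?case
      unfolding edge_pairs_def[symmetric]
    proof (rule prod.cong[OF refl])
      fix e assume e: "e \<in> edge_pairs E"
      obtain i j where ij: "e = (i, j)" by (cases e)
      note D = edge_pairsD[OF G(1) e[unfolded ij]]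
      show "(case e of (i, j) \<Rightarrow> W (override_on y a {1..k} i) (override_on y a {1..k} j)) =
        edge_factor k (override_on y a {1..k}) e"
        using bspec[OF elim(1) e] W_commute[OF y[OF D(1)] y[OF D(2)]] unfolding ij edge_factor_def
        by (cases "j \<in> {1..k}") (simp_all only: Let_def prod.case if_True if_False)
    qed
  qed
  note fg = this
  have "integral\<^sup>L (completion ?P) ?f = integral\<^sup>L (completion ?P) ?g"
    by (rule integral_cong_AE[OF borel_measurable_completion_AE[OF g fg] measurable_completion[OF g] AE_completion[OF fg]])
  also have "\<dots> = integral\<^sup>L ?P ?g" by (rule integral_completion[OF g])
  finally show ?thesis by (simp add: restricted_hom_density_def Let_def)
qed

text \<open>Change of variables by the map applying \<open>\<phi>\<close> to every free coordinate.
  It carries the integrand at \<open>b\<close> to the one at \<open>a\<close>, up to a null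
  set.\<close>

lemma restricted_hom_density_automorphism:
  assumes \<phi>: "graphon_automorphism M W \<phi>" and ab: "\<forall>i\<in>{1..k}. \<phi> (a i) = b i"
    and G: "labeled_simple_graph k V E" "labels_nonadjacent k E" and a: "\<forall>i\<in>{1..k}. a i \<in> space M"
  shows "restricted_hom_density M W k V E a = restricted_hom_density M W k V E b"
proof -
  let ?I = "V - {1..k}"
  let ?P = "PiM ?I (\<lambda>_. M)"
  let ?g = "\<lambda>a y. \<Prod>e\<in>edge_pairs E. edge_factor k (override_on y a {1..k}) e"
  let ?\<phi> = "\<lambda>y. \<lambda>i\<in>?I. \<phi> (y i)"
  have m: "\<phi> \<in> measurable M M" and d: "distr M M \<phi> = M"
    and \<phi>W: "\<And>x. x \<in> space M \<Longrightarrow> AE y in M. W (\<phi> x) (\<phi> y) = W x y"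
    using \<phi> by (auto simp: graphon_automorphism_def measure_preserving_bij_def)
  note \<phi>s = measurable_space[OF m]
  have b: "\<forall>i\<in>{1..k}. b i \<in> space M" using a ab \<phi>s by metis
  have meas: "?g c \<in> borel_measurable ?P" if "\<forall>i\<in>{1..k}. c i \<in> space M" for c
    using G(1) that by (rule edge_factor_measurable) (auto intro!: measurable_M_B)
  note D = distr_PiM_map[OF prob_space_axioms m d subset_refl, of ?I]
  \<comment> \<open>\<open>W2\<close> and \<open>W\<close> agree at \<open>\<phi> x\<close> and
    almost every \<open>y\<close>; that they also agree at \<open>\<phi> x\<close> and
    \<open>\<phi> y\<close> uses preservation of measure.\<close>
  have R: "AE y in M. W2 (\<phi> x) (\<phi> y) = W2 x y" if x: "x \<in> space M" for x
  proof -
    have "AE y in distr M M \<phi>. W2 (\<phi> x) y = W (\<phi> x) y"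
      unfolding d by (rule W2_AE) (rule \<phi>s[OF x])
    from AE_distrD[OF m this] \<phi>W[OF x] W2_AE[OF x] show ?thesis by eventually_elim simp
  qed
  have R2: "AE p in M \<Otimes>\<^sub>M M. W2 (\<phi> (fst p)) (\<phi> (snd p)) = W2 (fst p) (snd p)"
  proof (rule AE_pair_completion_eqI)
    have *: "(\<lambda>p. \<phi> (fst p)) \<in> measurable (M \<Otimes>\<^sub>M M) B" "(\<lambda>p. \<phi> (snd p)) \<in> measurable (M \<Otimes>\<^sub>M M) B"
      "fst \<in> measurable (M \<Otimes>\<^sub>M M) B" "snd \<in> measurable (M \<Otimes>\<^sub>M M) B"
      using m by (auto intro!: measurable_M_B)
    from W2_measurable[OF *(1,2)] show "(\<lambda>p. W2 (\<phi> (fst p)) (\<phi> (snd p))) \<in> borel_measurable (completion (M \<Otimes>\<^sub>M M))"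
      by (rule measurable_completion)
    from W2_measurable[OF *(3,4)] show "(\<lambda>p. W2 (fst p) (snd p)) \<in> borel_measurable (M \<Otimes>\<^sub>M M)" .
  qed (simp add: R)
  have AEe: "AE y in ?P. \<forall>e\<in>edge_pairs E. (case e of (i, j) \<Rightarrow> let x = override_on y a {1..k} in
      if j \<in> {1..k} then W2 (\<phi> (x j)) (\<phi> (x i)) = W2 (x j) (x i)
      else W2 (\<phi> (x i)) (\<phi> (x j)) = W2 (x i) (x j))"
    using R R2 by (rule AE_edges[where R="\<lambda>x y. W2 (\<phi> x) (\<phi> y) = W2 x y", OF G a])
  have "restricted_hom_density M W k V E b = integral\<^sup>L (distr ?P ?P ?\<phi>) (?g b)"
    unfolding restricted_hom_density_eq[OF G b] D(2) ..
  also have "\<dots> = (\<integral>y. ?g b (?\<phi> y) \<partial>?P)" by (rule integral_distr[OF D(1) meas[OF b]])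
  also have "\<dots> = integral\<^sup>L ?P (?g a)"
  proof (rule integral_cong_AE)
    show "?g a \<in> borel_measurable ?P" by (rule meas[OF a])
    show "(\<lambda>y. ?g b (?\<phi> y)) \<in> borel_measurable ?P" by (rule measurable_compose[OF D(1) meas[OF b]])
    show "AE y in ?P. ?g b (?\<phi> y) = ?g a y"
      using AEe
    proof eventually_elim
      case (elim y)
      show ?case
      proof (rule prod.cong[OF refl])
        fix e assume e: "e \<in> edge_pairs E"
        obtain i j where ij: "e = (i, j)" by (cases e)
        note DE = edge_pairsD[OF G(1) e[unfolded ij]]
        have "override_on (?\<phi> y) b {1..k} l = \<phi> (override_on y a {1..k} l)" if "l \<in> V" for l
          using that ab by (simp add: override_on_def del: atLeastAtMost_iff)
        then show "edge_factor k (override_on (?\<phi> y) b {1..k}) e = edge_factor k (override_on y a {1..k}) e"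
          using bspec[OF elim e] DE unfolding ij edge_factor_def
          by (cases "j \<in> {1..k}") (simp_all only: Let_def prod.case if_True if_False)
      qed
    qed
  qed
  also have "\<dots> = restricted_hom_density M W k V E a" unfolding restricted_hom_density_eq[OF G a] ..
  finally show ?thesis ..
qed

end


section \<open>Densities with infinitely many roots\<close>

text \<open>The second end of an edge is always a free node, so edges between roots are excluded by
  the type.\<close>

type_synonym rooted_edge = "(nat + nat) \<times> nat"

text \<open>The orientation \<open>u < l\<close> rules out loops and gives each edge between free
  nodes a single representation, so that an edge set is a simple graph.\<close>

definition rooted_graph :: "rooted_edge set \<Rightarrow> bool" where
  "rooted_graph E \<longleftrightarrow> finite E \<and> (\<forall>u l. (Inr u, l) \<in> E \<longrightarrow> u < l)"

lemma rooted_graph_bound: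
  assumes "rooted_graph E"
  obtains i where "i > k" "\<And>n l. (n, l) \<in> E \<Longrightarrow> l < i" "\<And>r l. (Inl r, l) \<in> E \<Longrightarrow> r < i" "\<And>u l. (Inr u, l) \<in> E \<Longrightarrow> u < i"
proof -
  have fin: "finite E" using assms by (simp add: rooted_graph_def)
  define A where "A = insert k (snd ` E \<union> (\<lambda>(n, l). case_sum id id n) ` E)"
  define i where "i = Suc (Max A)"
  have "finite A" using fin by (simp add: A_def)
  then have lt: "j < i" if "j \<in> A" for j using le_imp_less_Suc[OF Max_ge[OF _ that]] by (simp add: i_def)
  show thesis
  proof (rule that[of i])
    show "k < i" by (rule lt) (simp add: A_def)
    show "l < i" if "(n, l) \<in> E" for n l by (rule lt) (use that in \<open>force simp: A_def\<close>)
    show "r < i" if "(Inl r, l) \<in> E" for r l by (rule lt) (use that in \<open>force simp: A_def\<close>)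
    show "u < i" if "(Inr u, l) \<in> E" for u l by (rule lt) (use that in \<open>force simp: A_def\<close>)
  qed
qed

context pure_graphon_space
begin

sublocale Sq: sequence_space B
  by unfold_locales

abbreviation SB :: "(nat \<Rightarrow> 'a) measure" where "SB \<equiv> PiM UNIV (\<lambda>_. B)"

lemma space_SB: "space SB = {\<rho>. \<forall>i. \<rho> i \<in> space M}"
  by (auto simp: space_PiM PiE_iff)

lemma SB_measurableI: "(\<And>i. (\<lambda>x. f x i) \<in> measurable N B) \<Longrightarrow> f \<in> measurable N SB"
proof (rule measurable_PiM_single')
  assume m: "\<And>i. (\<lambda>x. f x i) \<in> measurable N B"
  show "(\<lambda>x i. f x i) \<in> space N \<rightarrow> (\<Pi>\<^sub>E i\<in>UNIV. space B)"
    using measurable_space[OF m] by (simp add: PiE_iff)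
qed

lemma SB_measurableD: "f \<in> measurable N SB \<Longrightarrow> (\<lambda>x. f x i) \<in> measurable N B"
  by (rule measurable_compose[OF _ measurable_component_singleton]) auto

definition edge_val :: "(nat \<Rightarrow> 'a) \<Rightarrow> (nat \<Rightarrow> 'a) \<Rightarrow> rooted_edge \<Rightarrow> real" where
  "edge_val \<rho> \<omega> e = W2 (case_sum \<rho> \<omega> (fst e)) (\<omega> (snd e))"

text \<open>The homomorphism density of a graph with edge set \<open>E\<close> whose nodes \<open>Inl r\<close> are mapped
  to \<open>\<rho> r\<close>. No edge joins two of these roots.\<close>

definition rdens :: "rooted_edge set \<Rightarrow> (nat \<Rightarrow> 'a) \<Rightarrow> real" where
  "rdens E \<rho> = (\<integral>\<omega>. (\<Prod>e\<in>E. edge_val \<rho> \<omega> e) \<partial>SB)"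

lemma edge_prod_bounds: "0 \<le> (\<Prod>e\<in>E. edge_val \<rho> \<omega> e)" "(\<Prod>e\<in>E. edge_val \<rho> \<omega> e) \<le> 1"
  by (auto intro!: prod_nonneg prod_le_1 simp: edge_val_def W2_bounds)

lemma edge_val_measurable:
  assumes "f \<in> measurable N SB" "g \<in> measurable N SB"
  shows "(\<lambda>x. edge_val (f x) (g x) e) \<in> borel_measurable N"
proof (cases "fst e")
  case (Inl r)
  show ?thesis unfolding edge_val_def Inl sum.case
    by (intro W2_measurable SB_measurableD assms)
next
  case (Inr r)
  show ?thesis unfolding edge_val_def Inr sum.case
    by (intro W2_measurable SB_measurableD assms)
qed

lemma edge_prod_measurable:
  assumes "f \<in> measurable N SB" "g \<in> measurable N SB"
  shows "(\<lambda>x. \<Prod>e\<in>E. edge_val (f x) (g x) e) \<in> borel_measurable N"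
  by (intro borel_measurable_prod edge_val_measurable assms)

lemma edge_prod_measurable': "\<rho> \<in> space SB \<Longrightarrow> (\<lambda>\<omega>. \<Prod>e\<in>E. edge_val \<rho> \<omega> e) \<in> borel_measurable SB"
  by (rule edge_prod_measurable[OF measurable_const measurable_ident_sets]) auto

lemma edge_prod_integrable:
  "\<rho> \<in> space SB \<Longrightarrow> integrable SB (\<lambda>\<omega>. \<Prod>e\<in>E. edge_val \<rho> \<omega> e)"
  by (rule Sq.P.integrable_const_bound[where B=1, OF AE_I2 edge_prod_measurable'])
    (simp_all add: edge_prod_bounds)

lemma rdens_measurable:
  assumes "f \<in> measurable N SB"
  shows "(\<lambda>x. rdens E (f x)) \<in> borel_measurable N"
proof -
  have "(\<lambda>p. \<Prod>e\<in>E. edge_val (f (fst p)) (snd p) e) \<in> borel_measurable (N \<Otimes>\<^sub>M SB)"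
    by (rule edge_prod_measurable[OF measurable_compose[OF measurable_fst assms] measurable_snd])
  then have "(\<lambda>(x, \<omega>). \<Prod>e\<in>E. edge_val (f x) \<omega> e) \<in> borel_measurable (N \<Otimes>\<^sub>M SB)"
    by (simp add: split_beta)
  then show ?thesis unfolding rdens_def by (rule Sq.P.borel_measurable_lebesgue_integral)
qed

lemma rdens_bounds: "\<rho> \<in> space SB \<Longrightarrow> 0 \<le> rdens E \<rho>" "\<rho> \<in> space SB \<Longrightarrow> rdens E \<rho> \<le> 1"
proof -
  assume \<rho>: "\<rho> \<in> space SB"
  show "0 \<le> rdens E \<rho>" unfolding rdens_def by (rule integral_nonneg_AE) (simp add: edge_prod_bounds)
  have "rdens E \<rho> \<le> (\<integral>\<omega>. 1 \<partial>SB)" unfolding rdens_def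
    by (rule integral_mono[OF edge_prod_integrable[OF \<rho>]]) (simp_all add: edge_prod_bounds)
  also have "\<dots> = 1" using Sq.P.prob_space by simp
  finally show "rdens E \<rho> \<le> 1" .
qed

text \<open>An independent sequence may be resampled from position \<open>i\<close> on:
  \<open>comb_seq\<close> takes its first \<open>i\<close> entries from \<open>z\<close> and the
  others from \<open>\<omega>\<close>. This separates blocks of nodes that are to be integrated one
  after the other.\<close>

lemma integral_comb_seq:
  fixes f :: "(nat \<Rightarrow> 'a) \<Rightarrow> real"
  assumes f: "f \<in> borel_measurable SB" and bd: "\<And>\<omega>. 0 \<le> f \<omega> \<and> f \<omega> \<le> 1"
  shows "integral\<^sup>L SB f = (\<integral>z. \<integral>\<omega>. f (comb_seq i z \<omega>) \<partial>SB \<partial>SB)"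
proof -
  interpret PP: pair_prob_space SB SB ..
  have m: "(\<lambda>(z, \<omega>). comb_seq i z \<omega>) \<in> measurable (SB \<Otimes>\<^sub>M SB) SB" by (rule measurable_comb_seq)
  have m2: "(\<lambda>p. f (case p of (z, \<omega>) \<Rightarrow> comb_seq i z \<omega>)) \<in> borel_measurable (SB \<Otimes>\<^sub>M SB)"
    by (rule measurable_compose[OF m f])
  have int: "integrable (SB \<Otimes>\<^sub>M SB) (\<lambda>p. f (case p of (z, \<omega>) \<Rightarrow> comb_seq i z \<omega>))"
    by (rule PP.P.integrable_const_bound[where B=1, OF AE_I2 m2]) (simp add: bd)
  have "integral\<^sup>L SB f = integral\<^sup>L (distr (SB \<Otimes>\<^sub>M SB) SB (\<lambda>(z, \<omega>). comb_seq i z \<omega>)) f"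
    by (subst Sq.PiM_comb_seq) simp
  also have "\<dots> = (\<integral>p. f (case p of (z, \<omega>) \<Rightarrow> comb_seq i z \<omega>) \<partial>(SB \<Otimes>\<^sub>M SB))"
    by (rule integral_distr[OF m f])
  also have "\<dots> = (\<integral>z. \<integral>\<omega>. f (comb_seq i z \<omega>) \<partial>SB \<partial>SB)"
    using PP.integral_fst'[OF int] by simp
  finally show ?thesis .
qed

lemma integral_case_nat:
  fixes f :: "(nat \<Rightarrow> 'a) \<Rightarrow> real"
  assumes f: "f \<in> borel_measurable SB" and bd: "\<And>\<omega>. 0 \<le> f \<omega> \<and> f \<omega> \<le> 1"
  shows "integral\<^sup>L SB f = (\<integral>x. \<integral>\<omega>. f (case_nat x \<omega>) \<partial>SB \<partial>B)"
proof -
  interpret PP: pair_prob_space B SB ..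
  have m: "(\<lambda>(x, \<omega>). case_nat x \<omega>) \<in> measurable (B \<Otimes>\<^sub>M SB) SB" by measurable
  have m2: "(\<lambda>p. f (case p of (x, \<omega>) \<Rightarrow> case_nat x \<omega>)) \<in> borel_measurable (B \<Otimes>\<^sub>M SB)"
    by (rule measurable_compose[OF m f])
  have int: "integrable (B \<Otimes>\<^sub>M SB) (\<lambda>p. f (case p of (x, \<omega>) \<Rightarrow> case_nat x \<omega>))"
    by (rule PP.P.integrable_const_bound[where B=1, OF AE_I2 m2]) (simp add: bd)
  have "integral\<^sup>L SB f = integral\<^sup>L (distr (B \<Otimes>\<^sub>M SB) SB (\<lambda>(x, \<omega>). case_nat x \<omega>)) f"
    by (subst Sq.PiM_iter) simp
  also have "\<dots> = (\<integral>p. f (case p of (x, \<omega>) \<Rightarrow> case_nat x \<omega>) \<partial>(B \<Otimes>\<^sub>M SB))"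
    by (rule integral_distr[OF m f])
  also have "\<dots> = (\<integral>x. \<integral>\<omega>. f (case_nat x \<omega>) \<partial>SB \<partial>B)"
    using PP.integral_fst'[OF int] by simp
  finally show ?thesis .
qed

text \<open>Gluing at the common roots. The free nodes of the second graph are moved past all those
  of the first, so the two products depend on disjoint blocks of an independent sequence. Edges of
  the two graphs never coincide after gluing because every edge has a free end.\<close>

lemma rdens_mult:
  assumes E: "rooted_graph E" and E': "rooted_graph E'"
  shows "\<exists>F. rooted_graph F \<and> (\<forall>\<rho>\<in>space SB. rdens E \<rho> * rdens E' \<rho> = rdens F \<rho>)"
proof -
  obtain i where i: "\<And>n l. (n, l) \<in> E \<Longrightarrow> l < i" "\<And>u l. (Inr u, l) \<in> E \<Longrightarrow> u < i"
    using rooted_graph_bound[OF E] by metis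
  define sh :: "rooted_edge \<Rightarrow> rooted_edge" where "sh = map_prod (map_sum id ((+) i)) ((+) i)"
  have inj: "inj sh" unfolding sh_def by (intro prod.inj_map sum.inj_map) auto
  let ?F = "E \<union> sh ` E'"
  have disj: "E \<inter> sh ` E' = {}" using i(1) by (fastforce simp: sh_def)
  have fin: "finite E" "finite E'" using E E' by (auto simp: rooted_graph_def)
  have "rooted_graph ?F"
    unfolding rooted_graph_def
  proof (intro conjI allI impI)
    fix u l assume "(Inr u, l) \<in> ?F"
    then consider "(Inr u, l) \<in> E" | n' l' where "(n', l') \<in> E'" "sh (n', l') = (Inr u, l)" by auto
    then show "u < l"
    proof cases
      case 2
      then show ?thesis using E' by (cases n') (auto simp: sh_def rooted_graph_def)
    qed (use E in \<open>auto simp: rooted_graph_def\<close>)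
  qed (use fin in auto)
  moreover have "rdens E \<rho> * rdens E' \<rho> = rdens ?F \<rho>" if \<rho>: "\<rho> \<in> space SB" for \<rho>
  proof -
    have 1: "edge_val \<rho> (comb_seq i \<omega> \<omega>') e = edge_val \<rho> \<omega> e" if "e \<in> E" for e \<omega> \<omega>'
    proof (cases e)
      case (Pair n l)
      then show ?thesis using i that by (cases n) (auto simp: edge_val_def comb_seq_less)
    qed
    have 2: "edge_val \<rho> (comb_seq i \<omega> \<omega>') (sh e) = edge_val \<rho> \<omega>' e" for e \<omega> \<omega>'
    proof (cases e)
      case (Pair n l)
      then show ?thesis using comb_seq_add[of i \<omega> \<omega>']
        by (cases n) (auto simp: edge_val_def sh_def add.commute[of i])
    qed
    have "rdens ?F \<rho> = (\<integral>\<omega>. \<integral>\<omega>'. (\<Prod>e\<in>?F. edge_val \<rho> (comb_seq i \<omega> \<omega>') e) \<partial>SB \<partial>SB)"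
      unfolding rdens_def by (rule integral_comb_seq[OF edge_prod_measurable'[OF \<rho>]]) (simp add: edge_prod_bounds)
    also have "\<dots> = (\<integral>\<omega>. \<integral>\<omega>'. (\<Prod>e\<in>E. edge_val \<rho> \<omega> e) * (\<Prod>e\<in>E'. edge_val \<rho> \<omega>' e) \<partial>SB \<partial>SB)"
    proof -
      have "(\<Prod>e\<in>?F. edge_val \<rho> (comb_seq i \<omega> \<omega>') e) = (\<Prod>e\<in>E. edge_val \<rho> \<omega> e) * (\<Prod>e\<in>E'. edge_val \<rho> \<omega>' e)" for \<omega> \<omega>'
        using inj_on_subset[OF inj subset_UNIV]
        by (subst prod.union_disjoint) (simp_all add: fin disj 1 2 prod.reindex)
      then show ?thesis by simp
    qed
    also have "\<dots> = rdens E \<rho> * rdens E' \<rho>" by (simp add: rdens_def)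
    finally show ?thesis ..
  qed
  ultimately show ?thesis by blast
qed

lemma rdens_empty[simp]: "rdens {} \<rho> = 1"
  using Sq.P.prob_space by (simp add: rdens_def)

lemma rdens_prod_list:
  assumes "\<And>x. x \<in> set xs \<Longrightarrow> \<exists>E. rooted_graph E \<and> (\<forall>\<rho>\<in>space SB. f x \<rho> = rdens E \<rho>)"
  shows "\<exists>F. rooted_graph F \<and> (\<forall>\<rho>\<in>space SB. (\<Prod>x\<leftarrow>xs. f x \<rho>) = rdens F \<rho>)"
  using assms
proof (induction xs)
  case Nil
  show ?case by (rule exI[of _ "{}"]) (simp add: rooted_graph_def)
next
  case (Cons x xs)
  obtain E where E: "rooted_graph E" "\<forall>\<rho>\<in>space SB. f x \<rho> = rdens E \<rho>" using Cons.prems[of x] by auto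
  obtain E' where E': "rooted_graph E'" "\<forall>\<rho>\<in>space SB. (\<Prod>x\<leftarrow>xs. f x \<rho>) = rdens E' \<rho>"
    using Cons.IH Cons.prems by auto
  obtain F where "rooted_graph F" "\<forall>\<rho>\<in>space SB. rdens E \<rho> * rdens E' \<rho> = rdens F \<rho>"
    using rdens_mult[OF E(1) E'(1)] by auto
  then show ?case using E(2) E'(2) by (intro exI[of _ F]) simp
qed

text \<open>The roots must differ: for \<open>r = s\<close> the two edges would be one, and the
  density would be the degree of \<open>\<rho> r\<close> rather than \<open>K\<close> on the
  diagonal.\<close>

lemma rdens_K:
  assumes "r \<noteq> s" "\<rho> \<in> space SB"
  shows "rdens {(Inl r, 0), (Inl s, 0)} \<rho> = K (\<rho> r) (\<rho> s)"
proof -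
  have m: "(\<lambda>x. W2 (\<rho> r) x * W2 (\<rho> s) x) \<in> borel_measurable B"
    using assms(2) by (intro borel_measurable_times W2_section) (auto simp: space_SB)
  have "rdens {(Inl r, 0), (Inl s, 0)} \<rho> = (\<integral>\<omega>. W2 (\<rho> r) (\<omega> 0) * W2 (\<rho> s) (\<omega> 0) \<partial>SB)"
    using assms(1) by (simp add: rdens_def edge_val_def)
  also have "\<dots> = (\<integral>x. W2 (\<rho> r) x * W2 (\<rho> s) x \<partial>distr SB B (\<lambda>\<omega>. \<omega> 0))"
    by (rule integral_distr[symmetric, OF _ m]) simp
  also have "\<dots> = K (\<rho> r) (\<rho> s)"
    by (subst Sq.PiM_component) (simp_all add: K_def)
  finally show ?thesis .
qed

lemma rooted_graph_K: "rooted_graph {(Inl r, 0), (Inl s, 0)}"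
  by (simp add: rooted_graph_def)

text \<open>Roots 0 and 1 are averaged out and become free nodes 0 and 1; the other roots move down
  by two, the old free nodes up by two. Being free, the two nodes may now be joined by an edge,
  which is how the factor \<open>W2 x y\<close> enters the moments.\<close>

lemma rdens_unroot:
  assumes E: "rooted_graph E"
  shows "\<exists>F. rooted_graph F \<and> (\<forall>\<rho>\<in>space SB.
    (\<integral>x. \<integral>y. rdens E (case_nat x (case_nat y \<rho>)) * (if c then W2 x y else 1) \<partial>B \<partial>B) = rdens F \<rho>)"
proof -
  define \<tau> :: "rooted_edge \<Rightarrow> rooted_edge" where
    "\<tau> = map_prod (case_sum (case_nat (Inr 0) (case_nat (Inr 1) Inl)) (\<lambda>u. Inr (Suc (Suc u)))) (\<lambda>l. Suc (Suc l))"
  define F where "F = \<tau> ` E \<union> (if c then {(Inr 0, 1)} else {})"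
  have inj: "inj_on \<tau> E"
    unfolding inj_on_def \<tau>_def by (auto split: sum.splits nat.splits)
  have fin: "finite E" using E by (auto simp: rooted_graph_def)
  have "rooted_graph F"
    using E unfolding rooted_graph_def F_def \<tau>_def
    by (auto split: sum.splits nat.splits if_splits)
  moreover have "(\<integral>x. \<integral>y. rdens E (case_nat x (case_nat y \<rho>)) * (if c then W2 x y else 1) \<partial>B \<partial>B) = rdens F \<rho>"
    if \<rho>: "\<rho> \<in> space SB" for \<rho>
  proof -
    let ?f = "\<lambda>\<omega>. \<Prod>e\<in>F. edge_val \<rho> \<omega> e"
    have f: "?f \<in> borel_measurable SB" by (rule edge_prod_measurable'[OF \<rho>])
    have bd: "0 \<le> ?f \<omega> \<and> ?f \<omega> \<le> 1" for \<omega> by (simp add: edge_prod_bounds)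
    have ev: "edge_val \<rho> (case_nat x (case_nat y \<omega>)) (\<tau> e) = edge_val (case_nat x (case_nat y \<rho>)) \<omega> e" for x y \<omega> e
      by (cases e) (auto simp: edge_val_def \<tau>_def split: sum.splits nat.splits)
    \<comment> \<open>Every edge in the image ends at a free node with number at least 2, so the
      added edge is new.\<close>
    have notin: "(Inr 0, 1) \<notin> \<tau> ` E" by (auto simp: \<tau>_def)
    have fe: "?f (case_nat x (case_nat y \<omega>)) =
      (\<Prod>e\<in>E. edge_val (case_nat x (case_nat y \<rho>)) \<omega> e) * (if c then W2 x y else 1)" for x y \<omega>
    proof -
      have *: "(\<Prod>e\<in>\<tau> ` E. edge_val \<rho> (case_nat x (case_nat y \<omega>)) e) = (\<Prod>e\<in>E. edge_val (case_nat x (case_nat y \<rho>)) \<omega> e)"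
        by (simp add: prod.reindex[OF inj] ev)
      have **: "edge_val \<rho> (case_nat x (case_nat y \<omega>)) (Inr 0, Suc 0) = W2 x y"
        by (simp add: edge_val_def)
      show ?thesis
        using fin notin by (cases c) (simp_all add: F_def * ** mult.commute)
    qed
    have cn: "(\<lambda>\<omega>. case_nat x \<omega>) \<in> measurable SB SB" if "x \<in> space M" for x
      using that by (intro SB_measurableI) (auto split: nat.splits intro: measurable_component_singleton measurable_const)
    have "rdens F \<rho> = (\<integral>x. \<integral>\<omega>. ?f (case_nat x \<omega>) \<partial>SB \<partial>B)"
      unfolding rdens_def by (rule integral_case_nat[OF f bd])
    also have "\<dots> = (\<integral>x. \<integral>y. \<integral>\<omega>. ?f (case_nat x (case_nat y \<omega>)) \<partial>SB \<partial>B \<partial>B)"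
      by (intro Bochner_Integration.integral_cong refl integral_case_nat bd measurable_compose[OF cn f]) simp
    also have "\<dots> = (\<integral>x. \<integral>y. rdens E (case_nat x (case_nat y \<rho>)) * (if c then W2 x y else 1) \<partial>B \<partial>B)"
      unfolding fe rdens_def by simp
    finally show ?thesis ..
  qed
  ultimately show ?thesis by blast
qed

end


section \<open>Restricted densities as averages over random roots\<close>

lemma borel_measurable_monomial: "(\<lambda>x::'i \<Rightarrow> real. \<Prod>i\<leftarrow>is. x i) \<in> borel_measurable borel"
  by (induction "is") (simp_all add: borel_measurable_times[OF borel_measurable_coordinate])

context pure_graphon_space
begin

lemma ident_measurable_M_B: "(\<lambda>x. x) \<in> measurable M B"
  by (rule measurable_M_B) simp

lemma distr_ident_M_B: "distr M B (\<lambda>x. x) = B"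
proof (rule measure_eqI)
  fix A assume "A \<in> sets (distr M B (\<lambda>x. x))"
  then have A: "A \<in> sets B" by simp
  have "A \<subseteq> space M" using sets.sets_into_space[OF A] by simp
  then have "(\<lambda>x. x) -` A \<inter> space M = A" by auto
  then show "emeasure (distr M B (\<lambda>x. x)) A = emeasure B A"
    using emeasure_distr[OF ident_measurable_M_B A] emeasure_B[OF A] by simp
qed simp

text \<open>Bridges two conventions: restricted densities integrate over the unlabeled nodes with
  \<open>M\<close>, rooted densities over a whole sequence with \<open>B\<close>. For a function of
  the coordinates in \<open>I\<close> both give the same integral.\<close>

lemma integral_PiM_M_eq_SB:
  fixes f :: "(nat \<Rightarrow> 'a) \<Rightarrow> real"
  assumes f: "f \<in> borel_measurable (PiM I (\<lambda>_. B))" and restr: "\<And>\<omega>. f (\<lambda>i\<in>I. \<omega> i) = f \<omega>"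
  shows "integral\<^sup>L (PiM I (\<lambda>_. M)) f = integral\<^sup>L SB f"
proof -
  note D1 = distr_PiM_map[OF prob_space_axioms ident_measurable_M_B distr_ident_M_B subset_refl, of I]
  have B_id: "distr B B (\<lambda>x. x) = B" by (rule distr_id)
  note D2 = distr_PiM_map[OF B.prob_space_axioms measurable_ident_sets[OF refl] B_id subset_UNIV, of I]
  have "integral\<^sup>L (PiM I (\<lambda>_. M)) f = (\<integral>\<omega>. f (\<lambda>i\<in>I. \<omega> i) \<partial>PiM I (\<lambda>_. M))" by (simp add: restr)
  also have "\<dots> = integral\<^sup>L (PiM I (\<lambda>_. B)) f"
    using integral_distr[OF D1(1) f] unfolding D1(2) by (rule sym)
  also have "\<dots> = (\<integral>\<omega>. f (\<lambda>i\<in>I. \<omega> i) \<partial>SB)"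
    using integral_distr[OF D2(1) f] unfolding D2(2) .
  also have "\<dots> = integral\<^sup>L SB f" by (simp add: restr)
  finally show ?thesis .
qed

text \<open>Roots keep their numbers, and free nodes are shifted by \<open>i\<close>, beyond all
  labels and all roots in use. Drawing the unlabeled roots at random makes them ordinary nodes, so
  averaging over \<open>z\<close> leaves a graph with only the labels fixed. Every edge keeps an end
  numbered at least \<open>i\<close>, hence above \<open>k\<close>, and the labels stay
  nonadjacent.\<close>

lemma integral_rdens_eq_density:
  assumes E: "rooted_graph E"
  shows "\<exists>V F. labeled_simple_graph k V F \<and> labels_nonadjacent k F \<and>
    (\<forall>a. (\<forall>i\<in>{1..k}. a i \<in> space M) \<longrightarrow>
      restricted_hom_density M W k V F a = (\<integral>z. rdens E (override_on z a {1..k}) \<partial>SB))"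
proof -
  obtain i where i: "k < i" "\<And>n l. (n, l) \<in> E \<Longrightarrow> l < i" "\<And>r l. (Inl r, l) \<in> E \<Longrightarrow> r < i"
    "\<And>u l. (Inr u, l) \<in> E \<Longrightarrow> u < i"
    using rooted_graph_bound[OF E, of k] by metis
  define \<nu> :: "nat + nat \<Rightarrow> nat" where "\<nu> = case_sum id ((+) i)"
  define F where "F = (\<lambda>(n, l). {\<nu> n, i + l}) ` E"
  \<comment> \<open>Nodes of \<open>V\<close> without edges are harmless, as they integrate out over
    a probability measure. The bound suffices because free nodes and roots in use have numbers below
    \<open>i\<close>.\<close>
  define V where "V = {..<i + i}"
  have \<nu>: "\<nu> n < i + l" if "(n, l) \<in> E" for n l
    using that E i(3) by (cases n) (fastforce simp: \<nu>_def rooted_graph_def)+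
  have inj: "inj_on (map_prod \<nu> ((+) i)) E"
  proof (rule inj_onI)
    fix p q assume p: "p \<in> E" and q: "q \<in> E" and eq: "map_prod \<nu> ((+) i) p = map_prod \<nu> ((+) i) q"
    obtain n l n' l' where pq: "p = (n, l)" "q = (n', l')" by (cases p, cases q)
    show "p = q" using p q eq i(3)[of _ l] i(3)[of _ l'] unfolding pq
      by (cases n; cases n') (fastforce simp: \<nu>_def)+
  qed
  have ep: "edge_pairs F = map_prod \<nu> ((+) i) ` E"
  proof (intro equalityI subsetI)
    fix p assume "p \<in> edge_pairs F"
    then obtain u v where p: "p = (u, v)" "u < v" "{u, v} \<in> F" by (auto simp: edge_pairs_def)
    then obtain n l where nl: "(n, l) \<in> E" "{u, v} = {\<nu> n, i + l}" by (auto simp: F_def)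
    with \<nu>[OF nl(1)] p(2) have "u = \<nu> n" "v = i + l" by (auto simp: doubleton_eq_iff)
    then show "p \<in> map_prod \<nu> ((+) i) ` E" using nl(1) p(1) by force
  next
    fix p assume "p \<in> map_prod \<nu> ((+) i) ` E"
    then obtain n l where nl: "(n, l) \<in> E" "p = (\<nu> n, i + l)" by auto
    have "{\<nu> n, i + l} \<in> F" using nl(1) by (force simp: F_def)
    then show "p \<in> edge_pairs F" using \<nu>[OF nl(1)] nl(2) by (simp add: edge_pairs_def)
  qed
  have G: "labeled_simple_graph k V F"
    unfolding labeled_simple_graph_def
  proof (intro conjI ballI)
    show "finite V" "{1..k} \<subseteq> V" using i(1) by (auto simp: V_def)
    fix e assume "e \<in> F"
    then obtain n l where nl: "(n, l) \<in> E" "e = {\<nu> n, i + l}" by (auto simp: F_def)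
    then show "\<exists>i\<in>V. \<exists>j\<in>V. i \<noteq> j \<and> e = {i, j}"
      using \<nu>[OF nl(1)] i(2)[OF nl(1)] by (intro bexI[of _ "\<nu> n"] bexI[of _ "i + l"]) (auto simp: V_def)
  qed
  have L: "labels_nonadjacent k F"
    unfolding labels_nonadjacent_def
  proof (intro ballI notI)
    fix u v assume uv: "u \<in> {1..k}" "v \<in> {1..k}" "{u, v} \<in> F"
    then obtain n l where "{u, v} = {\<nu> n, i + l}" by (auto simp: F_def)
    then have "i + l = u \<or> i + l = v" by (auto simp: doubleton_eq_iff)
    then show False using uv i(1) by auto
  qed
  have "restricted_hom_density M W k V F a = (\<integral>z. rdens E (override_on z a {1..k}) \<partial>SB)"
    if a: "\<forall>i\<in>{1..k}. a i \<in> space M" for a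
  proof -
    let ?f = "\<lambda>y. \<Prod>e\<in>edge_pairs F. edge_factor k (override_on y a {1..k}) e"
    have ef: "edge_factor k x (\<nu> n, i + l) = W2 (x (\<nu> n)) (x (i + l))" for x n l
      using i(1) by (simp add: edge_factor_def)
    have f1: "?f \<in> borel_measurable (PiM (V - {1..k}) (\<lambda>_. B))"
      by (rule edge_factor_measurable[OF G a]) (rule measurable_component_singleton)
    have f2: "?f \<in> borel_measurable SB"
      by (rule edge_factor_measurable[OF G a]) (rule measurable_component_singleton, simp)
    have bd: "0 \<le> ?f y \<and> ?f y \<le> 1" for y
      by (auto intro!: prod_nonneg prod_le_1 simp: edge_factor_def W2_bounds)
    have restr: "?f (\<lambda>l\<in>V - {1..k}. y l) = ?f y" for y
    proof (rule prod.cong[OF refl])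
      fix e assume e: "e \<in> edge_pairs F"
      obtain u v where uv: "e = (u, v)" by (cases e)
      note D = edge_pairsD[OF G e[unfolded uv]]
      have "override_on (\<lambda>l\<in>V - {1..k}. y l) a {1..k} l = override_on y a {1..k} l" if "l \<in> V" for l
        using that by (simp add: override_on_def del: atLeastAtMost_iff)
      note * = this[OF D(1)] this[OF D(2)]
      show "edge_factor k (override_on (\<lambda>l\<in>V - {1..k}. y l) a {1..k}) e = edge_factor k (override_on y a {1..k}) e"
        unfolding edge_factor_def uv prod.case * ..
    qed
    have comb: "?f (comb_seq i z \<omega>) = (\<Prod>e\<in>E. edge_val (override_on z a {1..k}) \<omega> e)" for z \<omega>
      unfolding ep prod.reindex[OF inj] comp_def
    proof (rule prod.cong[OF refl])
      fix e assume e: "e \<in> E"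
      obtain n l where nl: "e = (n, l)" by (cases e)
      have 1: "override_on (comb_seq i z \<omega>) a {1..k} (i + l) = \<omega> l" for l
        using i(1) comb_seq_add[of i z \<omega> l] by (simp add: override_on_def add.commute)
      have 2: "override_on (comb_seq i z \<omega>) a {1..k} (\<nu> n) = case_sum (override_on z a {1..k}) \<omega> n"
        using e i(3)[of _ l] 1 by (cases n) (auto simp: \<nu>_def nl override_on_def comb_seq_less)
      show "edge_factor k (override_on (comb_seq i z \<omega>) a {1..k}) (map_prod \<nu> ((+) i) e) =
        edge_val (override_on z a {1..k}) \<omega> e"
        by (simp only: nl map_prod_simp edge_val_def ef 1 2 fst_conv snd_conv)
    qed
    have "restricted_hom_density M W k V F a = integral\<^sup>L SB ?f"
      unfolding restricted_hom_density_eq[OF G L a]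
      by (rule integral_PiM_M_eq_SB[where f="?f", OF f1]) (rule restr)
    also have "\<dots> = (\<integral>z. \<integral>\<omega>. ?f (comb_seq i z \<omega>) \<partial>SB \<partial>SB)"
      by (rule integral_comb_seq[where f="?f", OF f2]) (rule bd)
    also have "\<dots> = (\<integral>z. rdens E (override_on z a {1..k}) \<partial>SB)"
      unfolding comb rdens_def ..
    finally show ?thesis .
  qed
  with G L show ?thesis by blast
qed

lemma override_on_measurable:
  assumes "f \<in> measurable N SB" "\<forall>i\<in>{1..k}. a i \<in> space M"
  shows "(\<lambda>x. override_on (f x) a {1..k}) \<in> measurable N SB"
proof (rule SB_measurableI)
  fix i show "(\<lambda>x. override_on (f x) a {1..k} i) \<in> measurable N B"
    using assms(2) SB_measurableD[OF assms(1)]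
    by (cases "i \<in> {1..k}") (simp_all add: override_on_def del: atLeastAtMost_iff)
qed

text \<open>The probability that \<open>m\<close> independent entries all miss \<open>U\<close> is
  \<open>q ^ m\<close>, which tends to 0. Only positions beyond \<open>k\<close> count, since the
  positions 1 to \<open>k\<close> are to be overwritten by labels.\<close>

lemma AE_visits:
  assumes U: "U \<in> sets B" "measure B U > 0"
  shows "AE z in SB. \<exists>p>k. z p \<in> U"
proof -
  have cU: "space M - U \<in> sets B" using sets.compl_sets[OF U(1)] by simp
  define q where "q = measure B (space M - U)"
  have q: "0 \<le> q" "q < 1" using U B.prob_compl[OF U(1)] by (simp_all add: q_def)
  have coll: "{z \<in> space SB. z p \<in> A} \<in> sets SB" if "A \<in> sets B" for p A
  proof -
    have "{z \<in> space SB. z p \<in> A} = (\<lambda>z. z p) -` A \<inter> space SB" by auto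
    also have "\<dots> \<in> sets SB" by (rule measurable_sets[OF SB_measurableD[OF measurable_ident_sets[OF refl]] that])
    finally show ?thesis .
  qed
  let ?N = "{z \<in> space SB. \<forall>p>k. z p \<in> space M - U}"
  have N: "?N \<in> sets SB"
  proof -
    have "?N = (\<Inter>p\<in>{k<..}. {z \<in> space SB. z p \<in> space M - U})" by auto
    also have "\<dots> \<in> sets SB"
      by (intro sets.countable_INT' image_subsetI coll cU) auto
    finally show ?thesis .
  qed
  have le: "measure SB ?N \<le> q ^ m" for m
  proof -
    let ?Nm = "{z \<in> space SB. \<forall>p\<in>{k<..k + m}. z p \<in> space M - U}"
    have em: "emeasure SB ?Nm = (\<Prod>p\<in>{k<..k + m}. emeasure B (space M - U))"
      by (rule Sq.emeasure_PiM_Collect) (use cU in auto)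
    have Nm: "?Nm \<in> sets SB"
      by (intro sets.sets_Collect_finite_All coll cU) simp
    have "ennreal (measure SB ?Nm) = ennreal (q ^ m)"
      using em by (simp add: B.emeasure_eq_measure Sq.P.emeasure_eq_measure q_def ennreal_power)
    then have "measure SB ?Nm = q ^ m" using q by (simp add: measure_nonneg)
    moreover have "measure SB ?N \<le> measure SB ?Nm"
      by (rule Sq.P.finite_measure_mono[OF _ Nm]) auto
    ultimately show ?thesis by simp
  qed
  have "(\<lambda>m. q ^ m) \<longlonglongrightarrow> 0" using q by (intro LIMSEQ_realpow_zero) auto
  then have "measure SB ?N \<le> 0" using le by (intro LIMSEQ_le_const) auto
  then have "emeasure SB ?N = 0"
    unfolding Sq.P.emeasure_eq_measure by (simp only: measure_le_0_iff ennreal_0)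
  from AE_not_in[OF null_setsI[OF this N]] AE_space[of SB] show ?thesis
  proof eventually_elim
    case (elim z)
    then have "\<And>p. z p \<in> space M" by (simp add: space_SB)
    then show ?case using elim by blast
  qed
qed

text \<open>The rooted densities at \<open>(a, z)\<close>, for a random sequence \<open>z\<close>, have as mixed moments the
  restricted homomorphism densities at \<open>a\<close>, so their joint law at \<open>a\<close> is that at \<open>b\<close>.\<close>

lemma ex_dense_sequences_same_densities:
  assumes a: "\<forall>i\<in>{1..k}. a i \<in> space M" and b: "\<forall>i\<in>{1..k}. b i \<in> space M"
    and eq: "\<And>V E. labeled_simple_graph k V E \<Longrightarrow> labels_nonadjacent k E \<Longrightarrow>
       restricted_hom_density M W k V E a = restricted_hom_density M W k V E b"
  shows "\<exists>z z'. z \<in> space SB \<and> z' \<in> space SB \<and>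
    (\<forall>x\<in>space M. \<forall>e>0. \<exists>p>k. rdist x (z p) < e) \<and> (\<forall>x\<in>space M. \<forall>e>0. \<exists>p>k. rdist x (z' p) < e) \<and>
    (\<forall>E. rooted_graph E \<longrightarrow> rdens E (override_on z a {1..k}) = rdens E (override_on z' b {1..k}))"
proof -
  obtain \<mu> :: "(nat \<Rightarrow> real) measure" and h :: "(nat \<Rightarrow> real) \<Rightarrow> 'a"
  where \<mu>: "prob_space \<mu>" and sets\<mu>: "sets \<mu> = sets borel" and h: "h \<in> measurable \<mu> B" and dist: "distr \<mu> B h = B"
    using parametrization by metis
  \<comment> \<open>The random sequence is drawn from a product of Borel measures on
    \<open>nat \<Rightarrow> real\<close>, because \<open>equal_laws_common_value\<close> requires a
    Polish space; \<open>H\<close> then transports it to points of the graphon.\<close>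
  define P where "P = PiM (UNIV :: nat set) (\<lambda>_. \<mu>)"
  interpret P: prob_space P unfolding P_def by (rule prob_space_PiM) (rule \<mu>)
  have setsP: "sets P = sets borel"
    unfolding P_def using sets_PiM_cong[OF refl sets\<mu>] sets_PiM_equal_borel by (rule trans)
  have spP: "space P = UNIV" using sets_eq_imp_space_eq[OF setsP] by simp
  define H where "H = (\<lambda>\<zeta>::nat \<Rightarrow> nat \<Rightarrow> real. \<lambda>i::nat. h (\<zeta> i))"
  have Hm: "H \<in> measurable P SB" and Hd: "distr P SB H = SB"
    using distr_PiM_map[OF \<mu> h dist subset_refl, of "UNIV :: nat set"]
    by (simp_all add: H_def P_def restrict_UNIV)
  \<comment> \<open>Lists of edges stand for edge sets in order to have a countable index type for
    \<open>measure_eqI_moments\<close>. Lists that are no rooted graph contribute the constant 0, so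
    any moment using one vanishes for \<open>a\<close> and \<open>b\<close> alike.\<close>
  define arr where "arr c \<zeta> L = (if rooted_graph (set L) then rdens (set L) (override_on (H \<zeta>) c {1..k}) else 0)"
    for c \<zeta> and L :: "rooted_edge list"
  have arrP: "(\<lambda>\<zeta>. arr c \<zeta> L) \<in> borel_measurable P" if c: "\<forall>i\<in>{1..k}. c i \<in> space M" for c L
    unfolding arr_def
    by (cases "rooted_graph (set L)") (simp_all only: if_True if_False measurable_const UNIV_I space_borel
      rdens_measurable[OF override_on_measurable[OF Hm c]])
  have arrB: "arr c \<in> borel_measurable P" if c: "\<forall>i\<in>{1..k}. c i \<in> space M" for c
    by (rule measurable_coordinatewise_then_product) (rule arrP[OF c])
  have Hs: "H \<zeta> \<in> space SB" for \<zeta> using measurable_space[OF Hm] spP by auto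
  have os: "override_on z c {1..k} \<in> space SB" if "z \<in> space SB" "\<forall>i\<in>{1..k}. c i \<in> space M" for z c
    using that by (auto simp: space_SB override_on_def)
  have arr01: "0 \<le> arr c \<zeta> L \<and> arr c \<zeta> L \<le> 1" if c: "\<forall>i\<in>{1..k}. c i \<in> space M" for c \<zeta> L
    unfolding arr_def using rdens_bounds[OF os[OF Hs c]] by simp
  have supp: "AE x in distr P borel (arr c). \<forall>i. 0 \<le> x i \<and> x i \<le> 1" if c: "\<forall>i\<in>{1..k}. c i \<in> space M" for c
  proof -
    have [measurable]: "(\<lambda>x::rooted_edge list \<Rightarrow> real. x i) \<in> borel_measurable borel" for i
      by (rule borel_measurable_coordinate)
    have "{x :: rooted_edge list \<Rightarrow> real \<in> space borel. \<forall>i. 0 \<le> x i \<and> x i \<le> 1} \<in> sets borel"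
      by measurable
    from AE_distr_iff[OF arrB[OF c] this] show ?thesis using arr01[OF c] by simp
  qed
  have moments: "(\<integral>x. (\<Prod>i\<leftarrow>Ls. x i) \<partial>distr P borel (arr c)) = (\<integral>\<zeta>. (\<Prod>i\<leftarrow>Ls. arr c \<zeta> i) \<partial>P)"
    if c: "\<forall>i\<in>{1..k}. c i \<in> space M" for c Ls
    by (rule integral_distr[OF arrB[OF c] borel_measurable_monomial])
  have meq: "(\<integral>\<zeta>. (\<Prod>i\<leftarrow>Ls. arr a \<zeta> i) \<partial>P) = (\<integral>\<zeta>. (\<Prod>i\<leftarrow>Ls. arr b \<zeta> i) \<partial>P)" for Ls
  proof (cases "\<forall>L\<in>set Ls. rooted_graph (set L)")
    case True
    have "\<exists>F. rooted_graph F \<and> (\<forall>\<rho>\<in>space SB. (\<Prod>L\<leftarrow>Ls. rdens (set L) \<rho>) = rdens F \<rho>)"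
      by (rule rdens_prod_list) (use True in blast)
    then obtain F where F: "rooted_graph F" "\<And>\<rho>. \<rho> \<in> space SB \<Longrightarrow> (\<Prod>L\<leftarrow>Ls. rdens (set L) \<rho>) = rdens F \<rho>" by blast
    obtain V E where G: "labeled_simple_graph k V E" "labels_nonadjacent k E"
      and dens: "\<forall>c. (\<forall>i\<in>{1..k}. c i \<in> space M) \<longrightarrow>
        restricted_hom_density M W k V E c = (\<integral>z. rdens F (override_on z c {1..k}) \<partial>SB)"
      using integral_rdens_eq_density[OF F(1)] by metis
    have "(\<integral>\<zeta>. (\<Prod>i\<leftarrow>Ls. arr c \<zeta> i) \<partial>P) = restricted_hom_density M W k V E c"
      if c: "\<forall>i\<in>{1..k}. c i \<in> space M" for c
    proof -
      have "(\<Prod>i\<leftarrow>Ls. arr c \<zeta> i) = rdens F (override_on (H \<zeta>) c {1..k})" for \<zeta>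
      proof -
        have "map (arr c \<zeta>) Ls = map (\<lambda>L. rdens (set L) (override_on (H \<zeta>) c {1..k})) Ls"
          using True by (simp add: arr_def)
        then have "(\<Prod>i\<leftarrow>Ls. arr c \<zeta> i) = (\<Prod>L\<leftarrow>Ls. rdens (set L) (override_on (H \<zeta>) c {1..k}))"
          by (rule arg_cong[where f=prod_list])
        also have "\<dots> = rdens F (override_on (H \<zeta>) c {1..k})" by (rule F(2)[OF os[OF Hs c]])
        finally show ?thesis .
      qed
      then have "(\<integral>\<zeta>. (\<Prod>i\<leftarrow>Ls. arr c \<zeta> i) \<partial>P) = (\<integral>\<zeta>. rdens F (override_on (H \<zeta>) c {1..k}) \<partial>P)"
        by simp
      also have "\<dots> = (\<integral>z. rdens F (override_on z c {1..k}) \<partial>distr P SB H)"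
        by (rule integral_distr[symmetric, OF Hm])
          (rule rdens_measurable[OF override_on_measurable[OF measurable_ident_sets[OF refl] c]])
      also have "\<dots> = restricted_hom_density M W k V E c" unfolding Hd using dens c by simp
      finally show ?thesis .
    qed
    from this[OF a] this[OF b] eq[OF G] show ?thesis by simp
  next
    case False
    then obtain L where L: "L \<in> set Ls" "\<not> rooted_graph (set L)" by blast
    have "0 \<in> set (map (arr c \<zeta>) Ls)" for c \<zeta>
    proof -
      have "arr c \<zeta> L = 0" using L(2) by (simp add: arr_def)
      then show ?thesis using L(1) by force
    qed
    then have "(\<Prod>i\<leftarrow>Ls. arr c \<zeta> i) = 0" for c \<zeta> by (simp only: prod_list_zero_iff)
    then show ?thesis by simp
  qed
  have fin: "finite_measure (distr P borel (arr c))" if c: "\<forall>i\<in>{1..k}. c i \<in> space M" for c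
    by (rule P.finite_measure_distr[OF arrB[OF c]])
  have law: "distr P borel (arr a) = distr P borel (arr b)"
    using fin[OF a] fin[OF b] _ _ supp[OF a] supp[OF b]
    by (rule measure_eqI_moments) (simp_all only: sets_distr moments[OF a] moments[OF b] meq)
  \<comment> \<open>The event that the sequence is dense already beyond position \<open>k\<close>.
    It is measurable because countably many balls suffice, and has full measure by
    \<open>AE_visits\<close>.\<close>
  define D where "D = {\<zeta> \<in> space P. \<forall>n j. \<exists>p>k. H \<zeta> p \<in> J.mball (dseq n) (1 / real (Suc j))}"
  have Dm: "D \<in> sets P"
  proof -
    have "{\<zeta> \<in> space P. H \<zeta> p \<in> J.mball x e} \<in> sets P" for p x e
      using measurable_sets[OF SB_measurableD[OF Hm] ball_sets_B, of p x e]
      by (simp add: vimage_def Int_def conj_commute)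
    then show ?thesis unfolding D_def
      by (intro sets.sets_Collect_countable_All sets.sets_Collect_countable_Ex sets.sets_Collect_conj sets.sets_Collect_const)
  qed
  have D1: "measure P D = 1"
  proof -
    have "AE z in SB. \<forall>n j. \<exists>p>k. z p \<in> J.mball (dseq n) (1 / real (Suc j))"
      unfolding AE_all_countable by (intro allI AE_visits ball_sets_B ball_positive) auto
    then have "AE \<zeta> in P. \<forall>n j. \<exists>p>k. H \<zeta> p \<in> J.mball (dseq n) (1 / real (Suc j))"
      using AE_distrD[OF Hm, unfolded Hd] by blast
    then have "AE \<zeta> in P. \<zeta> \<in> D" using AE_space by eventually_elim (simp add: D_def)
    then show ?thesis using P.prob_eq_1[OF Dm] by simp
  qed
  have "\<exists>\<zeta>\<in>D. \<exists>\<zeta>'\<in>D. arr a \<zeta> = arr b \<zeta>'"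
    using P.prob_space_axioms setsP _ _ _ D1 law
    by (rule equal_laws_common_value)
      (use arrB[OF a] arrB[OF b] Dm setsP measurable_cong_sets[OF setsP refl] in auto)
  then obtain \<zeta> \<zeta>' where \<zeta>: "\<zeta> \<in> D" "\<zeta>' \<in> D" "arr a \<zeta> = arr b \<zeta>'" by blast
  have dense: "\<exists>p>k. rdist x (H \<zeta> p) < e" if \<zeta>: "\<zeta> \<in> D" and x: "x \<in> space M" and e: "e > 0" for \<zeta> x e
  proof -
    obtain j where j: "1 / real (Suc j) < e / 2" using e by (meson half_gt_zero nat_approx_posE)
    obtain n where n: "rdist x (dseq n) < 1 / real (Suc j)" using dseq_dense[OF x, of "1 / real (Suc j)"] by auto
    obtain p where p: "p > k" "H \<zeta> p \<in> J.mball (dseq n) (1 / real (Suc j))" using \<zeta> unfolding D_def by blast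
    then have "rdist x (H \<zeta> p) < e"
      using J.triangle[OF x dseq_space, of "H \<zeta> p" n] n j by auto
    with p show ?thesis by blast
  qed
  have "rdens E (override_on (H \<zeta>) a {1..k}) = rdens E (override_on (H \<zeta>') b {1..k})" if E: "rooted_graph E" for E
  proof -
    obtain L where L: "set L = E" using finite_list[of E] E unfolding rooted_graph_def by blast
    show ?thesis using fun_cong[OF \<zeta>(3), of L] E by (simp add: arr_def L)
  qed
  then show ?thesis
    using Hs[of \<zeta>] Hs[of \<zeta>'] dense[OF \<zeta>(1)] dense[OF \<zeta>(2)]
    by (intro exI[of _ "H \<zeta>"] exI[of _ "H \<zeta>'"]) simp
qed

end


section \<open>Reconstruction of the automorphism\<close>

lemma prod_list_bounds:
  fixes f :: "'b \<Rightarrow> real"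
  shows "(\<And>x. x \<in> set xs \<Longrightarrow> 0 \<le> f x \<and> f x \<le> 1) \<Longrightarrow> 0 \<le> (\<Prod>x\<leftarrow>xs. f x) \<and> (\<Prod>x\<leftarrow>xs. f x) \<le> 1"
  by (induction xs) (auto intro: mult_le_one)

context pure_graphon_space
begin

definition dense_seq :: "(nat \<Rightarrow> 'a) \<Rightarrow> bool" where
  "dense_seq u \<longleftrightarrow> (\<forall>n. u n \<in> space M) \<and> (\<forall>x\<in>space M. \<forall>e>0. \<exists>n. rdist x (u n) < e)"

lemma dense_seq_space: "dense_seq u \<Longrightarrow> u n \<in> space M"
  by (simp add: dense_seq_def)

text \<open>\<open>K\<close> is 1-Lipschitz in its second argument as well, so its values along a
  dense sequence control those at all points.\<close>

lemma K_sup_le: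
  assumes u: "dense_seq u" and xyz: "x \<in> space M" "y \<in> space M" "z \<in> space M"
    and e: "\<And>n. \<bar>K x (u n) - K y (u n)\<bar> \<le> e"
  shows "\<bar>K x z - K y z\<bar> \<le> e"
proof (rule field_le_epsilon)
  fix d :: real assume "d > 0"
  then obtain n where n: "rdist z (u n) < d / 2" using u xyz(3) unfolding dense_seq_def by (meson half_gt_zero)
  note un = dense_seq_space[OF u, of n]
  have "\<bar>K x z - K x (u n)\<bar> \<le> rdist z (u n)" "\<bar>K y z - K y (u n)\<bar> \<le> rdist z (u n)"
    using K_diff_le[OF xyz(3) un xyz(1)] K_diff_le[OF xyz(3) un xyz(2)] by (simp_all add: K_commute)
  then show "\<bar>K x z - K y z\<bar> \<le> e + d" using n e[of n] by linarith
qed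

lemma rdist_squared_le_sup:
  assumes u: "dense_seq u" and xy: "x \<in> space M" "y \<in> space M"
    and e: "\<And>n. \<bar>K x (u n) - K y (u n)\<bar> \<le> e"
  shows "(rdist x y)\<^sup>2 \<le> 2 * e"
  using rdist_squared_le[OF xy] K_sup_le[OF u xy xy(1) e] K_sup_le[OF u xy xy(2) e] by linarith

definition Phi :: "(nat \<Rightarrow> 'a) \<Rightarrow> 'a \<Rightarrow> nat \<Rightarrow> real" where
  "Phi u x = (\<lambda>n. K x (u n))"

lemma Phi_inj:
  assumes u: "dense_seq u" and xy: "x \<in> space M" "y \<in> space M" and eq: "Phi u x = Phi u y"
  shows "x = y"
proof -
  have "\<bar>K x (u n) - K y (u n)\<bar> \<le> 0" for n using fun_cong[OF eq, of n] by (simp add: Phi_def)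
  from rdist_squared_le_sup[OF u xy this] show ?thesis using xy by simp
qed

lemma Phi_measurable:
  assumes u: "\<And>n. u n \<in> space M" shows "Phi u \<in> borel_measurable B"
proof (rule measurable_coordinatewise_then_product)
  fix n
  have "(\<lambda>x. u n) \<in> measurable B B" by (rule measurable_const) (simp add: u)
  from K_measurable[OF measurable_ident_sets[OF refl] this]
  show "(\<lambda>x. Phi u x n) \<in> borel_measurable B" by (simp add: Phi_def)
qed

lemma closed_sup_ball_borel: "{v :: nat \<Rightarrow> real. \<forall>n. \<bar>v n - w n\<bar> \<le> e} \<in> sets borel"
proof -
  have [measurable]: "(\<lambda>x::nat \<Rightarrow> real. x i) \<in> borel_measurable borel" for i
    by (rule borel_measurable_coordinate)
  have "{v :: nat \<Rightarrow> real \<in> space borel. \<forall>n. \<bar>v n - w n\<bar> \<le> e} \<in> sets borel" by measurable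
  then show ?thesis by simp
qed

text \<open>By \<open>rdist_squared_le_sup\<close>, every neighborhood of a point contains the
  preimage of some closed sup-norm ball around the image of a dense point, with the given point in
  it. Such a ball is a countable intersection of coordinate conditions, hence Borel for the product
  topology, in which it need not be a neighborhood.\<close>

lemma sets_B_Phi:
  assumes u: "dense_seq u" and A: "A \<in> sets B"
  shows "\<exists>C\<in>sets borel. A = Phi u -` C \<inter> space M"
  using A unfolding sets_B
proof induction
  case (Basic U)
  then have U: "openin J.mtopology U" by simp
  have US: "U \<subseteq> space M" using openin_subset[OF U] by simp
  define C where "C n j = {v :: nat \<Rightarrow> real. \<forall>i. \<bar>v i - K (u n) (u i)\<bar> \<le> 1 / real (Suc j)}" for n j
  define T where "T = {(n, j). Phi u -` C n j \<inter> space M \<subseteq> U}"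
  have "(\<Union>(n, j)\<in>T. C n j) \<in> sets borel"
    by (intro sets.countable_UN') (auto simp: C_def closed_sup_ball_borel)
  moreover have "U = Phi u -` (\<Union>(n, j)\<in>T. C n j) \<inter> space M"
  proof (intro equalityI subsetI)
    fix x assume x: "x \<in> U"
    then have xM: "x \<in> space M" using US by auto
    obtain e where e: "e > 0" "J.mball x e \<subseteq> U" using x U unfolding J.openin_mtopology by blast
    \<comment> \<open>Rows of \<open>K\<close> within \<open>2 / real (Suc j)\<close> of each other
      have squared distance at most twice that, by \<open>rdist_squared_le_sup\<close>; hence the
      4.\<close>
    obtain j where j: "1 / real (Suc j) < e\<^sup>2 / 4" using e(1) by (metis nat_approx_posE zero_less_divide_iff zero_less_numeral zero_less_power)
    obtain n where n: "rdist x (u n) < 1 / real (Suc j)"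
      using u xM unfolding dense_seq_def by (metis of_nat_0_less_iff zero_less_Suc zero_less_divide_1_iff)
    note un = dense_seq_space[OF u]
    have Kn: "\<bar>K x (u i) - K (u n) (u i)\<bar> \<le> 1 / real (Suc j)" for i
      using K_diff_le[OF xM un[of n] un[of i]] n by simp
    have "Phi u -` C n j \<inter> space M \<subseteq> U"
    proof
      fix y assume "y \<in> Phi u -` C n j \<inter> space M"
      then have y: "y \<in> space M" "\<And>i. \<bar>K y (u i) - K (u n) (u i)\<bar> \<le> 1 / real (Suc j)"
        by (auto simp: C_def Phi_def)
      have "\<bar>K x (u i) - K y (u i)\<bar> \<le> 2 / real (Suc j)" for i
      proof -
        have "2 / real (Suc j) = 1 / real (Suc j) + 1 / real (Suc j)" by simp
        then show ?thesis using Kn[of i] y(2)[of i] by linarith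
      qed
      from rdist_squared_le_sup[OF u xM y(1) this] have "(rdist x y)\<^sup>2 < e\<^sup>2" using j by simp
      then have "rdist x y < e" using e(1) by (simp add: power2_less_imp_less)
      then show "y \<in> U" using e(2) xM y(1) by auto
    qed
    then have "(n, j) \<in> T" by (simp add: T_def)
    moreover have "Phi u x \<in> C n j" using Kn by (simp add: C_def Phi_def)
    ultimately show "x \<in> Phi u -` (\<Union>(n, j)\<in>T. C n j) \<inter> space M" using xM by auto
  qed (auto simp: T_def)
  ultimately show ?case by (rule bexI[rotated])
next
  case Empty
  show ?case by (rule bexI[of _ "{}"]) auto
next
  case (Compl A)
  then obtain C where C: "C \<in> sets borel" "A = Phi u -` C \<inter> space M" by blast
  show ?case by (rule bexI[of _ "- C"]) (use C in auto)
next
  case (Union A)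
  then have "\<forall>i. \<exists>C. C \<in> sets borel \<and> A i = Phi u -` C \<inter> space M" by blast
  then obtain C where C: "\<And>i. C i \<in> sets borel" "\<And>i. A i = Phi u -` C i \<inter> space M" by metis
  show ?case by (rule bexI[of _ "\<Union>i. C i"]) (use C in auto)
qed

section \<open>Laws of pairs of points in the coordinates \<open>Phi\<close>\<close>

definition PhiPair :: "(nat \<Rightarrow> 'a) \<Rightarrow> 'a \<times> 'a \<Rightarrow> bool \<times> nat \<Rightarrow> real" where
  "PhiPair u p = (\<lambda>(t, n). K (if t then fst p else snd p) (u n))"

definition weight :: "bool \<Rightarrow> 'a \<times> 'a \<Rightarrow> real" where
  "weight c p = (if c then W2 (fst p) (snd p) else 1)"

text \<open>For \<open>c\<close> false this is the joint law of the coordinates of two independent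
  points, with marginal the law of \<open>Phi u\<close>. For \<open>c\<close> true the pairs are
  weighted by the edge \<open>W2\<close>, so that comparing these laws for two sequences captures
  \<open>W\<close> and not only the measure. The coordinates of both points share one countable
  index type, as \<open>measure_eqI_moments\<close> requires.\<close>

definition pair_law :: "bool \<Rightarrow> (nat \<Rightarrow> 'a) \<Rightarrow> (bool \<times> nat \<Rightarrow> real) measure" where
  "pair_law c u = distr (density (B \<Otimes>\<^sub>M B) (weight c)) borel (PhiPair u)"

sublocale BB: pair_prob_space B B ..

lemma weight_measurable: "weight c \<in> borel_measurable (B \<Otimes>\<^sub>M B)"
proof (cases c)
  case True
  show ?thesis using W2_measurable[OF measurable_fst measurable_snd] True by (simp add: weight_def[abs_def])
next
  case False
  then show ?thesis by (simp add: weight_def[abs_def])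
qed

lemma weight_bounds: "0 \<le> weight c p" "weight c p \<le> 1"
  by (simp_all add: weight_def W2_bounds)

lemma PhiPair_measurable:
  assumes u: "\<And>n. u n \<in> space M" shows "PhiPair u \<in> borel_measurable (B \<Otimes>\<^sub>M B)"
proof (rule measurable_coordinatewise_then_product)
  fix i :: "bool \<times> nat"
  obtain t n where i: "i = (t, n)" by (cases i)
  have "(\<lambda>p::'a \<times> 'a. u n) \<in> measurable (B \<Otimes>\<^sub>M B) B" by (rule measurable_const) (simp add: u)
  from K_measurable[OF measurable_fst this] K_measurable[OF measurable_snd this]
  show "(\<lambda>p. PhiPair u p i) \<in> borel_measurable (B \<Otimes>\<^sub>M B)" by (cases t) (simp_all add: PhiPair_def i)
qed

lemma PhiPair_bounds:
  assumes u: "\<And>n. u n \<in> space M" and p: "p \<in> space (B \<Otimes>\<^sub>M B)"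
  shows "0 \<le> PhiPair u p i \<and> PhiPair u p i \<le> 1"
proof -
  obtain t n where i: "i = (t, n)" by (cases i)
  have "fst p \<in> space M" "snd p \<in> space M" using p by (auto simp: space_pair_measure)
  then show ?thesis using K_bounds[OF _ u] by (cases t) (simp_all add: PhiPair_def i)
qed

lemma pair_law_moment:
  assumes u: "\<And>n. u n \<in> space M"
  shows "(\<integral>v. (\<Prod>i\<leftarrow>js. v i) \<partial>pair_law c u) =
    (\<integral>x. \<integral>y. (\<Prod>i\<leftarrow>js. PhiPair u (x, y) i) * weight c (x, y) \<partial>B \<partial>B)"
proof -
  have m: "(\<lambda>p. \<Prod>i\<leftarrow>js. PhiPair u p i) \<in> borel_measurable (B \<Otimes>\<^sub>M B)"
    by (rule measurable_compose[OF PhiPair_measurable[of u, OF u] borel_measurable_monomial])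
  have bd: "\<bar>(\<Prod>i\<leftarrow>js. PhiPair u p i) * weight c p\<bar> \<le> 1" if "p \<in> space (B \<Otimes>\<^sub>M B)" for p
  proof -
    have "0 \<le> (\<Prod>i\<leftarrow>js. PhiPair u p i) \<and> (\<Prod>i\<leftarrow>js. PhiPair u p i) \<le> 1"
      by (rule prod_list_bounds) (rule PhiPair_bounds[of u, OF u that])
    then show ?thesis using weight_bounds[of c p] by (auto simp: abs_mult intro: mult_le_one)
  qed
  have int: "integrable (B \<Otimes>\<^sub>M B) (\<lambda>p. (\<Prod>i\<leftarrow>js. PhiPair u p i) * weight c p)"
    by (rule BB.P.integrable_const_bound[where B=1, OF AE_I2 borel_measurable_times[OF m weight_measurable]])
      (use bd in simp)
  have "(\<integral>v. (\<Prod>i\<leftarrow>js. v i) \<partial>pair_law c u) = (\<integral>p. (\<Prod>i\<leftarrow>js. PhiPair u p i) \<partial>density (B \<Otimes>\<^sub>M B) (weight c))"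
    unfolding pair_law_def
    by (rule integral_distr) (use PhiPair_measurable[of u, OF u] borel_measurable_monomial in auto)
  also have "\<dots> = (\<integral>p. weight c p *\<^sub>R (\<Prod>i\<leftarrow>js. PhiPair u p i) \<partial>(B \<Otimes>\<^sub>M B))"
    by (rule integral_density[OF m weight_measurable]) (simp add: weight_bounds)
  also have "\<dots> = (\<integral>p. (\<Prod>i\<leftarrow>js. PhiPair u p i) * weight c p \<partial>(B \<Otimes>\<^sub>M B))"
    by (simp add: mult.commute)
  also have "\<dots> = (\<integral>x. \<integral>y. (\<Prod>i\<leftarrow>js. PhiPair u (x, y) i) * weight c (x, y) \<partial>B \<partial>B)"
    by (rule BB.integral_fst'[OF int, symmetric])
  finally show ?thesis .
qed

text \<open>The two points of the pair become roots 0 and 1 in front of the sequence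
  \<open>\<rho>\<close>, whose indices rise by two. Each coordinate is then the density of a path
  between two roots, and \<open>rdens_unroot\<close> averages over the pair. As \<open>F\<close>
  does not depend on \<open>\<rho>\<close>, equal rooted densities force equal moments.\<close>

lemma pair_law_moment_rooted:
  "\<exists>F. rooted_graph F \<and> (\<forall>\<rho>\<in>space SB.
    (\<integral>v. (\<Prod>i\<leftarrow>js. v i) \<partial>pair_law c (\<lambda>n. \<rho> (Suc (n + k)))) = rdens F \<rho>)"
proof -
  let ?f = "\<lambda>(t, n) \<rho>. K (\<rho> (if t then 0 else Suc 0)) (\<rho> (Suc (Suc (Suc (n + k)))))"
  have "\<exists>E. rooted_graph E \<and> (\<forall>\<rho>\<in>space SB. (\<Prod>i\<leftarrow>js. ?f i \<rho>) = rdens E \<rho>)"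
  proof (rule rdens_prod_list)
    fix i :: "bool \<times> nat"
    obtain t n where i: "i = (t, n)" by (cases i)
    let ?E = "{(Inl (if t then 0 else Suc 0), 0), (Inl (Suc (Suc (Suc (n + k)))), 0)}"
    have "?f i \<rho> = rdens ?E \<rho>" if "\<rho> \<in> space SB" for \<rho>
      unfolding i prod.case by (rule rdens_K[OF _ that, symmetric]) simp
    then show "\<exists>E. rooted_graph E \<and> (\<forall>\<rho>\<in>space SB. ?f i \<rho> = rdens E \<rho>)"
      using rooted_graph_K by (intro exI[of _ ?E]) blast
  qed
  then obtain E where E: "rooted_graph E" "\<And>\<rho>. \<rho> \<in> space SB \<Longrightarrow> (\<Prod>i\<leftarrow>js. ?f i \<rho>) = rdens E \<rho>" by blast
  obtain F where F: "rooted_graph F" "\<And>\<rho>. \<rho> \<in> space SB \<Longrightarrow>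
    (\<integral>x. \<integral>y. rdens E (case_nat x (case_nat y \<rho>)) * (if c then W2 x y else 1) \<partial>B \<partial>B) = rdens F \<rho>"
    using rdens_unroot[OF E(1), of c] by blast
  have "(\<integral>v. (\<Prod>i\<leftarrow>js. v i) \<partial>pair_law c (\<lambda>n. \<rho> (Suc (n + k)))) = rdens F \<rho>" if \<rho>: "\<rho> \<in> space SB" for \<rho>
  proof -
    have u: "\<And>n. \<rho> (Suc (n + k)) \<in> space M" using \<rho> by (simp add: space_SB)
    have "(\<Prod>i\<leftarrow>js. PhiPair (\<lambda>n. \<rho> (Suc (n + k))) (x, y) i) * weight c (x, y) =
      rdens E (case_nat x (case_nat y \<rho>)) * (if c then W2 x y else 1)" if "x \<in> space B" "y \<in> space B" for x y
    proof -
      have s: "case_nat x (case_nat y \<rho>) \<in> space SB" using \<rho> that by (auto simp: space_SB split: nat.splits)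
      have "PhiPair (\<lambda>n. \<rho> (Suc (n + k))) (x, y) = (\<lambda>i. ?f i (case_nat x (case_nat y \<rho>)))"
        by (auto simp: PhiPair_def fun_eq_iff)
      then show ?thesis using E(2)[OF s] by (simp add: weight_def)
    qed
    then have "(\<integral>x. \<integral>y. (\<Prod>i\<leftarrow>js. PhiPair (\<lambda>n. \<rho> (Suc (n + k))) (x, y) i) * weight c (x, y) \<partial>B \<partial>B) =
      (\<integral>x. \<integral>y. rdens E (case_nat x (case_nat y \<rho>)) * (if c then W2 x y else 1) \<partial>B \<partial>B)"
      by (intro Bochner_Integration.integral_cong refl)
    then show ?thesis using pair_law_moment[OF u] F(2)[OF \<rho>] by simp
  qed
  with F(1) show ?thesis by blast
qed

lemma finite_measure_pair_law:
  assumes u: "\<And>n. u n \<in> space M" shows "finite_measure (pair_law c u)"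
proof -
  have "finite_measure (density (B \<Otimes>\<^sub>M B) (weight c))"
  proof (rule finite_measureI)
    have "emeasure (density (B \<Otimes>\<^sub>M B) (weight c)) (space (B \<Otimes>\<^sub>M B)) =
      (\<integral>\<^sup>+p. ennreal (weight c p) * indicator (space (B \<Otimes>\<^sub>M B)) p \<partial>(B \<Otimes>\<^sub>M B))"
      using weight_measurable by (intro emeasure_density) auto
    also have "\<dots> \<le> (\<integral>\<^sup>+p. 1 \<partial>(B \<Otimes>\<^sub>M B))"
      by (intro nn_integral_mono) (auto simp: indicator_def weight_bounds)
    finally show "emeasure (density (B \<Otimes>\<^sub>M B) (weight c)) (space (density (B \<Otimes>\<^sub>M B) (weight c))) \<noteq> \<infinity>"
      using BB.P.emeasure_space_1 by (auto simp: top_unique)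
  qed
  then show ?thesis unfolding pair_law_def
    by (rule finite_measure.finite_measure_distr) (use PhiPair_measurable[of u, OF u] in simp)
qed

lemma pair_law_support:
  assumes u: "\<And>n. u n \<in> space M" shows "AE v in pair_law c u. \<forall>i. 0 \<le> v i \<and> v i \<le> 1"
proof -
  have [measurable]: "(\<lambda>x::bool \<times> nat \<Rightarrow> real. x i) \<in> borel_measurable borel" for i
    by (rule borel_measurable_coordinate)
  have S: "{x :: bool \<times> nat \<Rightarrow> real \<in> space borel. \<forall>i. 0 \<le> x i \<and> x i \<le> 1} \<in> sets borel"
    by measurable
  have m: "PhiPair u \<in> borel_measurable (density (B \<Otimes>\<^sub>M B) (weight c))" using PhiPair_measurable[of u, OF u] by simp
  have "AE p in density (B \<Otimes>\<^sub>M B) (weight c). \<forall>i. 0 \<le> PhiPair u p i \<and> PhiPair u p i \<le> 1"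
    by (rule AE_I2) (use PhiPair_bounds[of u, OF u] in simp)
  then show ?thesis unfolding pair_law_def AE_distr_iff[OF m S] .
qed

lemma pair_law_eqI:
  assumes \<rho>: "\<rho> \<in> space SB" "\<rho>' \<in> space SB" and eq: "\<And>F. rooted_graph F \<Longrightarrow> rdens F \<rho> = rdens F \<rho>'"
  shows "pair_law c (\<lambda>n. \<rho> (Suc (n + k))) = pair_law c (\<lambda>n. \<rho>' (Suc (n + k)))"
proof (rule measure_eqI_moments)
  have u: "\<And>n. \<rho> (Suc (n + k)) \<in> space M" "\<And>n. \<rho>' (Suc (n + k)) \<in> space M" using \<rho> by (simp_all add: space_SB)
  show "finite_measure (pair_law c (\<lambda>n. \<rho> (Suc (n + k))))" "finite_measure (pair_law c (\<lambda>n. \<rho>' (Suc (n + k))))"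
    by (rule finite_measure_pair_law, rule u)+
  show "AE v in pair_law c (\<lambda>n. \<rho> (Suc (n + k))). \<forall>i. 0 \<le> v i \<and> v i \<le> 1"
    "AE v in pair_law c (\<lambda>n. \<rho>' (Suc (n + k))). \<forall>i. 0 \<le> v i \<and> v i \<le> 1"
    by (rule pair_law_support, rule u)+
  show "(\<integral>v. (\<Prod>i\<leftarrow>js. v i) \<partial>pair_law c (\<lambda>n. \<rho> (Suc (n + k)))) =
    (\<integral>v. (\<Prod>i\<leftarrow>js. v i) \<partial>pair_law c (\<lambda>n. \<rho>' (Suc (n + k))))" for js
    using pair_law_moment_rooted[where js=js and c=c and k=k] \<rho> eq by metis
qed (simp_all add: pair_law_def)

lemma emeasure_pair_law:
  assumes u: "\<And>n. u n \<in> space M" and C: "C1 \<in> sets borel" "C2 \<in> sets borel"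
  shows "emeasure (pair_law c u) {v. (\<lambda>n. v (True, n)) \<in> C1 \<and> (\<lambda>n. v (False, n)) \<in> C2} =
    emeasure (density (B \<Otimes>\<^sub>M B) (weight c)) ((Phi u -` C1 \<inter> space M) \<times> (Phi u -` C2 \<inter> space M))"
proof -
  have sec: "(\<lambda>v::bool \<times> nat \<Rightarrow> real. \<lambda>n. v (t, n)) \<in> borel_measurable borel" for t
    by (rule measurable_coordinatewise_then_product) (rule borel_measurable_coordinate)
  let ?S = "{v. (\<lambda>n. v (True, n)) \<in> C1 \<and> (\<lambda>n. v (False, n)) \<in> C2}"
  have "?S = ((\<lambda>v n. v (True, n)) -` C1 \<inter> space borel) \<inter> ((\<lambda>v n. v (False, n)) -` C2 \<inter> space borel)"
    by auto
  also have "\<dots> \<in> sets borel" by (intro sets.Int measurable_sets[OF sec] C)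
  finally have S: "?S \<in> sets borel" .
  have m: "PhiPair u \<in> borel_measurable (density (B \<Otimes>\<^sub>M B) (weight c))" using PhiPair_measurable[of u, OF u] by simp
  have "PhiPair u -` ?S \<inter> space (density (B \<Otimes>\<^sub>M B) (weight c)) = (Phi u -` C1 \<inter> space M) \<times> (Phi u -` C2 \<inter> space M)"
    by (auto simp: PhiPair_def Phi_def space_pair_measure)
  then show ?thesis unfolding pair_law_def using emeasure_distr[OF m S] by simp
qed

text \<open>With the second point unrestricted, the unweighted pair law reduces to its first
  marginal, the law of \<open>Phi u\<close>.\<close>

lemma measure_Phi_eq:
  assumes u: "\<And>n. u n \<in> space M" "\<And>n. u' n \<in> space M" and eq: "pair_law False u = pair_law False u'"
    and C: "C \<in> sets borel"
  shows "emeasure B (Phi u -` C \<inter> space M) = emeasure B (Phi u' -` C \<inter> space M)"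
proof -
  have w: "density (B \<Otimes>\<^sub>M B) (weight False) = B \<Otimes>\<^sub>M B"
    using density_1[of "B \<Otimes>\<^sub>M B"] by (simp add: weight_def)
  have "emeasure (pair_law False v) {v. (\<lambda>n. v (True, n)) \<in> C \<and> (\<lambda>n. v (False, n)) \<in> UNIV} =
    emeasure B (Phi v -` C \<inter> space M)" if v: "\<And>n. v n \<in> space M" for v
  proof -
    have "Phi v -` C \<inter> space M \<in> sets B" using measurable_sets[OF Phi_measurable[of v, OF v] C] by simp
    moreover have "space M \<in> sets B" using sets.top[of B] by simp
    ultimately have "emeasure (B \<Otimes>\<^sub>M B) ((Phi v -` C \<inter> space M) \<times> space M) = emeasure B (Phi v -` C \<inter> space M)"
      using B.emeasure_space_1 by (simp add: B.emeasure_pair_measure_Times)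
    then show ?thesis using emeasure_pair_law[of v, OF v C, of UNIV False] by (simp add: w)
  qed
  from this[of u, OF u(1)] this[of u', OF u(2)] eq show ?thesis by simp
qed

end


section \<open>Construction of the automorphism\<close>

context pure_graphon_space
begin

text \<open>\<open>Phi u\<close> and \<open>Phi u'\<close> have the same law. Sup-norm balls around a point of the image of
  \<open>Phi u\<close> have positive measure for this law by full support, hence they meet the image of
  \<open>Phi u'\<close>, and by completeness the point lies in that image.\<close>

lemma Phi_image:
  assumes u: "dense_seq u" and u': "dense_seq u'" and eq: "pair_law False u = pair_law False u'"
    and x: "x \<in> space M"
  shows "\<exists>y\<in>space M. Phi u' y = Phi u x"
proof -
  note us = dense_seq_space[OF u] and us' = dense_seq_space[OF u']
  have "\<exists>y. y \<in> space M \<and> (\<forall>i. \<bar>K y (u' i) - K x (u i)\<bar> \<le> 1 / real (Suc n))" for n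
  proof -
    let ?C = "{v. \<forall>i. \<bar>v i - Phi u x i\<bar> \<le> 1 / real (Suc n)}"
    have C: "?C \<in> sets borel" by (rule closed_sup_ball_borel)
    have sub: "J.mball x (1 / real (Suc n)) \<subseteq> Phi u -` ?C \<inter> space M"
    proof
      fix y assume y: "y \<in> J.mball x (1 / real (Suc n))"
      then have yM: "y \<in> space M" and "rdist x y < 1 / real (Suc n)" by auto
      then have "\<bar>K y (u i) - K x (u i)\<bar> \<le> 1 / real (Suc n)" for i
        using K_diff_le[OF x yM us[of i]] by linarith
      then show "y \<in> Phi u -` ?C \<inter> space M" using yM by (simp add: Phi_def)
    qed
    have "Phi u -` ?C \<inter> space M \<in> sets B" using measurable_sets[OF Phi_measurable[of u, OF us] C] by simp
    then have "0 < measure B (Phi u -` ?C \<inter> space M)"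
      using ball_positive[OF x, of "1 / real (Suc n)"] B.finite_measure_mono[OF sub] by simp
    then have "emeasure B (Phi u' -` ?C \<inter> space M) \<noteq> 0"
      unfolding measure_Phi_eq[OF us us' eq C, symmetric] by (simp add: B.emeasure_eq_measure)
    then have "Phi u' -` ?C \<inter> space M \<noteq> {}" by (intro notI) (simp only: emeasure_empty)
    then obtain y where "y \<in> Phi u' -` ?C \<inter> space M" by blast
    then show ?thesis by (intro exI[of _ y]) (simp add: Phi_def)
  qed
  then obtain y where y: "\<And>n. y n \<in> space M" "\<And>n i. \<bar>K (y n) (u' i) - K x (u i)\<bar> \<le> 1 / real (Suc n)"
    by metis
  have sq: "(rdist (y n) (y m))\<^sup>2 \<le> 2 * (1 / real (Suc n) + 1 / real (Suc m))" for n m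
  proof (rule rdist_squared_le_sup[OF u' y(1) y(1)])
    show "\<bar>K (y n) (u' i) - K (y m) (u' i)\<bar> \<le> 1 / real (Suc n) + 1 / real (Suc m)" for i
      using y(2)[of n i] y(2)[of m i] by linarith
  qed
  have "J.MCauchy y"
    unfolding J.MCauchy_def
  proof (intro conjI allI impI)
    show "range y \<subseteq> space M" using y(1) by auto
    fix \<epsilon> :: real assume "\<epsilon> > 0"
    \<comment> \<open>From index \<open>N\<close> on, the bound in \<open>sq\<close> is at most
      \<open>4 / real (Suc N)\<close>; hence the quarter.\<close>
    then have "0 < \<epsilon>\<^sup>2 / 4" by simp
    then obtain N where N: "1 / real (Suc N) < \<epsilon>\<^sup>2 / 4" by (rule nat_approx_posE)
    have "rdist (y n) (y m) < \<epsilon>" if "N \<le> n" "N \<le> m" for n m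
    proof -
      have "1 / real (Suc n) + 1 / real (Suc m) \<le> 1 / real (Suc N) + 1 / real (Suc N)"
        using that by (intro add_mono) (simp_all add: frac_le)
      also have "\<dots> < \<epsilon>\<^sup>2 / 4 + \<epsilon>\<^sup>2 / 4" by (intro add_strict_mono N)
      finally have "2 * (1 / real (Suc n) + 1 / real (Suc m)) < \<epsilon>\<^sup>2" by simp
      with sq[of n m] have "(rdist (y n) (y m))\<^sup>2 < \<epsilon>\<^sup>2" by (rule le_less_trans)
      then show ?thesis using \<open>\<epsilon> > 0\<close> by (simp add: power2_less_imp_less)
    qed
    then show "\<exists>N. \<forall>n n'. N \<le> n \<longrightarrow> N \<le> n' \<longrightarrow> rdist (y n) (y n') < \<epsilon>" by blast
  qed
  then obtain l where "limitin J.mtopology y l sequentially"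
    using pure unfolding pure_graphon_def J.mcomplete_def by blast
  then have l: "l \<in> space M" and dl: "(\<lambda>n. rdist (y n) l) \<longlonglongrightarrow> 0"
    by (auto simp: J.limitin_metric_dist_null)
  have "K l (u' i) = K x (u i)" for i
  proof -
    have "(\<lambda>n. K (y n) (u' i) - K l (u' i)) \<longlonglongrightarrow> 0"
      by (rule Lim_null_comparison[OF _ dl]) (simp add: K_diff_le y(1) l us')
    then have 1: "(\<lambda>n. K (y n) (u' i)) \<longlonglongrightarrow> K l (u' i)" by (rule LIM_zero_cancel)
    have "(\<lambda>n. K (y n) (u' i) - K x (u i)) \<longlonglongrightarrow> 0"
      by (rule Lim_null_comparison[OF _ LIMSEQ_inverse_real_of_nat])
        (use y(2) in \<open>simp add: inverse_eq_divide\<close>)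
    then have "(\<lambda>n. K (y n) (u' i)) \<longlonglongrightarrow> K x (u i)" by (rule LIM_zero_cancel)
    from LIMSEQ_unique[OF 1 this] show ?thesis .
  qed
  then show ?thesis using l by (intro bexI[of _ l]) (simp_all add: Phi_def)
qed

text \<open>A map that preserves the measure pulls null sets back to null sets and therefore passes
  to the completion, which is \<open>M\<close>.\<close>

lemma distr_M_if_distr_B:
  assumes m: "\<phi> \<in> measurable B B" and d: "distr B B \<phi> = B"
  shows "\<phi> \<in> measurable M M" "distr M M \<phi> = M"
proof -
  have mMB: "\<phi> \<in> measurable M B" by (rule measurable_B_M[OF m])
  have dMB: "distr M B \<phi> = B"
  proof (rule measure_eqI)
    fix A assume "A \<in> sets (distr M B \<phi>)"
    then have A: "A \<in> sets B" by simp
    have "emeasure (distr M B \<phi>) A = emeasure M (\<phi> -` A \<inter> space M)" by (rule emeasure_distr[OF mMB A])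
    also have "\<dots> = emeasure B (\<phi> -` A \<inter> space M)"
      using emeasure_B[OF measurable_sets[OF m A]] by simp
    also have "\<dots> = emeasure (distr B B \<phi>) A" using emeasure_distr[OF m A] by simp
    finally show "emeasure (distr M B \<phi>) A = emeasure B A" unfolding d .
  qed simp
  show "\<phi> \<in> measurable M M"
    using measurable_completion2[OF mMB] unfolding dMB completion_B by simp
  show "distr M M \<phi> = M"
    using completion_distr_eq[OF mMB] unfolding dMB completion_B by simp
qed

lemma measure_eqI_rectangles:
  assumes "finite_measure \<mu>" and sets: "sets \<mu> = sets (B \<Otimes>\<^sub>M B)" "sets \<nu> = sets (B \<Otimes>\<^sub>M B)"
    and eq: "\<And>A1 A2. A1 \<in> sets B \<Longrightarrow> A2 \<in> sets B \<Longrightarrow> emeasure \<mu> (A1 \<times> A2) = emeasure \<nu> (A1 \<times> A2)"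
  shows "\<mu> = \<nu>"
proof (rule measure_eqI_generator_eq[where E="{a \<times> b | a b. a \<in> sets B \<and> b \<in> sets B}"
      and \<Omega>="space B \<times> space B" and A="\<lambda>_. space B \<times> space B"])
  interpret \<mu>: finite_measure \<mu> by fact
  show "Int_stable {a \<times> b | a b. a \<in> sets B \<and> b \<in> sets B}" by (rule Int_stable_pair_measure_generator)
  show "{a \<times> b | a b. a \<in> sets B \<and> b \<in> sets B} \<subseteq> Pow (space B \<times> space B)"
    using sets.sets_into_space[of _ B] by auto
  show "sets \<mu> = sigma_sets (space B \<times> space B) {a \<times> b | a b. a \<in> sets B \<and> b \<in> sets B}"
    "sets \<nu> = sigma_sets (space B \<times> space B) {a \<times> b | a b. a \<in> sets B \<and> b \<in> sets B}"
    using sets by (simp_all only: sets_pair_measure)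
  show "emeasure \<mu> X = emeasure \<nu> X" if "X \<in> {a \<times> b | a b. a \<in> sets B \<and> b \<in> sets B}" for X
    using that eq by blast
  show "range (\<lambda>_::nat. space B \<times> space B) \<subseteq> {a \<times> b | a b. a \<in> sets B \<and> b \<in> sets B}"
    using sets.top[of B] by blast
  show "emeasure \<mu> (space B \<times> space B) \<noteq> \<infinity>" by simp
qed simp

lemma ex_automorphism:
  assumes u: "dense_seq u" and u': "dense_seq u'" and eq: "\<And>c. pair_law c u = pair_law c u'"
  shows "\<exists>\<phi>. graphon_automorphism M W \<phi> \<and> (\<forall>x\<in>space M. \<phi> x \<in> space M \<and> Phi u' (\<phi> x) = Phi u x)"
proof -
  note us = dense_seq_space[OF u] and us' = dense_seq_space[OF u']
  define \<phi> where "\<phi> x = (SOME y. y \<in> space M \<and> Phi u' y = Phi u x)" for x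
  have \<phi>: "\<phi> x \<in> space M" "Phi u' (\<phi> x) = Phi u x" if "x \<in> space M" for x
  proof -
    have "\<exists>y. y \<in> space M \<and> Phi u' y = Phi u x" using Phi_image[OF u u' eq that] by blast
    from someI_ex[OF this] show "\<phi> x \<in> space M" "Phi u' (\<phi> x) = Phi u x" by (simp_all add: \<phi>_def)
  qed
  have bij: "bij_betw \<phi> (space M) (space M)"
    unfolding bij_betw_def
  proof (intro conjI inj_onI equalityI subsetI)
    fix x y assume xy: "x \<in> space M" "y \<in> space M" "\<phi> x = \<phi> y"
    then have "Phi u x = Phi u y" using \<phi>(2)[of x] \<phi>(2)[of y] by simp
    then show "x = y" by (rule Phi_inj[OF u xy(1,2)])
  next
    fix y assume "y \<in> \<phi> ` space M"
    then show "y \<in> space M" using \<phi>(1) by auto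
  next
    fix y assume y: "y \<in> space M"
    obtain x where x: "x \<in> space M" "Phi u x = Phi u' y" using Phi_image[OF u' u eq[symmetric] y] by blast
    then have "\<phi> x = y" using \<phi>[OF x(1)] by (intro Phi_inj[OF u' _ y]) simp_all
    then show "y \<in> \<phi> ` space M" using x(1) by blast
  qed
  \<comment> \<open>All Borel sets are preimages under \<open>Phi u'\<close>, and
    \<open>\<phi>\<close> pulls these back to preimages under \<open>Phi u\<close>. Measurability
    and preservation of measure both reduce to this identity.\<close>
  have vim: "\<phi> -` (Phi u' -` C \<inter> space M) \<inter> space M = Phi u -` C \<inter> space M" for C
    using \<phi> by auto
  have mB: "\<phi> \<in> measurable B B"
  proof (rule measurableI)
    show "\<phi> x \<in> space B" if "x \<in> space B" for x using \<phi>(1) that by simp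
    fix A assume "A \<in> sets B"
    then obtain C where C: "C \<in> sets borel" "A = Phi u' -` C \<inter> space M" using sets_B_Phi[OF u'] by blast
    show "\<phi> -` A \<inter> space B \<in> sets B"
      unfolding C(2) space_B vim using measurable_sets[OF Phi_measurable[of u, OF us] C(1)] by simp
  qed
  have dB: "distr B B \<phi> = B"
  proof (rule measure_eqI)
    fix A assume "A \<in> sets (distr B B \<phi>)"
    then have A: "A \<in> sets B" by simp
    then obtain C where C: "C \<in> sets borel" "A = Phi u' -` C \<inter> space M" using sets_B_Phi[OF u'] by blast
    have "emeasure (distr B B \<phi>) A = emeasure B (Phi u -` C \<inter> space M)"
      unfolding emeasure_distr[OF mB A] unfolding C(2) space_B vim ..
    also have "\<dots> = emeasure B A" unfolding C(2) by (rule measure_Phi_eq[OF us us' eq C(1)])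
    finally show "emeasure (distr B B \<phi>) A = emeasure B A" .
  qed simp
  define \<phi>2 where "\<phi>2 = (\<lambda>(x, y). (\<phi> x, \<phi> y))"
  have m2: "\<phi>2 \<in> measurable (B \<Otimes>\<^sub>M B) (B \<Otimes>\<^sub>M B)"
    unfolding \<phi>2_def using mB by measurable
  have d2: "distr (B \<Otimes>\<^sub>M B) (B \<Otimes>\<^sub>M B) \<phi>2 = B \<Otimes>\<^sub>M B"
    unfolding \<phi>2_def
    using pair_measure_distr[OF mB mB] B.sigma_finite_measure_axioms by (simp add: dB)
  have wm: "(\<lambda>p. ennreal (weight True p)) \<in> borel_measurable (B \<Otimes>\<^sub>M B)"
    using weight_measurable by simp
  have wm2: "(\<lambda>p. ennreal (weight True (\<phi>2 p))) \<in> borel_measurable (B \<Otimes>\<^sub>M B)"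
    by (rule measurable_compose[OF m2 wm])
  \<comment> \<open>Equality of the weighted laws says that \<open>A1 \<times> A2\<close> has the
    same weighted mass as its counterpart \<open>?A1 \<times> ?A2\<close> in the coordinates of
    \<open>u'\<close>, whose preimage under \<open>\<phi>2\<close> is \<open>A1 \<times> A2\<close>.
    Hence \<open>weight True\<close> and its composition with \<open>\<phi>2\<close> are densities
    of the same measure.\<close>
  have dens: "density (B \<Otimes>\<^sub>M B) (weight True) = density (B \<Otimes>\<^sub>M B) (\<lambda>p. weight True (\<phi>2 p))"
  proof (rule measure_eqI_rectangles)
    show "finite_measure (density (B \<Otimes>\<^sub>M B) (weight True))"
    proof (rule finite_measureI)
      have "finite_measure (pair_law True u)" by (rule finite_measure_pair_law) (rule us)
      then have "emeasure (pair_law True u) UNIV \<noteq> \<infinity>" by (simp add: finite_measure.emeasure_finite)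
      moreover have "emeasure (pair_law True u) UNIV = emeasure (density (B \<Otimes>\<^sub>M B) (weight True)) (space (B \<Otimes>\<^sub>M B))"
        unfolding pair_law_def using PhiPair_measurable[of u, OF us] by (subst emeasure_distr) simp_all
      ultimately show "emeasure (density (B \<Otimes>\<^sub>M B) (weight True)) (space (density (B \<Otimes>\<^sub>M B) (weight True))) \<noteq> \<infinity>"
        by simp
    qed
    fix A1 A2 assume A: "A1 \<in> sets B" "A2 \<in> sets B"
    obtain C1 where C1: "C1 \<in> sets borel" "A1 = Phi u -` C1 \<inter> space M" using sets_B_Phi[OF u A(1)] by blast
    obtain C2 where C2: "C2 \<in> sets borel" "A2 = Phi u -` C2 \<inter> space M" using sets_B_Phi[OF u A(2)] by blast
    let ?A1 = "Phi u' -` C1 \<inter> space M" and ?A2 = "Phi u' -` C2 \<inter> space M"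
    have A': "?A1 \<in> sets B" "?A2 \<in> sets B"
      using measurable_sets[OF Phi_measurable[of u', OF us'] C1(1)] measurable_sets[OF Phi_measurable[of u', OF us'] C2(1)]
      by simp_all
    have AA: "A1 \<times> A2 \<in> sets (B \<Otimes>\<^sub>M B)" and AA': "?A1 \<times> ?A2 \<in> sets (B \<Otimes>\<^sub>M B)" using A A' by auto
    have ind: "indicator (?A1 \<times> ?A2) (\<phi>2 p) = (indicator (A1 \<times> A2) p :: ennreal)" if "p \<in> space (B \<Otimes>\<^sub>M B)" for p
      using that \<phi> by (auto simp: \<phi>2_def C1(2) C2(2) indicator_def space_pair_measure)
    have "emeasure (density (B \<Otimes>\<^sub>M B) (weight True)) (A1 \<times> A2) =
      emeasure (density (B \<Otimes>\<^sub>M B) (weight True)) (?A1 \<times> ?A2)"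
      unfolding C1(2) C2(2) emeasure_pair_law[of u, OF us C1(1) C2(1), symmetric]
        emeasure_pair_law[of u', OF us' C1(1) C2(1), symmetric] eq ..
    also have "\<dots> = (\<integral>\<^sup>+p. ennreal (weight True p) * indicator (?A1 \<times> ?A2) p \<partial>distr (B \<Otimes>\<^sub>M B) (B \<Otimes>\<^sub>M B) \<phi>2)"
      unfolding d2 by (rule emeasure_density[OF wm AA'])
    also have "\<dots> = (\<integral>\<^sup>+p. ennreal (weight True (\<phi>2 p)) * indicator (?A1 \<times> ?A2) (\<phi>2 p) \<partial>(B \<Otimes>\<^sub>M B))"
      by (rule nn_integral_distr[OF m2]) (use wm AA' in measurable)
    also have "\<dots> = (\<integral>\<^sup>+p. ennreal (weight True (\<phi>2 p)) * indicator (A1 \<times> A2) p \<partial>(B \<Otimes>\<^sub>M B))"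
      by (rule nn_integral_cong) (simp add: ind)
    also have "\<dots> = emeasure (density (B \<Otimes>\<^sub>M B) (\<lambda>p. weight True (\<phi>2 p))) (A1 \<times> A2)"
      by (rule emeasure_density[OF wm2 AA, symmetric])
    finally show "emeasure (density (B \<Otimes>\<^sub>M B) (weight True)) (A1 \<times> A2) =
      emeasure (density (B \<Otimes>\<^sub>M B) (\<lambda>p. weight True (\<phi>2 p))) (A1 \<times> A2)" .
  qed simp_all
  have "AE p in B \<Otimes>\<^sub>M B. ennreal (weight True p) = ennreal (weight True (\<phi>2 p))"
    by (rule BB.P.density_unique[OF wm wm2 dens])
  then have "AE p in B \<Otimes>\<^sub>M B. W2 (\<phi> (fst p)) (\<phi> (snd p)) = W2 (fst p) (snd p)"
    by eventually_elim (simp add: weight_def \<phi>2_def split_beta W2_bounds)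
  from BB.AE_pair[OF this] have good: "AE x in B. AE y in B. W2 (\<phi> x) (\<phi> y) = W2 x y" by simp
  \<comment> \<open>The integral of \<open>?d\<close> is shown to vanish. This is possible at every
    \<open>x\<close>, and not only at almost every one, because both sides depend continuously on
    \<open>x\<close> in mean.\<close>
  have all: "AE y in B. W2 (\<phi> x) (\<phi> y) = W2 x y" if x: "x \<in> space M" for x
  proof -
    let ?d = "\<lambda>y. \<bar>W2 (\<phi> x) (\<phi> y) - W2 x y\<bar>"
    have W2\<phi>: "(\<lambda>y. W2 v (\<phi> y)) \<in> borel_measurable B" if "v \<in> space M" for v
      by (rule measurable_compose[OF mB W2_section[OF that]])
    have dm: "?d \<in> borel_measurable B" using W2\<phi>[OF \<phi>(1)[OF x]] W2_section[OF x] by measurable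
    have int1: "integrable B f" if "f \<in> borel_measurable B" "\<And>y. \<bar>f y\<bar> \<le> 1" for f :: "'a \<Rightarrow> real"
      by (rule B.integrable_const_bound[where B=1, OF AE_I2 that(1)]) (simp add: that(2))
    have bd: "\<bar>\<bar>W2 p q - W2 s t\<bar>\<bar> \<le> 1" for p q s t
      using W2_bounds[of p q] W2_bounds[of s t] by linarith
    \<comment> \<open>The exceptional null set contains no ball, so \<open>x\<close> is a limit of points \<open>v\<close> outside it.\<close>
    have small: "integral\<^sup>L B ?d \<le> sqrt (2 * e) + e" if e: "e > 0" for e
    proof -
      have "\<exists>v\<in>J.mball x e. AE y in B. W2 (\<phi> v) (\<phi> y) = W2 v y"
      proof (rule ccontr)
        assume "\<not> ?thesis"
        then have "AE v in B. v \<notin> J.mball x e" using good by (auto elim: eventually_mono)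
        then have "measure B (J.mball x e) = 0"
          using B.prob_eq_0[OF ball_sets_B] by simp
        then show False using ball_positive[OF x e] by simp
      qed
      then obtain v where v: "v \<in> space M" "rdist x v < e" and vg: "AE y in B. W2 (\<phi> v) (\<phi> y) = W2 v y" by auto
      have m1: "(\<lambda>y. \<bar>W2 (\<phi> x) (\<phi> y) - W2 (\<phi> v) (\<phi> y)\<bar>) \<in> borel_measurable B"
        using W2\<phi>[OF \<phi>(1)[OF x]] W2\<phi>[OF \<phi>(1)[OF v(1)]] by measurable
      have m2: "(\<lambda>y. \<bar>W2 x y - W2 v y\<bar>) \<in> borel_measurable B"
        using W2_section[OF x] W2_section[OF v(1)] by measurable
      have m3: "(\<lambda>y. \<bar>W2 (\<phi> x) y - W2 (\<phi> v) y\<bar>) \<in> borel_measurable B"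
        using W2_section[OF \<phi>(1)[OF x]] W2_section[OF \<phi>(1)[OF v(1)]] by measurable
      have "integral\<^sup>L B ?d \<le> (\<integral>y. \<bar>W2 (\<phi> x) (\<phi> y) - W2 (\<phi> v) (\<phi> y)\<bar> + \<bar>W2 x y - W2 v y\<bar> \<partial>B)"
      proof (rule integral_mono_AE)
        show "integrable B ?d" by (rule int1[OF dm bd])
        show "integrable B (\<lambda>y. \<bar>W2 (\<phi> x) (\<phi> y) - W2 (\<phi> v) (\<phi> y)\<bar> + \<bar>W2 x y - W2 v y\<bar>)"
          by (intro Bochner_Integration.integrable_add int1[OF m1 bd] int1[OF m2 bd])
        show "AE y in B. ?d y \<le> \<bar>W2 (\<phi> x) (\<phi> y) - W2 (\<phi> v) (\<phi> y)\<bar> + \<bar>W2 x y - W2 v y\<bar>"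
          using vg by eventually_elim linarith
      qed
      also have "\<dots> = (\<integral>y. \<bar>W2 (\<phi> x) (\<phi> y) - W2 (\<phi> v) (\<phi> y)\<bar> \<partial>B) + rdist x v"
        unfolding rdist_eq[OF x v(1)]
        by (rule Bochner_Integration.integral_add[OF int1[OF m1 bd] int1[OF m2 bd]])
      also have "(\<integral>y. \<bar>W2 (\<phi> x) (\<phi> y) - W2 (\<phi> v) (\<phi> y)\<bar> \<partial>B) = rdist (\<phi> x) (\<phi> v)"
        unfolding rdist_eq[OF \<phi>(1)[OF x] \<phi>(1)[OF v(1)]]
        using integral_distr[OF mB m3] unfolding dB by (rule sym)
      also have "\<dots> + rdist x v \<le> sqrt (2 * e) + e"
      proof -
        \<comment> \<open>That \<open>\<phi>\<close> is an isometry is not yet known. It preserves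
          the coordinates given by \<open>K\<close>, and this yields the weaker modulus of
          continuity \<open>sqrt (2 * e)\<close>.\<close>
        have "\<bar>K (\<phi> x) (u' n) - K (\<phi> v) (u' n)\<bar> \<le> e" for n
          using fun_cong[OF \<phi>(2)[OF x], of n] fun_cong[OF \<phi>(2)[OF v(1)], of n] K_diff_le[OF x v(1) us[of n]] v(2)
          by (simp add: Phi_def)
        from rdist_squared_le_sup[OF u' \<phi>(1)[OF x] \<phi>(1)[OF v(1)] this]
        have "rdist (\<phi> x) (\<phi> v) \<le> sqrt (2 * e)" by (rule real_le_rsqrt)
        then show ?thesis using v(2) by linarith
      qed
      finally show ?thesis .
    qed
    have lim: "((\<lambda>e. sqrt (2 * e) + e) \<longlongrightarrow> sqrt (2 * 0) + 0) (at_right 0)"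
      by (intro tendsto_intros)
    have "integral\<^sup>L B ?d \<le> sqrt (2 * 0) + 0"
      by (rule tendsto_lowerbound[OF lim])
        (auto simp: eventually_at_right_field intro!: exI[of _ 1] small)
    moreover have "0 \<le> integral\<^sup>L B ?d" by (intro integral_nonneg_AE AE_I2) simp
    ultimately have "integral\<^sup>L B ?d = 0" by simp
    then have "AE y in B. ?d y = 0"
      using integral_nonneg_eq_0_iff_AE[OF int1[OF dm bd]] by simp
    then show ?thesis by eventually_elim simp
  qed
  note mdM = distr_M_if_distr_B[OF mB dB]
  have "AE y in M. W (\<phi> x) (\<phi> y) = W x y" if x: "x \<in> space M" for x
  proof -
    have "AE y in distr M M \<phi>. W2 (\<phi> x) y = W (\<phi> x) y"
      unfolding mdM(2) by (rule W2_AE[OF \<phi>(1)[OF x]])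
    from AE_distrD[OF mdM(1) this] all[OF x, unfolded AE_B_iff] W2_AE[OF x]
    show ?thesis by eventually_elim simp
  qed
  then have "graphon_automorphism M W \<phi>"
    using bij mdM by (simp add: graphon_automorphism_def measure_preserving_bij_def)
  then show ?thesis using \<phi> by blast
qed

lemma automorphism_if_equal_densities:
  assumes a: "\<forall>i\<in>{1..k}. a i \<in> space M" and b: "\<forall>i\<in>{1..k}. b i \<in> space M"
    and eq: "\<And>V E. labeled_simple_graph k V E \<Longrightarrow> labels_nonadjacent k E \<Longrightarrow>
       restricted_hom_density M W k V E a = restricted_hom_density M W k V E b"
  shows "\<exists>\<phi>. graphon_automorphism M W \<phi> \<and> (\<forall>i\<in>{1..k}. \<phi> (a i) = b i)"
proof -
  obtain z z' where z: "z \<in> space SB" "z' \<in> space SB"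
    and dz: "\<forall>x\<in>space M. \<forall>e>0. \<exists>p>k. rdist x (z p) < e" and dz': "\<forall>x\<in>space M. \<forall>e>0. \<exists>p>k. rdist x (z' p) < e"
    and rd: "\<forall>E. rooted_graph E \<longrightarrow> rdens E (override_on z a {1..k}) = rdens E (override_on z' b {1..k})"
    using ex_dense_sequences_same_densities[OF a b eq] by blast
  define \<rho> where "\<rho> = override_on z a {1..k}"
  define \<rho>' where "\<rho>' = override_on z' b {1..k}"
  have \<rho>: "\<rho> \<in> space SB" "\<rho>' \<in> space SB" using z a b by (auto simp: \<rho>_def \<rho>'_def space_SB override_on_def)
  \<comment> \<open>The labels occupy positions 1 to \<open>k\<close>; from \<open>Suc k\<close> on,
    \<open>\<rho>\<close> is the dense sequence \<open>z\<close> itself.\<close>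
  define u where "u n = \<rho> (Suc (n + k))" for n
  define u' where "u' n = \<rho>' (Suc (n + k))" for n
  have uz: "u n = z (Suc (n + k))" "u' n = z' (Suc (n + k))" for n
    by (simp_all add: u_def u'_def \<rho>_def \<rho>'_def)
  have dense: "dense_seq v" if w: "w \<in> space SB" "\<And>n. v n = w (Suc (n + k))"
    "\<forall>x\<in>space M. \<forall>e>0. \<exists>p>k. rdist x (w p) < e" for v w
    unfolding dense_seq_def
  proof (intro conjI allI ballI impI)
    show "v n \<in> space M" for n using w(1,2) by (simp add: space_SB)
    fix x e assume "x \<in> space M" "0 < (e::real)"
    then obtain p where p: "p > k" "rdist x (w p) < e" using w(3) by blast
    then have "v (p - Suc k) = w p" using w(2) by simp
    then show "\<exists>n. rdist x (v n) < e" using p(2) by metis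
  qed
  have u: "dense_seq u" by (rule dense[OF z(1) uz(1) dz])
  have u': "dense_seq u'" by (rule dense[OF z(2) uz(2) dz'])
  have law: "pair_law c u = pair_law c u'" for c
    using pair_law_eqI[OF \<rho>, of c k] rd unfolding u_def[abs_def] u'_def[abs_def] \<rho>_def \<rho>'_def by blast
  obtain \<phi> where \<phi>: "graphon_automorphism M W \<phi>" "\<And>x. x \<in> space M \<Longrightarrow> \<phi> x \<in> space M \<and> Phi u' (\<phi> x) = Phi u x"
    using ex_automorphism[OF u u' law] by blast
  have "\<phi> (a i) = b i" if i: "i \<in> {1..k}" for i
  proof -
    \<comment> \<open>The path from label \<open>i\<close> to root \<open>Suc (n + k)\<close> has
      the same density on both sides. So \<open>b i\<close> has the \<open>Phi u'\<close>
      coordinates that \<open>\<phi> (a i)\<close> has by construction, and these determine the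
      point.\<close>
    have "K (a i) (u n) = K (b i) (u' n)" for n
    proof -
      let ?E = "{(Inl i, 0), (Inl (Suc (n + k)), 0)}"
      have ne: "i \<noteq> Suc (n + k)" using i by auto
      have "\<rho> i = a i" "\<rho>' i = b i" using i by (simp_all add: \<rho>_def \<rho>'_def)
      then show ?thesis
        using rdens_K[OF ne \<rho>(1)] rdens_K[OF ne \<rho>(2)] rd rooted_graph_K[of i "Suc (n + k)"]
        by (simp add: u_def u'_def \<rho>_def \<rho>'_def)
    qed
    then have "Phi u' (b i) = Phi u (a i)" by (simp add: Phi_def)
    then show ?thesis using \<phi>(2)[of "a i"] a b i by (intro Phi_inj[OF u']) auto
  qed
  with \<phi>(1) show ?thesis by blast
qed

end

theorem theorem5p1:
  fixes M :: "'a measure" and W :: "'a \<Rightarrow> 'a \<Rightarrow> real"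
    and k :: nat and a b :: "nat \<Rightarrow> 'a"
  assumes "pure_graphon M W"
    and "\<forall>i\<in>{1..k}. a i \<in> space M"
    and "\<forall>i\<in>{1..k}. b i \<in> space M"
  shows "(\<exists>\<phi>. graphon_automorphism M W \<phi> \<and> (\<forall>i\<in>{1..k}. \<phi> (a i) = b i)) \<longleftrightarrow>
    (\<forall>V E. labeled_simple_graph k V E \<and> labels_nonadjacent k E \<longrightarrow>
       restricted_hom_density M W k V E a = restricted_hom_density M W k V E b)"
proof -
  interpret pure_graphon_space M W by unfold_locales (rule assms(1))
  show ?thesis
  proof
    assume "\<exists>\<phi>. graphon_automorphism M W \<phi> \<and> (\<forall>i\<in>{1..k}. \<phi> (a i) = b i)"
    then obtain \<phi> where "graphon_automorphism M W \<phi>" "\<forall>i\<in>{1..k}. \<phi> (a i) = b i" by blast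
    from restricted_hom_density_automorphism[OF this _ _ assms(2)]
    show "\<forall>V E. labeled_simple_graph k V E \<and> labels_nonadjacent k E \<longrightarrow>
       restricted_hom_density M W k V E a = restricted_hom_density M W k V E b" by simp
  next
    assume "\<forall>V E. labeled_simple_graph k V E \<and> labels_nonadjacent k E \<longrightarrow>
       restricted_hom_density M W k V E a = restricted_hom_density M W k V E b"
    then show "\<exists>\<phi>. graphon_automorphism M W \<phi> \<and> (\<forall>i\<in>{1..k}. \<phi> (a i) = b i)"
      by (intro automorphism_if_equal_densities[OF assms(2,3)]) simp
  qed
qed

end
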